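(* Let $K$ be a CM number field whose unit rank is at least $3$. Then $M(K)$ is attained in $\operatorname{Spec}(\overline K)$ and $M(K)$ is an isolated point of $\operatorname{Spec}(\overline K)$. Moreover, the set $\{z\in\overline K : m_{\overline K}(z)=M(K)\}$ is contained in $K$ and is the union of finitely many residue classes modulo $\mathcal O_K$.
   Context: A number field $K$ is CM if it is a totally complex quadratic extension of a totally real number field. $\mathcal O_K$ is the ring of integers, $U_K=\mathcal O_K^*$ the unit group, and the unit rank of $K$ is the rank of $U_K$. Let $r_1$ be the number of real embeddings $\sigma_1,\dots,\sigma_{r_1}$ of $K$ and $r_2$ the number of pairs of conjugate non-real embeddings, with representatives $\sigma_{r_1+1},\dots,\sigma_{r_1+r_2}$. Put $\overline K=K\otimes_{\mathbb Q}\mathbb R$, identified with $\mathbb R^{r_1}\oplus\mathbb C^{r_2}$ via $\theta\otimes s\mapsto (s\sigma_i(\theta))_{1\le i\le r_1+r_2}$; $K$ is viewed inside $\overline K$ by $x\mapsto x\otimes 1$. For $x=(x_i)\in\overline K$ set $N_{\overline K}(x)=\prod_{i=1}^{r_1}x_i\prod_{i=r_1+1}^{r_1+r_2}|x_i|^2$, which extends the field norm $N_K$. For $x\in\overline K$ let $m_{\overline K}(x)=\inf_{y\in x+\mathcal O_K}|N_{\overline K}(y)|$. The inhomogeneous spectrum is $\operatorname{Spec}(\overline K)=\{m_{\overline K}(x):x\in\overline K\}$. The Euclidean minimum is $M(K)=\sup_{x\in K}\inf_{y\in x+\mathcal O_K}|N_K(y)|$ (it is known that $M(K)=\sup_{x\in\overline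 K}m_{\overline K}(x)$). $M(K)$ is said to be attained in $\operatorname{Spec}(\overline K)$ if for every $x\in\overline K$ there exists $y\in x+\mathcal O_K$ with $|N_{\overline K}(y)|\le M(K)$; equivalently, whenever $x\in\overline K$ satisfies $m_{\overline K}(x)=M(K)$, there is $y\in x+\mathcal O_K$ with $|N_{\overline K}(y)|=M(K)$. *)

theory Defs
  imports
    Complex_Main
    "HOL-Library.Extended_Nat"
    "HOL-Computational_Algebra.Polynomial"
    "HOL-Analysis.Isolated"
    "Jordan_Normal_Form.Determinant"
begin

text \<open>A number field is a subset of an ambient field of characteristic 0 (possibly all of it), so
  that a field and its subfields are treated uniformly.\<close>

definition is_subfield :: "'a::field_char_0 set \<Rightarrow> bool" where
  "is_subfield K \<longleftrightarrow> 0 \<in> K \<and> 1 \<in> K \<and>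
     (\<forall>x\<in>K. \<forall>y\<in>K. x + y \<in> K \<and> x - y \<in> K \<and> x * y \<in> K) \<and> (\<forall>x\<in>K. inverse x \<in> K)"

global_interpretation rat_vs: vector_space "\<lambda>(q::rat) (x::'a::field_char_0). of_rat q * x"
  by unfold_locales (simp_all add: algebra_simps of_rat_add of_rat_mult)

definition number_field :: "'a::field_char_0 set \<Rightarrow> bool" where
  "number_field K \<longleftrightarrow> is_subfield K \<and> (\<exists>B. finite B \<and> rat_vs.span B = K)"

text \<open>Only the values on \<^term>\<open>K\<close> of an embedding matter.\<close>

definition is_embedding :: "'a::field_char_0 set \<Rightarrow> ('a \<Rightarrow> complex) \<Rightarrow> bool" where
  "is_embedding K \<tau> \<longleftrightarrow> \<tau> 1 = 1 \<and>
     (\<forall>x\<in>K. \<forall>y\<in>K. \<tau> (x + y) = \<tau> x + \<tau> y \<and> \<tau> (x * y) = \<tau> x * \<tau> y)"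

definition is_real_embedding :: "'a::field_char_0 set \<Rightarrow> ('a \<Rightarrow> complex) \<Rightarrow> bool" where
  "is_real_embedding K \<tau> \<longleftrightarrow> is_embedding K \<tau> \<and> \<tau> ` K \<subseteq> \<real>"

definition is_nonreal_embedding :: "'a::field_char_0 set \<Rightarrow> ('a \<Rightarrow> complex) \<Rightarrow> bool" where
  "is_nonreal_embedding K \<tau> \<longleftrightarrow> is_embedding K \<tau> \<and> \<not> \<tau> ` K \<subseteq> \<real>"

definition totally_real :: "'a::field_char_0 set \<Rightarrow> bool" where
  "totally_real K \<longleftrightarrow> (\<forall>\<tau>. is_embedding K \<tau> \<longrightarrow> is_real_embedding K \<tau>)"

definition totally_complex :: "'a::field_char_0 set \<Rightarrow> bool" where
  "totally_complex K \<longleftrightarrow> (\<forall>\<tau>. is_embedding K \<tau> \<longrightarrow> is_nonreal_embedding K \<tau>)"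

definition quadratic_extension :: "'a::field_char_0 set \<Rightarrow> 'a set \<Rightarrow> bool" where
  "quadratic_extension F K \<longleftrightarrow> F \<subseteq> K \<and>
     (\<exists>e\<^sub>1\<in>K. \<exists>e\<^sub>2\<in>K. \<forall>x\<in>K. \<exists>!(a, b). a \<in> F \<and> b \<in> F \<and> x = a * e\<^sub>1 + b * e\<^sub>2)"

definition CM_field :: "'a::field_char_0 set \<Rightarrow> bool" where
  "CM_field K \<longleftrightarrow> number_field K \<and> totally_complex K \<and>
     (\<exists>F. number_field F \<and> totally_real F \<and> quadratic_extension F K)"

definition ring_of_integers :: "'a::field_char_0 set \<Rightarrow> 'a set" where
  "ring_of_integers K = {x \<in> K. algebraic_int x}"

definition unit_group :: "'a::field_char_0 set \<Rightarrow> 'a set" where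
  "unit_group K = {u \<in> ring_of_integers K. \<exists>v\<in>ring_of_integers K. u * v = 1}"

text \<open>The rank of an abelian group is the largest cardinality of a \<open>\<int>\<close>-linearly independent
  subset; the group here is written multiplicatively.\<close>

definition mult_independent :: "'a::field set \<Rightarrow> bool" where
  "mult_independent S \<longleftrightarrow>
     (\<forall>e::'a \<Rightarrow> int. (\<Prod>u\<in>S. u powi e u) = 1 \<longrightarrow> (\<forall>u\<in>S. e u = 0))"

definition unit_rank :: "'a::field_char_0 set \<Rightarrow> enat" where
  "unit_rank K =
     (SUP S \<in> {S. S \<subseteq> unit_group K \<and> finite S \<and> mult_independent S}. enat (card S))"

text \<open>The field norm is the determinant of multiplication by \<^term>\<open>x\<close> on the rational vector
  space \<^term>\<open>K\<close>; it does not depend on the basis.\<close>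

definition is_rat_basis :: "'a::field_char_0 set \<Rightarrow> 'a list \<Rightarrow> bool" where
  "is_rat_basis K bs \<longleftrightarrow>
     distinct bs \<and> rat_vs.independent (set bs) \<and> rat_vs.span (set bs) = K"

definition mult_mat :: "'a::field_char_0 list \<Rightarrow> 'a \<Rightarrow> rat mat" where
  "mult_mat bs x = mat (length bs) (length bs)
     (\<lambda>(i, j). rat_vs.representation (set bs) (x * bs ! j) (bs ! i))"

definition field_norm :: "'a::field_char_0 set \<Rightarrow> 'a \<Rightarrow> rat" where
  "field_norm K x = det (mult_mat (SOME bs. is_rat_basis K bs) x)"

definition euclidean_minimum :: "'a::field_char_0 set \<Rightarrow> real" where
  "euclidean_minimum K =
     (SUP x\<in>K. INF y\<in>{x + a |a. a \<in> ring_of_integers K}. \<bar>of_rat (field_norm K y)\<bar>)"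

text \<open>\<open>\<sigma> 0, \<dots>, \<sigma> (r\<^sub>1 - 1)\<close> are the real embeddings, and
  \<open>\<sigma> r\<^sub>1, \<dots>, \<sigma> (r\<^sub>1 + r\<^sub>2 - 1)\<close> represent the pairs of conjugate non-real ones.\<close>

definition embedding_system ::
    "'a::field_char_0 set \<Rightarrow> nat \<Rightarrow> nat \<Rightarrow> (nat \<Rightarrow> 'a \<Rightarrow> complex) \<Rightarrow> bool" where
  "embedding_system K r\<^sub>1 r\<^sub>2 \<sigma> \<longleftrightarrow>
     (\<forall>i\<in>{..<r\<^sub>1}. is_real_embedding K (\<sigma> i)) \<and>
     (\<forall>i\<in>{r\<^sub>1..<r\<^sub>1 + r\<^sub>2}. is_nonreal_embedding K (\<sigma> i)) \<and>
     (\<forall>\<tau>. is_real_embedding K \<tau> \<longrightarrow>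
        (\<exists>!i. i \<in> {..<r\<^sub>1} \<and> (\<forall>x\<in>K. \<tau> x = \<sigma> i x))) \<and>
     (\<forall>\<tau>. is_nonreal_embedding K \<tau> \<longrightarrow>
        (\<exists>!i. i \<in> {r\<^sub>1..<r\<^sub>1 + r\<^sub>2} \<and>
              ((\<forall>x\<in>K. \<tau> x = \<sigma> i x) \<or> (\<forall>x\<in>K. \<tau> x = cnj (\<sigma> i x)))))"

text \<open>\<open>K \<otimes> \<real>\<close> as \<open>\<real>\<^bsup>r\<^sub>1\<^esup> \<oplus> \<complex>\<^bsup>r\<^sub>2\<^esup>\<close>: the first \<open>r\<^sub>1\<close> coordinates
  are real and those beyond \<open>r\<^sub>1 + r\<^sub>2\<close> are set to 0.\<close>

definition Kbar :: "nat \<Rightarrow> nat \<Rightarrow> (nat \<Rightarrow> complex) set" where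
  "Kbar r\<^sub>1 r\<^sub>2 = {x. (\<forall>i<r\<^sub>1. x i \<in> \<real>) \<and> (\<forall>i\<ge>r\<^sub>1 + r\<^sub>2. x i = 0)}"

definition to_Kbar ::
    "nat \<Rightarrow> nat \<Rightarrow> (nat \<Rightarrow> 'a \<Rightarrow> complex) \<Rightarrow> 'a::field_char_0 \<Rightarrow> (nat \<Rightarrow> complex)" where
  "to_Kbar r\<^sub>1 r\<^sub>2 \<sigma> x = (\<lambda>i. if i < r\<^sub>1 + r\<^sub>2 then \<sigma> i x else 0)"

definition norm_Kbar :: "nat \<Rightarrow> nat \<Rightarrow> (nat \<Rightarrow> complex) \<Rightarrow> real" where
  "norm_Kbar r\<^sub>1 r\<^sub>2 x = (\<Prod>i<r\<^sub>1. Re (x i)) * (\<Prod>i=r\<^sub>1..<r\<^sub>1 + r\<^sub>2. (cmod (x i))\<^sup>2)"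

definition residue_class ::
    "'a::field_char_0 set \<Rightarrow> nat \<Rightarrow> nat \<Rightarrow> (nat \<Rightarrow> 'a \<Rightarrow> complex) \<Rightarrow>
     (nat \<Rightarrow> complex) \<Rightarrow> (nat \<Rightarrow> complex) set" where
  "residue_class K r\<^sub>1 r\<^sub>2 \<sigma> x =
     {\<lambda>i. x i + to_Kbar r\<^sub>1 r\<^sub>2 \<sigma> a i |a. a \<in> ring_of_integers K}"

definition m_Kbar ::
    "'a::field_char_0 set \<Rightarrow> nat \<Rightarrow> nat \<Rightarrow> (nat \<Rightarrow> 'a \<Rightarrow> complex) \<Rightarrow>
     (nat \<Rightarrow> complex) \<Rightarrow> real" where
  "m_Kbar K r\<^sub>1 r\<^sub>2 \<sigma> x = (INF y\<in>residue_class K r\<^sub>1 r\<^sub>2 \<sigma> x. \<bar>norm_Kbar r\<^sub>1 r\<^sub>2 y\<bar>)"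

definition inhom_spectrum ::
    "'a::field_char_0 set \<Rightarrow> nat \<Rightarrow> nat \<Rightarrow> (nat \<Rightarrow> 'a \<Rightarrow> complex) \<Rightarrow> real set" where
  "inhom_spectrum K r\<^sub>1 r\<^sub>2 \<sigma> = m_Kbar K r\<^sub>1 r\<^sub>2 \<sigma> ` Kbar r\<^sub>1 r\<^sub>2"

definition minimum_attained ::
    "'a::field_char_0 set \<Rightarrow> nat \<Rightarrow> nat \<Rightarrow> (nat \<Rightarrow> 'a \<Rightarrow> complex) \<Rightarrow> bool" where
  "minimum_attained K r\<^sub>1 r\<^sub>2 \<sigma> \<longleftrightarrow>
     (\<forall>x\<in>Kbar r\<^sub>1 r\<^sub>2. \<exists>y\<in>residue_class K r\<^sub>1 r\<^sub>2 \<sigma> x.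
        \<bar>norm_Kbar r\<^sub>1 r\<^sub>2 y\<bar> \<le> euclidean_minimum K)"

end

(*
  Complex conjugation acts on a CM field K, so for every unit u the element u cnj(u) is a unit that
  is real and positive at all n places.  By Dirichlet's theorem these elements have a cobounded
  logarithm lattice in the hyperplane of sum zero, and n >= 3 because of the unit rank.  Let S be a
  closed set of points of C^n / O_K that is invariant under these units, and let p be a torsion
  point at which S accumulates.  Expanding small differences at one place j while contracting all
  the others produces a ray p + R_{>0} z e_j in S, since the j-th coordinates of the units are
  dense in the positive reals.  Either z is not real-proportional to any alpha_j with alpha in O_K,
  and then the ray is dense in C^n / O_K, or S contains the translated torus p + R^n alpha.
  Torsion points are found in S by projecting to R^n modulo the real integers, where
  Furstenberg's argument applies.

  The function m is invariant and upper semicontinuous, so it attains its supremum M on a closed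
  invariant set.  If that set were infinite, m would be constantly M > 0 on some p + R^n alpha with
  p torsion.  At every rational parameter the value M is then attained as a norm, and a product of
  positive quadratics has a unique minimum, which forces all rational numbers into a lattice.
  Hence the set of maximal points is finite modulo O_K, so it consists of torsion points, that is,
  of points of K.  Finally M is isolated: nearly maximal points would accumulate at a
  maximal torsion point, and expanding the differences would give infinitely many maximal points.
*)
theory Submission
  imports Defs
    "Jordan_Normal_Form.Char_Poly"
    "HOL-Computational_Algebra.Fundamental_Theorem_Algebra"
    "HOL-Library.Function_Algebras"
    "HOL-Analysis.Topology_Euclidean_Space"
begin

section \<open>Algebraic integers and separability\<close>

text \<open>The CM property enters through positivity: a unit times its conjugate multiplies every
  place by a positive real number, so the direction \<open>z\<close> of a ray is preserved while its
  length varies. The base point of a ray has to stay fixed modulo the lattice too, and a torsion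
  point is fixed only by units congruent to 1 modulo its order; hence statements carry a level
  \<open>N\<close>, which grows whenever a torsion point becomes the origin. The obstacle is that
  the real multiples of a lattice vector form a proper invariant torus. Accumulation at a torsion
  point therefore does not force density, and differences of an invariant set need not fill the
  complex torus. Furstenberg's argument is run twice over the real lattice instead: on the
  coefficients of an imaginary integer \<open>\<delta>\<close>, then on the fibre over a torsion
  coefficient. The proper tori that remain are excluded by arithmetic. Dirichlet's theorem is needed
  only in a coarse form: absolute values with product 1 can be prescribed up to a bounded factor.
  Powers, which turn units into positive units congruent to 1, merely change that factor.\<close>

definition zspan :: "'i set \<Rightarrow> ('i \<Rightarrow> 'a::field_char_0) \<Rightarrow> 'a set" where
  "zspan I v = {\<Sum>i\<in>I. of_int (c i) * v i |c. True}"

lemma zspanI: "x = (\<Sum>i\<in>I. of_int (c i) * v i) \<Longrightarrow> x \<in> zspan I v"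
  by (auto simp: zspan_def)

lemma zspan_add: assumes "x \<in> zspan I v" "y \<in> zspan I v" shows "x + y \<in> zspan I v"
proof -
  obtain c d where "x = (\<Sum>i\<in>I. of_int (c i) * v i)" "y = (\<Sum>i\<in>I. of_int (d i) * v i)"
    using assms by (auto simp: zspan_def)
  then have "x + y = (\<Sum>i\<in>I. of_int (c i + d i) * v i)"
    by (simp add: sum.distrib algebra_simps)
  then show ?thesis by (rule zspanI)
qed

lemma zspan_int: assumes "x \<in> zspan I v" shows "of_int k * x \<in> zspan I v"
proof -
  obtain c where "x = (\<Sum>i\<in>I. of_int (c i) * v i)" using assms by (auto simp: zspan_def)
  then have "of_int k * x = (\<Sum>i\<in>I. of_int (k * c i) * v i)"
    by (simp add: sum_distrib_left mult.assoc)
  then show ?thesis by (rule zspanI)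
qed

lemma zspan_0: "0 \<in> zspan I v"
proof -
  have "0 = (\<Sum>i\<in>I. of_int ((\<lambda>_. 0) i) * v i)" by simp
  then show ?thesis by (rule zspanI)
qed

lemma zspan_sum: "(\<And>j. j \<in> J \<Longrightarrow> f j \<in> zspan I v) \<Longrightarrow> (\<Sum>j\<in>J. f j) \<in> zspan I v"
  by (induction J rule: infinite_finite_induct) (auto intro: zspan_add zspan_0)

lemma zspan_gen: assumes "finite I" "i \<in> I" shows "v i \<in> zspan I v"
proof -
  have "v i = (\<Sum>j\<in>I. of_int (if j = i then 1 else 0) * v j)"
    using assms by (simp add: if_distrib[of of_int] if_distrib[of "\<lambda>x. x * _"] sum.delta cong: if_cong)
  then show ?thesis by (rule zspanI)
qed

lemma zspan_mult:
  assumes "\<And>i. i \<in> I \<Longrightarrow> x * v i \<in> zspan I v" "y \<in> zspan I v"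
  shows "x * y \<in> zspan I v"
proof -
  obtain c where "y = (\<Sum>i\<in>I. of_int (c i) * v i)" using assms by (auto simp: zspan_def)
  then have "x * y = (\<Sum>i\<in>I. of_int (c i) * (x * v i))" by (simp add: sum_distrib_left mult_ac)
  then show ?thesis using assms(1) by (auto intro!: zspan_sum zspan_int)
qed

text \<open>\<open>x\<close> is an eigenvalue of an integer matrix, and the characteristic
  polynomial of such a matrix is monic with integer coefficients.\<close>

lemma algebraic_int_eigen:
  fixes x :: "'a::field_char_0" and A :: "nat \<Rightarrow> nat \<Rightarrow> int"
  assumes "i0 < k" "v i0 \<noteq> 0" "\<And>i. i < k \<Longrightarrow> x * v i = (\<Sum>j<k. of_int (A i j) * v j)"
  shows "algebraic_int x"
proof -
  define A' where "A' = mat k k (\<lambda>(i, j). A i j)"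
  define B where "B = map_mat (of_int :: int \<Rightarrow> 'a) A'"
  have A': "A' \<in> carrier_mat k k" by (simp add: A'_def)
  have B: "B \<in> carrier_mat k k" by (simp add: B_def A'_def)
  have "B *\<^sub>v vec k v = x \<cdot>\<^sub>v vec k v"
  proof (rule eq_vecI)
    fix i assume "i < dim_vec (x \<cdot>\<^sub>v vec k v)"
    then have i: "i < k" by simp
    have "(B *\<^sub>v vec k v) $ i = (\<Sum>j<k. of_int (A i j) * v j)"
      using i by (simp add: B_def A'_def scalar_prod_def lessThan_atLeast0)
    then show "(B *\<^sub>v vec k v) $ i = (x \<cdot>\<^sub>v vec k v) $ i" using assms(3)[OF i] i by simp
  qed (simp add: B_def A'_def)
  moreover have "vec k v \<noteq> 0\<^sub>v k"
  proof
    assume "vec k v = 0\<^sub>v k"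
    then have "vec k v $ i0 = 0\<^sub>v k $ i0" by simp
    then show False using assms(1,2) by simp
  qed
  ultimately have "eigenvalue B x"
    unfolding eigenvalue_def eigenvector_def using B by (intro exI[of _ "vec k v"]) auto
  then have root: "poly (char_poly B) x = 0" using eigenvalue_root_char_poly[OF B] by simp
  have eq: "char_poly B = map_poly of_int (char_poly A')"
    unfolding B_def by (rule of_int_hom.char_poly_hom[OF A'])
  show ?thesis
  proof (rule algebraic_int.intros[OF _ _ root])
    show "lead_coeff (char_poly B) = 1" using degree_monic_char_poly[OF B] by simp
    show "\<forall>i. coeff (char_poly B) i \<in> \<int>" unfolding eq by (simp add: coeff_map_poly)
  qed
qed

text \<open>The determinant trick: multiplication by \<open>x\<close> acts on the generators through
  an integer matrix. The condition \<open>v i0 \<noteq> 0\<close> excludes the zero module, which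
  every \<open>x\<close> preserves.\<close>

lemma algebraic_int_zspan:
  fixes x :: "'a::field_char_0"
  assumes "finite I" "i0 \<in> I" "v i0 \<noteq> 0" "\<And>i. i \<in> I \<Longrightarrow> x * v i \<in> zspan I v"
  shows "algebraic_int x"
proof -
  obtain h where h: "bij_betw h {..<card I} I"
    using ex_bij_betw_nat_finite[OF assms(1)] by (auto simp: lessThan_atLeast0)
  have "\<exists>c. x * v i = (\<Sum>j\<in>I. of_int (c j) * v j)" if "i \<in> I" for i
    using assms(4)[OF that] by (auto simp: zspan_def)
  then obtain c where c: "\<And>i. i \<in> I \<Longrightarrow> x * v i = (\<Sum>j\<in>I. of_int (c i j) * v j)" by metis
  have "i0 \<in> h ` {..<card I}" using h assms(2) by (simp add: bij_betw_def)
  then obtain k0 where k0: "k0 < card I" "h k0 = i0" by auto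
  show ?thesis
  proof (rule algebraic_int_eigen[of k0 "card I" "\<lambda>k. v (h k)" x "\<lambda>k l. c (h k) (h l)"])
    fix k assume "k < card I"
    then have "h k \<in> I" using h by (auto simp: bij_betw_def)
    then have "x * v (h k) = (\<Sum>j\<in>I. of_int (c (h k) j) * v j)" by (rule c)
    also have "\<dots> = (\<Sum>l<card I. of_int (c (h k) (h l)) * v (h l))"
      by (rule sum.reindex_bij_betw[OF h, symmetric])
    finally show "x * v (h k) = (\<Sum>l<card I. of_int (c (h k) (h l)) * v (h l))" .
  qed (use k0 assms in auto)
qed

lemma algebraic_int_power_reduce:
  fixes x :: "'a::field_char_0"
  assumes "algebraic_int x"
  obtains m c where "0 < m" "x ^ m = (\<Sum>i<m. of_int (c i) * x ^ i)"
proof -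
  obtain p where p: "poly (map_poly of_int p) x = 0" "lead_coeff p = (1::int)"
    using assms by (auto simp: algebraic_int_altdef_ipoly)
  define m where "m = degree p"
  have m: "0 < m"
  proof (rule ccontr)
    assume "\<not> 0 < m"
    then have "degree p = 0" by (simp add: m_def)
    then obtain a where "p = [:a:]" by (rule degree_eq_zeroE)
    then show False using p by simp
  qed
  have "0 = (\<Sum>i\<le>m. of_int (coeff p i) * x ^ i)"
    using p(1) by (simp add: poly_altdef m_def coeff_map_poly degree_map_poly)
  also have "\<dots> = (\<Sum>i<m. of_int (coeff p i) * x ^ i) + x ^ m"
    unfolding lessThan_Suc_atMost[symmetric] sum.lessThan_Suc using p(2) by (simp add: m_def)
  finally have "x ^ m = - (\<Sum>i<m. of_int (coeff p i) * x ^ i)"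
    by (metis add.commute eq_neg_iff_add_eq_0)
  also have "\<dots> = (\<Sum>i<m. of_int (- coeff p i) * x ^ i)" by (simp add: sum_negf)
  finally show ?thesis by (rule that[OF m])
qed

lemma algebraic_int_add_mult:
  fixes x y :: "'a::field_char_0"
  assumes "algebraic_int x" "algebraic_int y"
  shows "algebraic_int (x + y)" "algebraic_int (x * y)"
proof -
  obtain m c where m: "0 < m" "x ^ m = (\<Sum>i<m. of_int (c i) * x ^ i)"
    using algebraic_int_power_reduce[OF assms(1)] by blast
  obtain l d where l: "0 < l" "y ^ l = (\<Sum>j<l. of_int (d j) * y ^ j)"
    using algebraic_int_power_reduce[OF assms(2)] by blast
  \<comment> \<open>The monomials in \<open>x\<close> and \<open>y\<close> below the two degrees
    generate a module that is stable under both, hence under their sum and product; the index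
    \<open>(0, 0)\<close> supplies the nonzero generator 1.\<close>
  define I where "I = {..<m} \<times> {..<l}"
  define v where "v = (\<lambda>(i, j). x ^ i * y ^ j)"
  have fin: "finite I" by (simp add: I_def)
  have 0: "(0, 0) \<in> I" "v (0, 0) \<noteq> 0" using m l by (auto simp: I_def v_def)
  have gen: "x ^ i * y ^ j \<in> zspan I v" if "i < m" "j < l" for i j
    using zspan_gen[OF fin, of "(i, j)" v] that by (simp add: I_def v_def)
  have x: "x * v t \<in> zspan I v" if "t \<in> I" for t
  proof -
    obtain i j where t: "t = (i, j)" "i < m" "j < l" using \<open>t \<in> I\<close> by (auto simp: I_def)
    show ?thesis
    proof (cases "Suc i < m")
      case True
      then show ?thesis using gen[OF True t(3)] by (simp add: t v_def mult.assoc)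
    next
      case False
      then have "Suc i = m" using t by simp
      then have "x * v t = x ^ m * y ^ j" by (auto simp: t v_def mult.assoc)
      also have "\<dots> = (\<Sum>i<m. of_int (c i) * (x ^ i * y ^ j))" by (simp add: m(2) sum_distrib_right mult.assoc)
      also have "\<dots> \<in> zspan I v" by (intro zspan_sum zspan_int gen t) simp
      finally show ?thesis .
    qed
  qed
  have y: "y * v t \<in> zspan I v" if "t \<in> I" for t
  proof -
    obtain i j where t: "t = (i, j)" "i < m" "j < l" using \<open>t \<in> I\<close> by (auto simp: I_def)
    show ?thesis
    proof (cases "Suc j < l")
      case True
      then show ?thesis using gen[OF t(2) True] by (simp add: t v_def mult_ac)
    next
      case False
      then have "Suc j = l" using t by simp
      then have "y * v t = x ^ i * y ^ l" by (auto simp: t v_def mult_ac)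
      also have "\<dots> = (\<Sum>j<l. of_int (d j) * (x ^ i * y ^ j))" by (simp add: l(2) sum_distrib_left mult_ac)
      also have "\<dots> \<in> zspan I v" by (intro zspan_sum zspan_int gen t) simp
      finally show ?thesis .
    qed
  qed
  show "algebraic_int (x + y)"
    by (rule algebraic_int_zspan[of I "(0, 0)" v, OF fin 0]) (auto simp: distrib_right intro: zspan_add x y)
  show "algebraic_int (x * y)"
    by (rule algebraic_int_zspan[of I "(0, 0)" v, OF fin 0]) (auto simp: mult.assoc intro: zspan_mult x y)
qed

lemma algebraic_int_prod:
  fixes f :: "'i \<Rightarrow> 'a::field_char_0"
  shows "(\<And>i. i \<in> I \<Longrightarrow> algebraic_int (f i)) \<Longrightarrow> algebraic_int (\<Prod>i\<in>I. f i)"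
  by (induction I rule: infinite_finite_induct) (auto intro: algebraic_int_add_mult)

lemma algebraic_int_diff:
  fixes x y :: "'a::field_char_0"
  assumes "algebraic_int x" "algebraic_int y" shows "algebraic_int (x - y)"
  using algebraic_int_add_mult(1)[OF assms(1) algebraic_int_minus[OF assms(2)]] by simp

lemma common_denominator:
  assumes "finite (F :: rat set)"
  obtains D where "0 < (D::nat)" "\<And>q. q \<in> F \<Longrightarrow> of_nat D * q \<in> \<int>"
proof -
  have "\<exists>D>0::nat. \<forall>q\<in>F. of_nat D * q \<in> \<int>" using assms
  proof (induction F rule: finite_induct)
    case (insert q F)
    then obtain D :: nat where D: "0 < D" "\<forall>q\<in>F. of_nat D * q \<in> \<int>" by blast
    obtain a b where q: "q = Rat.Fract a b" "0 < b" by (cases q rule: Rat_cases) auto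
    have bq: "of_int b * q = of_int a" using q by (simp add: Fract_of_int_quotient)
    have "of_nat (nat b * D) * q' \<in> \<int>" if "q' \<in> F" for q'
    proof -
      have "of_nat (nat b * D) * q' = of_nat (nat b) * (of_nat D * q')" by simp
      then show ?thesis using D(2) that by (metis Ints_mult Ints_of_nat)
    qed
    moreover have "of_nat (nat b * D) * q \<in> \<int>"
    proof -
      have "of_nat (nat b * D) * q = of_nat D * (of_int b * q)" using q(2) by (simp add: mult_ac)
      also have "\<dots> = of_int (int D * a)" by (simp only: bq of_int_mult of_int_of_nat_eq)
      finally show ?thesis by (simp only: Ints_of_int)
    qed
    ultimately show ?case using D(1) q(2) by (intro exI[of _ "nat b * D"]) auto
  qed auto
  then show ?thesis using that by blast
qed

text \<open>Minimality of the degree makes the polynomial separable.\<close>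

lemma separable_annihilator:
  fixes b :: "'a::field_char_0"
  assumes "p \<noteq> 0" "poly (map_poly of_rat p) b = 0"
  obtains q :: "rat poly" where "q \<noteq> 0" "poly (map_poly of_rat q) b = 0"
    "rsquarefree (map_poly of_rat q :: complex poly)"
proof -
  interpret A: map_poly_idom_hom "of_rat :: rat \<Rightarrow> 'a" ..
  interpret C: map_poly_idom_hom "of_rat :: rat \<Rightarrow> complex" ..
  define P where "P q \<longleftrightarrow> q \<noteq> 0 \<and> poly (map_poly of_rat q) b = 0" for q :: "rat poly"
  obtain q where q: "P q" "\<And>r. P r \<Longrightarrow> degree q \<le> degree r"
    using ex_has_least_nat[of P p degree] assms by (auto simp: P_def)
  have "\<not> (poly (map_poly of_rat q) a = 0 \<and> poly (pderiv (map_poly of_rat q)) a = 0)" for a :: complex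
  proof
    assume a: "poly (map_poly of_rat q) a = 0 \<and> poly (pderiv (map_poly of_rat q)) a = 0"
    \<comment> \<open>The minimal polynomial \<open>r\<close> of the double root \<open>a\<close>
      divides \<open>q\<close> and its derivative, so its degree is smaller than that of
      \<open>q\<close>. Then \<open>b\<close> is a root of \<open>r\<close> or of the cofactor
      \<open>h\<close>, against the choice of \<open>q\<close>.\<close>
    define S where "S r \<longleftrightarrow> r \<noteq> 0 \<and> poly (map_poly of_rat r) a = 0" for r :: "rat poly"
    obtain r where r: "S r" "\<And>s. S s \<Longrightarrow> degree r \<le> degree s"
      using ex_has_least_nat[of S q degree] a q(1) by (auto simp: P_def S_def)
    have dvd: "r dvd s" if "poly (map_poly of_rat s) a = 0" for s
    proof -
      have "poly (map_poly of_rat (s mod r)) a = 0"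
        using that r(1) unfolding S_def minus_div_mult_eq_mod[symmetric]
        by (simp add: C.hom_minus C.hom_mult)
      moreover have "s mod r = 0 \<or> degree (s mod r) < degree r"
        using r(1) degree_mod_less[of r s] by (auto simp: S_def)
      ultimately have "s mod r = 0" using r(2)[of "s mod r"] unfolding S_def by linarith
      then show ?thesis by (simp add: dvd_eq_mod_eq_0)
    qed
    have dr: "degree r \<noteq> 0"
    proof
      assume "degree r = 0"
      then obtain c where "r = [:c:]" by (rule degree_eq_zeroE)
      then show False using r(1) by (simp add: S_def of_rat_hom.map_poly_pCons_hom)
    qed
    have dq: "degree q \<noteq> 0"
    proof
      assume "degree q = 0"
      then obtain c where "q = [:c:]" by (rule degree_eq_zeroE)
      then show False using q(1) by (simp add: P_def of_rat_hom.map_poly_pCons_hom)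
    qed
    have pd: "poly (map_poly of_rat (pderiv q)) a = 0"
      using a by (simp add: of_rat_hom.map_poly_pderiv)
    have "pderiv q \<noteq> 0" using dq by (simp add: pderiv_eq_0_iff)
    then have "degree r \<le> degree (pderiv q)" using dvd[OF pd] by (rule dvd_imp_degree_le[rotated])
    then have rq: "degree r < degree q" using dq by (simp add: degree_pderiv)
    obtain h where h: "q = r * h" using dvd[of q] a by (auto elim: dvdE)
    have hn: "h \<noteq> 0" "r \<noteq> 0" using q(1) h by (auto simp: P_def)
    have "degree q = degree r + degree h" using hn h by (simp add: degree_mult_eq)
    then have dh: "degree h < degree q" using dr by simp
    have "poly (map_poly of_rat r) b * poly (map_poly of_rat h) b = 0"
      using q(1) unfolding P_def h by (simp add: A.hom_mult)
    then have "P r \<or> P h" using hn by (auto simp: P_def)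
    then show False using q(2) rq dh by fastforce
  qed
  then have "rsquarefree (map_poly of_rat q :: complex poly)" by (simp add: rsquarefree_roots)
  then show ?thesis using that q(1) by (auto simp: P_def)
qed

section \<open>Embeddings of a number field\<close>

locale field_set =
  fixes K :: "'a::field_char_0 set"
  assumes sub: "is_subfield K"
begin

lemma K_0 [simp]: "0 \<in> K" and K_1 [simp]: "1 \<in> K"
  and K_add: "x \<in> K \<Longrightarrow> y \<in> K \<Longrightarrow> x + y \<in> K" and K_diff: "x \<in> K \<Longrightarrow> y \<in> K \<Longrightarrow> x - y \<in> K"
  and K_mult: "x \<in> K \<Longrightarrow> y \<in> K \<Longrightarrow> x * y \<in> K" and K_inverse: "x \<in> K \<Longrightarrow> inverse x \<in> K"
  using sub by (auto simp: is_subfield_def)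

lemma K_uminus: "x \<in> K \<Longrightarrow> - x \<in> K" using K_diff[OF K_0] by fastforce
lemma K_divide: "x \<in> K \<Longrightarrow> y \<in> K \<Longrightarrow> x / y \<in> K" unfolding divide_inverse by (intro K_mult K_inverse)
lemma K_sum: "(\<And>i. i \<in> I \<Longrightarrow> f i \<in> K) \<Longrightarrow> (\<Sum>i\<in>I. f i) \<in> K"
  by (induction I rule: infinite_finite_induct) (auto intro: K_add)
lemma K_power: "x \<in> K \<Longrightarrow> x ^ k \<in> K" by (induction k) (auto intro: K_mult)
lemma K_of_nat: "of_nat k \<in> K" by (induction k) (auto intro: K_add)
lemma K_of_int: "of_int k \<in> K" by (cases k rule: int_cases2) (auto intro: K_of_nat K_uminus)
lemma K_of_rat: "of_rat q \<in> K"
proof (cases q rule: Rat_cases)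
  case (Fract a b)
  then show ?thesis by (simp add: of_rat_rat K_divide K_of_int)
qed

lemma emb_1: "is_embedding K \<tau> \<Longrightarrow> \<tau> 1 = 1"
  and emb_add: "is_embedding K \<tau> \<Longrightarrow> x \<in> K \<Longrightarrow> y \<in> K \<Longrightarrow> \<tau> (x + y) = \<tau> x + \<tau> y"
  and emb_mult: "is_embedding K \<tau> \<Longrightarrow> x \<in> K \<Longrightarrow> y \<in> K \<Longrightarrow> \<tau> (x * y) = \<tau> x * \<tau> y"
  by (auto simp: is_embedding_def)

context
  fixes \<tau> :: "'a \<Rightarrow> complex"
  assumes \<tau>: "is_embedding K \<tau>"
begin

lemma emb_0: "\<tau> 0 = 0" using emb_add[OF \<tau>, of 0 0] by simp

lemma emb_diff: assumes "x \<in> K" "y \<in> K" shows "\<tau> (x - y) = \<tau> x - \<tau> y"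
  using emb_add[OF \<tau> K_diff[OF assms] assms(2)] by (simp add: eq_diff_eq)

lemma emb_uminus: "x \<in> K \<Longrightarrow> \<tau> (- x) = - \<tau> x"
  using emb_diff[of 0 x] emb_0 by simp

lemma emb_sum: "(\<And>i. i \<in> I \<Longrightarrow> f i \<in> K) \<Longrightarrow> \<tau> (\<Sum>i\<in>I. f i) = (\<Sum>i\<in>I. \<tau> (f i))"
  by (induction I rule: infinite_finite_induct) (auto simp: emb_0 emb_add[OF \<tau>] K_sum)

lemma emb_power: "x \<in> K \<Longrightarrow> \<tau> (x ^ k) = \<tau> x ^ k"
  by (induction k) (auto simp: emb_1[OF \<tau>] emb_mult[OF \<tau>] K_power)

lemma emb_of_nat: "\<tau> (of_nat k) = of_nat k"
  by (induction k) (auto simp: emb_0 emb_1[OF \<tau>] emb_add[OF \<tau>] K_of_nat)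

lemma emb_of_int: "\<tau> (of_int k) = of_int k"
  by (cases k rule: int_cases2) (auto simp: emb_of_nat emb_uminus K_of_nat)

lemma emb_nz: assumes "x \<in> K" "x \<noteq> 0" shows "\<tau> x \<noteq> 0"
proof
  assume "\<tau> x = 0"
  then have "\<tau> (x * inverse x) = 0" using emb_mult[OF \<tau> assms(1) K_inverse[OF assms(1)]] by simp
  then show False using assms emb_1[OF \<tau>] by simp
qed

lemma emb_divide: assumes "x \<in> K" "y \<in> K" shows "\<tau> (x / y) = \<tau> x / \<tau> y"
proof (cases "y = 0")
  case False
  then have "\<tau> (x / y) * \<tau> y = \<tau> x"
    using emb_mult[OF \<tau> K_divide[OF assms] assms(2)] by simp
  then show ?thesis using emb_nz[OF assms(2) False] by (simp add: field_simps)
qed (simp add: emb_0)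

lemma emb_inj: assumes "x \<in> K" "y \<in> K" "\<tau> x = \<tau> y" shows "x = y"
  using emb_nz[OF K_diff[OF assms(1,2)]] emb_diff[OF assms(1,2)] assms(3) by auto

lemma emb_of_rat: "\<tau> (of_rat q) = of_rat q"
proof (cases q rule: Rat_cases)
  case (Fract a b)
  then show ?thesis by (simp add: of_rat_rat emb_divide K_of_int emb_of_int)
qed

lemma emb_algebraic_int: assumes "x \<in> K" shows "algebraic_int (\<tau> x) \<longleftrightarrow> algebraic_int x"
proof -
  have "poly (map_poly of_int p) (\<tau> x) = \<tau> (poly (map_poly of_int p) x)" for p :: "int poly"
    using assms by (simp add: poly_altdef emb_sum K_mult K_power K_of_int emb_mult[OF \<tau>] emb_of_int emb_power coeff_map_poly degree_map_poly)
  moreover have "poly (map_poly of_int p) x \<in> K" for p :: "int poly"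
    using assms by (simp add: poly_altdef K_sum K_mult K_power K_of_int coeff_map_poly degree_map_poly)
  ultimately show ?thesis unfolding algebraic_int_altdef_ipoly using emb_nz emb_0 by metis
qed

end

text \<open>Dedekind's argument: the relation at \<open>y * x\<close> minus
  \<open>\<tau> k y\<close> times the relation at \<open>x\<close> no longer involves
  \<open>k\<close>, and \<open>c j\<close> survives in it with a nonzero factor if \<open>y\<close>
  separates \<open>j\<close> from \<open>k\<close>.\<close>

lemma embeddings_independent:
  fixes \<tau> :: "'i \<Rightarrow> 'a \<Rightarrow> complex"
  assumes fin: "finite I" and emb: "\<And>i. i \<in> I \<Longrightarrow> is_embedding K (\<tau> i)"
    and dist: "\<And>i j. i \<in> I \<Longrightarrow> j \<in> I \<Longrightarrow> i \<noteq> j \<Longrightarrow> \<exists>x\<in>K. \<tau> i x \<noteq> \<tau> j x"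
    and zero: "\<And>x. x \<in> K \<Longrightarrow> (\<Sum>i\<in>I. c i * \<tau> i x) = 0" and i: "i \<in> I"
  shows "c i = 0"
  using assms
proof (induction I arbitrary: c i rule: finite_induct)
  case (insert k S)
  have S0: "c j = 0" if j: "j \<in> S" for j
  proof -
    have jk: "j \<noteq> k" using insert.hyps j by auto
    obtain y where y: "y \<in> K" "\<tau> j y \<noteq> \<tau> k y" using insert.prems(2)[of j k] j jk by auto
    have "c j * (\<tau> j y - \<tau> k y) = 0"
    proof (rule insert.IH[of "\<lambda>l. c l * (\<tau> l y - \<tau> k y)"])
      fix x assume x: "x \<in> K"
      have "(\<Sum>l\<in>insert k S. c l * (\<tau> l y - \<tau> k y) * \<tau> l x)
          = (\<Sum>l\<in>insert k S. c l * \<tau> l (y * x)) - \<tau> k y * (\<Sum>l\<in>insert k S. c l * \<tau> l x)"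
        unfolding sum_distrib_left sum_subtractf[symmetric]
        by (rule sum.cong[OF refl]) (use insert.prems(1) x y in \<open>simp add: emb_mult algebra_simps\<close>)
      also have "\<dots> = 0" using insert.prems(3)[OF x] insert.prems(3)[OF K_mult[OF y(1) x]] by simp
      finally show "(\<Sum>l\<in>S. c l * (\<tau> l y - \<tau> k y) * \<tau> l x) = 0"
        using insert.hyps by simp
    qed (use insert.prems j in auto)
    then show ?thesis using y(2) by simp
  qed
  have "(\<Sum>l\<in>insert k S. c l * \<tau> l 1) = 0" by (rule insert.prems(3)) simp
  then have "c k = 0" using insert.hyps S0 emb_1[OF insert.prems(1)[of k]] by simp
  then show ?case using S0 insert.prems(4) by auto
qed auto

section \<open>Rational linear functionals on K and their simultaneous eigendecomposition\<close>

definition rlin :: "('a \<Rightarrow> complex) \<Rightarrow> bool" where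
  "rlin \<phi> \<longleftrightarrow> (\<forall>x\<in>K. \<forall>y\<in>K. \<phi> (x + y) = \<phi> x + \<phi> y) \<and> (\<forall>q. \<forall>x\<in>K. \<phi> (of_rat q * x) = of_rat q * \<phi> x)"

lemma rlin_0: "rlin \<phi> \<Longrightarrow> \<phi> 0 = 0"
  using K_0 unfolding rlin_def by (metis add.right_neutral add_left_cancel)

lemma rlin_sum: "rlin \<phi> \<Longrightarrow> (\<And>i. i \<in> I \<Longrightarrow> f i \<in> K) \<Longrightarrow> \<phi> (\<Sum>i\<in>I. f i) = (\<Sum>i\<in>I. \<phi> (f i))"
  by (induction I rule: infinite_finite_induct) (auto simp: rlin_0 rlin_def K_sum)

text \<open>\<open>act b q \<phi>\<close> is \<open>q(b)\<close> applied to \<open>\<phi>\<close>, where \<open>b\<close> acts on functionals by \<open>(b\<phi>) x = \<phi> (b x)\<close>.\<close>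

definition act :: "'a \<Rightarrow> complex poly \<Rightarrow> ('a \<Rightarrow> complex) \<Rightarrow> 'a \<Rightarrow> complex" where
  "act b q \<phi> x = (\<Sum>i\<le>degree q. coeff q i * \<phi> (b ^ i * x))"

lemma act_alt: assumes "degree q \<le> N" shows "act b q \<phi> x = (\<Sum>i\<le>N. coeff q i * \<phi> (b ^ i * x))"
  unfolding act_def by (rule sum.mono_neutral_left) (use assms in \<open>auto simp: coeff_eq_0\<close>)

lemma act_0: "act b 0 \<phi> x = 0" by (simp add: act_def)

lemma act_const: "act b [:c:] \<phi> x = c * \<phi> x" by (simp add: act_def)

lemma act_add: "act b (p + q) \<phi> x = act b p \<phi> x + act b q \<phi> x"
proof -
  define N where "N = max (degree p) (degree q)"
  have "degree (p + q) \<le> N" "degree p \<le> N" "degree q \<le> N"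
    by (auto simp: N_def degree_add_le_max)
  then show ?thesis by (simp add: act_alt[where N = N] sum.distrib distrib_right)
qed

lemma act_smult: "act b (smult c p) \<phi> x = c * act b p \<phi> x"
proof -
  have "degree (smult c p) \<le> degree p" by simp
  then show ?thesis by (simp add: act_alt[where N = "degree p"] sum_distrib_left mult.assoc)
qed

lemma act_pCons: "act b (pCons c q) \<phi> x = c * \<phi> x + act b q \<phi> (b * x)"
proof -
  have "degree (pCons c q) \<le> Suc (degree q)" by (simp add: degree_pCons_le)
  then have "act b (pCons c q) \<phi> x = (\<Sum>i\<le>Suc (degree q). coeff (pCons c q) i * \<phi> (b ^ i * x))"
    by (rule act_alt)
  also have "\<dots> = c * \<phi> x + (\<Sum>i\<le>degree q. coeff q i * \<phi> (b ^ Suc i * x))"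
    unfolding sum.atMost_Suc_shift by simp
  finally show ?thesis by (simp add: act_def mult_ac)
qed

lemma act_mult: "act b (p * q) \<phi> x = act b p (act b q \<phi>) x"
proof (induction p arbitrary: x)
  case 0
  then show ?case by (simp add: act_0)
next
  case (pCons a p)
  have "act b (pCons a p * q) \<phi> x = act b (smult a q) \<phi> x + act b (pCons 0 (p * q)) \<phi> x"
    by (simp add: act_add)
  also have "\<dots> = a * act b q \<phi> x + act b (p * q) \<phi> (b * x)"
    by (simp add: act_smult act_pCons)
  also have "\<dots> = act b (pCons a p) (act b q \<phi>) x" by (simp add: act_pCons pCons.IH)
  finally show ?case .
qed

lemma act_zero: assumes "\<And>x. x \<in> K \<Longrightarrow> \<phi> x = 0" "b \<in> K" "x \<in> K" shows "act b q \<phi> x = 0"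
  unfolding act_def using assms by (simp add: K_mult K_power)

text \<open>A rational coefficient passes through \<open>\<phi>\<close>, so for rational polynomials
  the formal action is evaluation inside the field. An annihilating polynomial of \<open>b\<close>
  therefore kills every functional.\<close>

lemma act_rat:
  assumes "rlin \<phi>" "b \<in> K" "x \<in> K"
  shows "act b (map_poly of_rat p) \<phi> x = \<phi> (poly (map_poly of_rat p) b * x)"
  using assms(3)
proof (induction p arbitrary: x)
  case 0
  then show ?case using rlin_0[OF assms(1)] by (simp add: act_0)
next
  case (pCons a p)
  have pK: "poly (map_poly of_rat p) b \<in> K"
    using assms(2) by (simp add: poly_altdef K_sum K_mult K_power K_of_rat coeff_map_poly degree_map_poly)
  have bx: "b * x \<in> K" by (intro K_mult assms pCons)
  have "act b (map_poly of_rat (pCons a p)) \<phi> x = of_rat a * \<phi> x + \<phi> (poly (map_poly of_rat p) b * (b * x))"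
    using pCons.IH[OF bx] by (simp add: of_rat_hom.map_poly_pCons_hom act_pCons)
  also have "of_rat a * \<phi> x = \<phi> (of_rat a * x)" using assms(1) pCons.prems by (simp add: rlin_def)
  also have "\<phi> (of_rat a * x) + \<phi> (poly (map_poly of_rat p) b * (b * x))
     = \<phi> (of_rat a * x + poly (map_poly of_rat p) b * (b * x))"
    using assms(1) pK bx pCons.prems by (simp add: rlin_def K_mult K_of_rat)
  also have "of_rat a * x + poly (map_poly of_rat p) b * (b * x) = poly (map_poly of_rat (pCons a p)) b * x"
    by (simp add: of_rat_hom.map_poly_pCons_hom algebra_simps)
  finally show ?case .
qed

lemma rlin_shift: assumes "rlin \<phi>" "b \<in> K" shows "rlin (\<lambda>x. \<phi> (b * x))"
proof -
  have "\<phi> (b * (of_rat q * x)) = of_rat q * \<phi> (b * x)" if "x \<in> K" for q x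
  proof -
    have eq: "b * (of_rat q * x) = of_rat q * (b * x)" by (simp only: mult.left_commute)
    show ?thesis unfolding eq using assms that unfolding rlin_def by (simp add: K_mult)
  qed
  then show ?thesis using assms unfolding rlin_def by (simp add: distrib_left K_mult)
qed

lemma rlin_act: assumes "rlin \<phi>" "b \<in> K" shows "rlin (act b q \<phi>)"
proof -
  have *: "rlin (\<lambda>x. \<phi> (b ^ i * x))" for i by (rule rlin_shift[OF assms(1) K_power[OF assms(2)]])
  have "act b q \<phi> (x + y) = act b q \<phi> x + act b q \<phi> y" if "x \<in> K" "y \<in> K" for x y
    using *[unfolded rlin_def] that unfolding act_def by (simp add: distrib_left sum.distrib)
  moreover have "act b q \<phi> (of_rat r * x) = of_rat r * act b q \<phi> x" if "x \<in> K" for x r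
    using *[unfolded rlin_def] that unfolding act_def by (simp add: sum_distrib_left mult_ac)
  ultimately show ?thesis by (simp add: rlin_def)
qed

definition spanned :: "'i set \<Rightarrow> ('i \<Rightarrow> 'a \<Rightarrow> complex) \<Rightarrow> ('a \<Rightarrow> complex) \<Rightarrow> bool" where
  "spanned I \<tau> \<phi> \<longleftrightarrow> (\<exists>c. \<forall>x\<in>K. \<phi> x = (\<Sum>i\<in>I. c i * \<tau> i x))"

lemma spanned_add:
  assumes "spanned I \<tau> \<phi>" "spanned I \<tau> \<psi>" "\<And>x. x \<in> K \<Longrightarrow> \<omega> x = \<phi> x + \<psi> x"
  shows "spanned I \<tau> \<omega>"
proof -
  obtain c d where "\<And>x. x \<in> K \<Longrightarrow> \<phi> x = (\<Sum>i\<in>I. c i * \<tau> i x)" "\<And>x. x \<in> K \<Longrightarrow> \<psi> x = (\<Sum>i\<in>I. d i * \<tau> i x)"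
    using assms(1,2) unfolding spanned_def by blast
  then have "\<omega> x = (\<Sum>i\<in>I. (c i + d i) * \<tau> i x)" if "x \<in> K" for x
    using assms(3)[OF that] that by (simp add: sum.distrib distrib_right)
  then show ?thesis unfolding spanned_def by (intro exI[of _ "\<lambda>i. c i + d i"]) blast
qed

definition eig :: "'a set \<Rightarrow> ('a \<Rightarrow> complex) \<Rightarrow> bool" where
  "eig A \<phi> \<longleftrightarrow> rlin \<phi> \<and> (\<forall>a\<in>A. \<exists>l. \<forall>x\<in>K. \<phi> (a * x) = l * \<phi> x)"

lemma eig_act: assumes "eig A \<phi>" "A \<subseteq> K" "b \<in> K" shows "eig A (act b q \<phi>)"
  unfolding eig_def
proof (intro conjI ballI)
  show "rlin (act b q \<phi>)" using assms by (auto simp: eig_def intro: rlin_act)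
  fix a assume a: "a \<in> A"
  then obtain l where l: "\<And>x. x \<in> K \<Longrightarrow> \<phi> (a * x) = l * \<phi> x" using assms(1) unfolding eig_def by blast
  have "act b q \<phi> (a * x) = l * act b q \<phi> x" if "x \<in> K" for x
  proof -
    have "\<phi> (b ^ i * (a * x)) = l * \<phi> (b ^ i * x)" for i
      using l[of "b ^ i * x"] that assms(3) by (simp add: K_mult K_power mult.left_commute)
    then show ?thesis by (simp add: act_def sum_distrib_left mult_ac)
  qed
  then show "\<exists>l. \<forall>x\<in>K. act b q \<phi> (a * x) = l * act b q \<phi> x" by blast
qed

text \<open>With \<open>q\<close> the product of the remaining factors, \<open>q(b)\<phi> / q(r)\<close> is an eigenfunctional of \<open>b\<close>
  for \<open>r\<close>, and subtracting it leaves a functional killed by \<open>q\<close>.\<close>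

lemma eig_split:
  assumes "finite rs" "b \<in> K" "A \<subseteq> K"
    and IH: "\<And>\<phi>. eig (insert b A) \<phi> \<Longrightarrow> spanned I \<tau> \<phi>"
    and "eig A \<phi>" "\<And>x. x \<in> K \<Longrightarrow> act b (\<Prod>r\<in>rs. [:- r, 1:]) \<phi> x = 0"
  shows "spanned I \<tau> \<phi>"
  using assms(1,5,6)
proof (induction rs arbitrary: \<phi> rule: finite_induct)
  case empty
  then have "\<And>x. x \<in> K \<Longrightarrow> \<phi> x = 0" by (simp add: one_pCons act_const)
  then show ?case unfolding spanned_def by (intro exI[of _ "\<lambda>_. 0"]) simp
next
  case (insert r rs)
  define q where "q = (\<Prod>r\<in>rs. [:- r, 1:])"
  have q0: "poly q r \<noteq> 0" using insert.hyps by (auto simp: q_def poly_prod)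
  define p where "p = smult (1 / poly q r) q"
  define \<phi>1 where "\<phi>1 = act b p \<phi>"
  define \<phi>2 where "\<phi>2 = act b (1 - p) \<phi>"
  have kill: "act b ([:- r, 1:] * q) \<phi> x = 0" if "x \<in> K" for x
    using insert.prems(2)[OF that] insert.hyps by (simp add: q_def)
  have "spanned I \<tau> \<phi>1"
  proof (rule IH)
    have e: "eig A \<phi>1" unfolding \<phi>1_def by (rule eig_act[OF insert.prems(1) assms(3,2)])
    have "\<phi>1 (b * x) = r * \<phi>1 x" if "x \<in> K" for x
    proof -
      have "act b ([:- r, 1:] * p) \<phi> x = 0"
      proof -
        have "[:- r, 1:] * p = smult (1 / poly q r) ([:- r, 1:] * q)" by (simp add: p_def)
        then show ?thesis using kill[OF that] by (simp only: act_smult) simp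
      qed
      then have "act b [:- r, 1:] \<phi>1 x = 0" by (simp only: act_mult \<phi>1_def)
      then show ?thesis by (simp add: act_pCons act_0)
    qed
    then show "eig (insert b A) \<phi>1" using e unfolding eig_def by blast
  qed
  moreover have "spanned I \<tau> \<phi>2"
  proof (rule insert.IH)
    show "eig A \<phi>2" unfolding \<phi>2_def by (rule eig_act[OF insert.prems(1) assms(3,2)])
    fix x assume x: "x \<in> K"
    \<comment> \<open>Since \<open>p\<close> is normalised to the value 1 at \<open>r\<close>, the
      factor \<open>1 - p\<close> is divisible by the missing linear factor, and
      \<open>q * (1 - p)\<close> is a multiple of the full product that kills
      \<open>\<phi>\<close>.\<close>
    have "poly (1 - p) r = 0" using q0 by (simp add: p_def)
    then have "[:- r, 1:] dvd 1 - p" by (simp only: poly_eq_0_iff_dvd)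
    then obtain s where s: "1 - p = [:- r, 1:] * s" by (auto elim: dvdE)
    have "act b q \<phi>2 x = act b (q * (1 - p)) \<phi> x" unfolding \<phi>2_def act_mult ..
    also have "q * (1 - p) = s * ([:- r, 1:] * q)" unfolding s by (simp only: mult_ac)
    also have "act b (s * ([:- r, 1:] * q)) \<phi> x = act b s (act b ([:- r, 1:] * q) \<phi>) x" by (rule act_mult)
    also have "\<dots> = 0" by (rule act_zero[OF kill assms(2) x])
    finally show "act b (\<Prod>r\<in>rs. [:- r, 1:]) \<phi>2 x = 0" by (simp add: q_def)
  qed
  moreover have "\<phi> x = \<phi>1 x + \<phi>2 x" for x
  proof -
    have "\<phi>1 x + \<phi>2 x = act b (p + (1 - p)) \<phi> x" unfolding \<phi>1_def \<phi>2_def by (rule act_add[symmetric])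
    also have "\<dots> = \<phi> x" by (simp add: one_pCons act_const)
    finally show ?thesis by simp
  qed
  ultimately show ?case by (rule spanned_add)
qed

end

locale number_field_basis = field_set +
  fixes bs :: "'a list"
  assumes basis: "is_rat_basis K bs"
begin

abbreviation "d \<equiv> length bs"

definition crd :: "nat \<Rightarrow> 'a \<Rightarrow> rat" where "crd i x = rat_vs.representation (set bs) x (bs ! i)"

lemma span_bs: "rat_vs.span (set bs) = K" and indep_bs: "rat_vs.independent (set bs)" and dist_bs: "distinct bs"
  using basis by (auto simp: is_rat_basis_def)

lemma bs_K: "i < d \<Longrightarrow> bs ! i \<in> K"
  using span_bs rat_vs.span_superset[of "set bs"] by (auto dest: nth_mem)

lemma sum_set_bs: "(\<Sum>b\<in>set bs. f b) = (\<Sum>i<d. f (bs ! i))"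
  by (rule sum.reindex_bij_betw[symmetric]) (rule bij_betw_nth[OF dist_bs], auto)

lemma crd_expand: assumes "x \<in> K" shows "x = (\<Sum>i<d. of_rat (crd i x) * bs ! i)"
proof -
  have "(\<Sum>b\<in>set bs. of_rat (rat_vs.representation (set bs) x b) * b) = x"
    by (rule rat_vs.sum_representation_eq[OF indep_bs]) (use assms span_bs in auto)
  then show ?thesis by (simp add: sum_set_bs crd_def)
qed

lemma crd_add: "x \<in> K \<Longrightarrow> y \<in> K \<Longrightarrow> crd i (x + y) = crd i x + crd i y"
  unfolding crd_def using rat_vs.representation_add[OF indep_bs] span_bs by simp

lemma crd_scale: "x \<in> K \<Longrightarrow> crd i (of_rat q * x) = q * crd i x"
  unfolding crd_def using rat_vs.representation_scale[OF indep_bs] span_bs by simp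

lemma crd_bs: "i < d \<Longrightarrow> j < d \<Longrightarrow> crd i (bs ! j) = (if i = j then 1 else 0)"
  unfolding crd_def using rat_vs.representation_basis[OF indep_bs, of "bs ! j"] dist_bs
  by (auto simp: nth_eq_iff_index_eq)

lemma crd_rlin: "rlin (\<lambda>x. of_rat (crd i x))"
  by (simp add: rlin_def crd_add crd_scale of_rat_add of_rat_mult)

text \<open>The \<open>d + 1\<close> powers of \<open>b\<close> in a space of dimension
  \<open>d\<close> are dependent. They form a set of that size only if they are distinct; a
  coincidence of two powers gives a difference of two monomials instead.\<close>

lemma annihilator:
  assumes "b \<in> K"
  obtains p :: "rat poly" where "p \<noteq> 0" "poly (map_poly of_rat p) b = 0"
proof (cases "inj_on (\<lambda>i. b ^ i) {..d}")
  case True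
  let ?S = "(\<lambda>i. b ^ i) ` {..d}"
  have "\<not> rat_vs.independent ?S"
  proof
    assume "rat_vs.independent ?S"
    moreover have "?S \<subseteq> rat_vs.span (set bs)" using assms span_bs K_power by auto
    ultimately have "card ?S \<le> card (set bs)"
      using rat_vs.independent_span_bound[of "set bs" ?S] by simp
    then show False using True dist_bs by (simp add: card_image distinct_card)
  qed
  then obtain u v where u: "v \<in> ?S" "u v \<noteq> (0::rat)" "(\<Sum>v\<in>?S. of_rat (u v) * v) = 0"
    using rat_vs.dependent_finite[of ?S] by auto
  define p where "p = (\<Sum>i\<le>d. monom (u (b ^ i)) i)"
  have cp: "coeff p i = (if i \<le> d then u (b ^ i) else 0)" for i
    by (simp add: p_def coeff_sum coeff_monom)
  have "p \<noteq> 0" using u(1,2) cp by (auto simp: poly_eq_iff)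
  moreover have "poly (map_poly of_rat p) b = 0"
  proof -
    have deg: "degree p \<le> d" by (rule degree_le) (simp add: cp)
    have "poly (map_poly of_rat p) b = (\<Sum>i\<le>degree p. of_rat (coeff p i) * b ^ i)"
      by (simp add: poly_altdef coeff_map_poly degree_map_poly)
    also have "\<dots> = (\<Sum>i\<le>d. of_rat (coeff p i) * b ^ i)"
      by (rule sum.mono_neutral_left) (use deg in \<open>auto simp: coeff_eq_0\<close>)
    also have "\<dots> = (\<Sum>i\<le>d. of_rat (u (b ^ i)) * b ^ i)" by (simp add: cp)
    also have "\<dots> = (\<Sum>v\<in>?S. of_rat (u v) * v)" by (simp add: sum.reindex[OF True])
    finally show ?thesis using u(3) by simp
  qed
  ultimately show ?thesis using that by blast
next
  case False
  then obtain i j where ij: "b ^ i = b ^ j" "i \<noteq> j" by (auto simp: inj_on_def)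
  interpret A: map_poly_idom_hom "of_rat :: rat \<Rightarrow> 'a" ..
  define p :: "rat poly" where "p = monom 1 i - monom 1 j"
  have "coeff p i = 1" using ij(2) by (simp add: p_def coeff_monom)
  then have "p \<noteq> 0" by auto
  moreover have "poly (map_poly of_rat p) b = 0"
    using ij(1) by (simp add: p_def A.hom_minus map_poly_monom poly_monom)
  ultimately show ?thesis using that by blast
qed

text \<open>The multiplications by basis elements commute and each is annihilated by a separable
  polynomial, so every functional is a sum of simultaneous eigenfunctionals. This takes the place of
  a primitive element in counting the embeddings.\<close>

lemma hom_spanned:
  assumes all: "\<And>\<theta>. is_embedding K \<theta> \<Longrightarrow> \<exists>i\<in>I. \<forall>x\<in>K. \<theta> x = \<tau> i x" and fin: "finite I"
    and \<phi>: "rlin \<phi>"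
  shows "spanned I \<tau> \<phi>"
proof -
  have base: "spanned I \<tau> \<phi>" if e: "eig (set bs) \<phi>" for \<phi>
  proof -
    have lin: "rlin \<phi>" using e by (simp add: eig_def)
    have "\<exists>l. \<forall>x\<in>K. \<phi> (bs ! i * x) = l * \<phi> x" if "i < d" for i
      using e that unfolding eig_def by simp
    then obtain l where l: "\<And>i x. i < d \<Longrightarrow> x \<in> K \<Longrightarrow> \<phi> (bs ! i * x) = l i * \<phi> x" by metis
    have ev: "\<phi> (y * x) = (\<Sum>i<d. of_rat (crd i y) * l i) * \<phi> x" if y: "y \<in> K" and x: "x \<in> K" for x y
    proof -
      have "y * x = (\<Sum>i<d. of_rat (crd i y) * (bs ! i * x))"
        by (subst crd_expand[OF y]) (simp add: sum_distrib_right mult.assoc)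
      moreover have "\<phi> (\<Sum>i<d. of_rat (crd i y) * (bs ! i * x)) = (\<Sum>i<d. \<phi> (of_rat (crd i y) * (bs ! i * x)))"
        by (rule rlin_sum[OF lin]) (use x bs_K in \<open>simp add: K_mult K_of_rat\<close>)
      ultimately have "\<phi> (y * x) = (\<Sum>i<d. \<phi> (of_rat (crd i y) * (bs ! i * x)))" by simp
      also have "\<dots> = (\<Sum>i<d. of_rat (crd i y) * l i * \<phi> x)"
        using lin l x bs_K by (intro sum.cong) (auto simp: rlin_def K_mult)
      finally show ?thesis by (simp add: sum_distrib_right)
    qed
    show ?thesis
    proof (cases "\<phi> 1 = 0")
      case True
      then have "\<phi> y = 0" if "y \<in> K" for y using ev[OF that K_1] by simp
      then show ?thesis unfolding spanned_def by (intro exI[of _ "\<lambda>_. 0"]) simp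
    next
      case False
      \<comment> \<open>A simultaneous eigenfunctional is its value at 1 times a multiplicative
        functional, and the latter is an embedding.\<close>
      define \<theta> where "\<theta> y = \<phi> y / \<phi> 1" for y
      have "(\<Sum>i<d. of_rat (crd i y) * l i) = \<theta> y" if "y \<in> K" for y
        using ev[OF that K_1] False by (simp add: \<theta>_def)
      then have m: "\<phi> (y * x) = \<theta> y * \<phi> x" if "y \<in> K" "x \<in> K" for x y using ev that by simp
      have "is_embedding K \<theta>"
        unfolding is_embedding_def using False m lin by (auto simp: \<theta>_def rlin_def add_divide_distrib)
      then obtain i where i: "i \<in> I" "\<And>x. x \<in> K \<Longrightarrow> \<theta> x = \<tau> i x" using all by blast
      have "\<phi> x = (\<Sum>k\<in>I. (if k = i then \<phi> 1 else 0) * \<tau> k x)" if "x \<in> K" for x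
      proof -
        have "(\<Sum>k\<in>I. (if k = i then \<phi> 1 else 0) * \<tau> k x) = \<phi> 1 * \<tau> i x"
          using fin i(1) by (simp add: if_distrib[of "\<lambda>c. c * _"] cong: if_cong)
        also have "\<dots> = \<phi> 1 * \<theta> x" by (simp only: i(2)[OF that])
        also have "\<dots> = \<phi> x" using False by (simp add: \<theta>_def)
        finally show ?thesis by simp
      qed
      then show ?thesis unfolding spanned_def by (intro exI[of _ "\<lambda>k. if k = i then \<phi> 1 else 0"] ballI)
    qed
  qed
  \<comment> \<open>Induction on the set \<open>B\<close> of basis elements that are not yet
    diagonalised.\<close>
  have step: "spanned I \<tau> \<phi>" if "set bs = A \<union> B" "finite B" "eig A \<phi>" for A B \<phi>
    using that(2,1,3)
  proof (induction B arbitrary: A \<phi> rule: finite_induct)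
    case empty
    then show ?case using base by simp
  next
    case (insert b B)
    have bK: "b \<in> K" and AK: "A \<subseteq> K"
      using insert.prems(1) bs_K by (metis UnI1 UnI2 in_set_conv_nth insertI1, metis UnI1 in_set_conv_nth subsetI)
    obtain p0 :: "rat poly" where p0: "p0 \<noteq> 0" "poly (map_poly of_rat p0) b = 0" by (rule annihilator[OF bK])
    obtain p :: "rat poly" where p: "p \<noteq> 0" "poly (map_poly of_rat p) b = 0"
      "rsquarefree (map_poly of_rat p :: complex poly)" using separable_annihilator[OF p0] by blast
    define P where "P = (map_poly of_rat p :: complex poly)"
    define rs where "rs = {z. poly P z = 0}"
    have P0: "P \<noteq> 0" using p(3) by (simp add: P_def rsquarefree_def)
    then have rs: "finite rs" unfolding rs_def by (rule poly_roots_finite)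
    have fac: "smult (lead_coeff P) (\<Prod>r\<in>rs. [:- r, 1:]) = P"
      unfolding rs_def by (rule complex_poly_decompose_rsquarefree) (use p(3) in \<open>simp add: P_def\<close>)
    show ?case
    proof (rule eig_split[OF rs bK AK _ insert.prems(2)])
      show "spanned I \<tau> \<psi>" if "eig (insert b A) \<psi>" for \<psi>
        by (rule insert.IH[OF _ that]) (use insert.prems(1) in auto)
      fix x assume x: "x \<in> K"
      have lin: "rlin \<phi>" using insert.prems(2) by (simp add: eig_def)
      have "lead_coeff P * act b (\<Prod>r\<in>rs. [:- r, 1:]) \<phi> x = act b P \<phi> x"
        unfolding act_smult[symmetric] fac ..
      also have "\<dots> = \<phi> (poly (map_poly of_rat p) b * x)" unfolding P_def by (rule act_rat[OF lin bK x])
      also have "\<dots> = 0" using p(2) rlin_0[OF lin] by simp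
      finally show "act b (\<Prod>r\<in>rs. [:- r, 1:]) \<phi> x = 0" using P0 by simp
    qed
  qed
  show ?thesis by (rule step[of "{}" "set bs"]) (use \<phi> in \<open>auto simp: eig_def\<close>)
qed

end

lemma number_field_basis_exists:
  assumes "number_field K"
  obtains bs where "is_rat_basis K bs"
proof -
  obtain B where B: "finite B" "rat_vs.span B = K" using assms by (auto simp: number_field_def)
  obtain C where C: "C \<subseteq> B" "rat_vs.independent C" "B \<subseteq> rat_vs.span C"
    using rat_vs.maximal_independent_subset[of B] by blast
  have "rat_vs.span C = K"
    using C B rat_vs.span_mono[of C B] rat_vs.span_minimal[OF C(3) rat_vs.subspace_span] by auto
  moreover obtain bs where "set bs = C" "distinct bs"
    using finite_distinct_list finite_subset[OF C(1) B(1)] by blast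
  ultimately show ?thesis using that[of bs] C(2) by (simp add: is_rat_basis_def)
qed

section \<open>The ring of integers of a CM field\<close>

lemma prod_lessThan_add:
  fixes f :: "nat \<Rightarrow> 'b::comm_monoid_mult"
  shows "(\<Prod>i<m + k. f i) = (\<Prod>i<m. f i) * (\<Prod>i<k. f (m + i))"
  by (induction k) (simp_all add: mult.assoc)

text \<open>\<open>\<sigma>\<close> picks one embedding from each of \<open>n\<close> conjugate
  pairs; \<open>dist_cnj\<close> for \<open>i = j\<close> says that none of them is real, and
  \<open>K_cnj\<close> is the CM property. The basis is pinned by \<open>bs_some\<close> because the
  field norm is defined through that choice.\<close>

locale complex_field = number_field_basis +
  fixes n :: nat and \<sigma> :: "nat \<Rightarrow> 'a \<Rightarrow> complex"
  assumes bs_some: "bs = (SOME bs. is_rat_basis K bs)"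
    and emb: "\<And>i. i < n \<Longrightarrow> is_embedding K (\<sigma> i)"
    and all: "\<And>\<theta>. is_embedding K \<theta> \<Longrightarrow>
      \<exists>i<n. (\<forall>x\<in>K. \<theta> x = \<sigma> i x) \<or> (\<forall>x\<in>K. \<theta> x = cnj (\<sigma> i x))"
    and dist: "\<And>i j. i < n \<Longrightarrow> j < n \<Longrightarrow> i \<noteq> j \<Longrightarrow> \<exists>x\<in>K. \<sigma> i x \<noteq> \<sigma> j x"
    and dist_cnj: "\<And>i j. i < n \<Longrightarrow> j < n \<Longrightarrow> \<exists>x\<in>K. \<sigma> i x \<noteq> cnj (\<sigma> j x)"
    and K_cnj: "\<And>x. x \<in> K \<Longrightarrow> \<exists>y\<in>K. \<forall>i<n. \<sigma> i y = cnj (\<sigma> i x)"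
begin

section \<open>The matrix of embeddings and the field norm\<close>

definition \<tau> :: "nat \<Rightarrow> 'a \<Rightarrow> complex" where
  "\<tau> l = (if l < n then \<sigma> l else (\<lambda>x. cnj (\<sigma> (l - n) x)))"

lemma emb_\<tau>: "l < 2 * n \<Longrightarrow> is_embedding K (\<tau> l)"
  using emb[of l] emb[of "l - n"] by (auto simp: \<tau>_def is_embedding_def)

lemma dist_\<tau>: assumes "i < 2 * n" "j < 2 * n" "i \<noteq> j" shows "\<exists>x\<in>K. \<tau> i x \<noteq> \<tau> j x"
proof (cases "i < n"; cases "j < n")
  assume "i < n" "j < n" then show ?thesis using dist assms by (simp add: \<tau>_def)
next
  assume "i < n" "\<not> j < n" moreover have "j - n < n" using assms by linarith
  ultimately show ?thesis using dist_cnj[of i "j - n"] by (simp add: \<tau>_def)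
next
  assume *: "\<not> i < n" "j < n"
  then have "i - n < n" using assms by linarith
  then obtain x where "x \<in> K" "\<sigma> j x \<noteq> cnj (\<sigma> (i - n) x)" using dist_cnj[OF *(2)] by blast
  then show ?thesis using * by (intro bexI[of _ x]) (auto simp: \<tau>_def)
next
  assume "\<not> i < n" "\<not> j < n" moreover have "i - n < n" "j - n < n" using assms by linarith+
  moreover have "i - n \<noteq> j - n" using calculation assms(3) by linarith
  ultimately show ?thesis using dist[of "i - n" "j - n"] by (simp add: \<tau>_def)
qed

lemma all_\<tau>: assumes "is_embedding K \<theta>" shows "\<exists>l\<in>{..<2 * n}. \<forall>x\<in>K. \<theta> x = \<tau> l x"
proof -
  obtain i where i: "i < n" "(\<forall>x\<in>K. \<theta> x = \<sigma> i x) \<or> (\<forall>x\<in>K. \<theta> x = cnj (\<sigma> i x))" using all[OF assms] by blast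
  then show ?thesis
  proof (elim disjE)
    assume "\<forall>x\<in>K. \<theta> x = \<sigma> i x" then show ?thesis using i(1) by (intro bexI[of _ i]) (auto simp: \<tau>_def)
  next
    assume "\<forall>x\<in>K. \<theta> x = cnj (\<sigma> i x)" then show ?thesis using i(1) by (intro bexI[of _ "n + i"]) (auto simp: \<tau>_def)
  qed
qed

text \<open>The coordinate functionals are combinations of the embeddings, and their coefficients
  form the inverse of the matrix with entries \<open>\<tau> l (bs ! k)\<close>.\<close>

definition coef :: "nat \<Rightarrow> nat \<Rightarrow> complex" where
  "coef = (SOME c. \<forall>k. \<forall>x\<in>K. of_rat (crd k x) = (\<Sum>l<2 * n. c k l * \<tau> l x))"

lemma coef: assumes "x \<in> K" shows "of_rat (crd k x) = (\<Sum>l<2 * n. coef k l * \<tau> l x)"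
proof -
  have "spanned {..<2 * n} \<tau> (\<lambda>x. of_rat (crd k x))" for k
    by (rule hom_spanned[OF all_\<tau>]) (auto intro: crd_rlin)
  then have "\<forall>k. \<exists>c. \<forall>x\<in>K. of_rat (crd k x) = (\<Sum>l<2 * n. c l * \<tau> l x)" unfolding spanned_def by blast
  then have "\<exists>c. \<forall>k. \<forall>x\<in>K. of_rat (crd k x) = (\<Sum>l<2 * n. c k l * \<tau> l x)" by (rule choice)
  then have "\<forall>k. \<forall>x\<in>K. of_rat (crd k x) = (\<Sum>l<2 * n. coef k l * \<tau> l x)"
    unfolding coef_def by (rule someI_ex)
  then show ?thesis using assms by blast
qed

lemma \<tau>_expand: assumes "j < 2 * n" "x \<in> K" shows "\<tau> j x = (\<Sum>k<d. of_rat (crd k x) * \<tau> j (bs ! k))"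
proof -
  note e = emb_\<tau>[OF assms(1)]
  have "\<tau> j x = \<tau> j (\<Sum>k<d. of_rat (crd k x) * bs ! k)" by (subst crd_expand[OF assms(2)]) simp
  also have "\<dots> = (\<Sum>k<d. \<tau> j (of_rat (crd k x) * bs ! k))"
    by (rule emb_sum[OF e]) (simp add: K_mult K_of_rat bs_K)
  also have "\<dots> = (\<Sum>k<d. of_rat (crd k x) * \<tau> j (bs ! k))"
    by (rule sum.cong) (simp_all add: emb_mult[OF e] emb_of_rat[OF e] K_of_rat bs_K)
  finally show ?thesis .
qed

lemma coef_left: "k < d \<Longrightarrow> j < d \<Longrightarrow> (\<Sum>l<2 * n. coef k l * \<tau> l (bs ! j)) = (if k = j then 1 else 0)"
  using coef[OF bs_K, of j k] crd_bs[of k j] by auto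

text \<open>At this point \<open>d\<close> and \<open>2 * n\<close> are not known to agree, so the
  second inverse relation is no formal consequence of \<open>coef_left\<close>. It comes from the
  independence of the embeddings, after \<open>\<tau> j x\<close> is expanded in the basis.\<close>

lemma coef_right: assumes "j < 2 * n" "l < 2 * n" shows "(\<Sum>k<d. \<tau> j (bs ! k) * coef k l) = (if j = l then 1 else 0)"
proof -
  define c where "c l = (\<Sum>k<d. \<tau> j (bs ! k) * coef k l) - (if j = l then 1 else 0)" for l
  have "c l = 0"
  proof (rule embeddings_independent[of "{..<2 * n}" \<tau>])
    fix x assume x: "x \<in> K"
    have "(\<Sum>l<2 * n. (\<Sum>k<d. \<tau> j (bs ! k) * coef k l) * \<tau> l x) = (\<Sum>k<d. (\<Sum>l<2 * n. coef k l * \<tau> l x) * \<tau> j (bs ! k))"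
      unfolding sum_distrib_right by (subst sum.swap) (simp add: mult_ac)
    also have "\<dots> = \<tau> j x" unfolding coef[OF x, symmetric] \<tau>_expand[OF assms(1) x] ..
    also have "\<tau> j x = (\<Sum>l<2 * n. (if j = l then 1 else 0) * \<tau> l x)"
      using assms(1) by (simp add: if_distrib[of "\<lambda>c. c * _"] cong: if_cong)
    finally show "(\<Sum>l<2 * n. c l * \<tau> l x) = 0" by (simp add: c_def left_diff_distrib sum_subtractf)
  qed (use assms emb_\<tau> dist_\<tau> in auto)
  then show ?thesis by (simp add: c_def)
qed

text \<open>The two products of a \<open>d\<close> by \<open>2 * n\<close> matrix with its two-sided
  inverse have equal traces.\<close>

lemma degree_eq: "d = 2 * n"
proof -
  have "of_nat d = (\<Sum>k<d. \<Sum>l<2 * n. coef k l * \<tau> l (bs ! k))" by (simp add: coef_left)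
  also have "\<dots> = (\<Sum>l<2 * n. \<Sum>k<d. \<tau> l (bs ! k) * coef k l)" by (subst sum.swap) (simp add: mult.commute)
  also have "\<dots> = of_nat (2 * n)" by (simp add: coef_right)
  finally show ?thesis by (metis of_nat_eq_iff)
qed

lemma n_pos: "0 < n"
proof (rule ccontr)
  assume "\<not> 0 < n"
  then have "d = 0" using degree_eq by simp
  then have "(1::'a) = 0" using crd_expand[OF K_1] by simp
  then show False by simp
qed

lemma prod_\<tau>: "(\<Prod>l<2 * n. \<tau> l x) = of_real (\<Prod>i<n. (cmod (\<sigma> i x))\<^sup>2)"
proof -
  have "(\<Prod>l<2 * n. \<tau> l x) = (\<Prod>i<n. \<sigma> i x) * (\<Prod>i<n. cnj (\<sigma> i x))"
    unfolding mult_2 prod_lessThan_add by (simp add: \<tau>_def)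
  also have "\<dots> = (\<Prod>i<n. \<sigma> i x * cnj (\<sigma> i x))" by (simp add: prod.distrib)
  also have "\<dots> = (\<Prod>i<n. of_real ((cmod (\<sigma> i x))\<^sup>2))" by (simp only: complex_norm_square)
  finally show ?thesis by simp
qed

text \<open>The matrix \<open>B\<close> of embeddings diagonalises multiplication by
  \<open>x\<close>: the embeddings of \<open>x\<close> are the eigenvalues in \<open>D\<close>, and
  \<open>C\<close> is the inverse of \<open>B\<close>.\<close>

lemma field_norm_prod: assumes "x \<in> K" shows "of_rat (field_norm K x) = (\<Prod>l<2 * n. \<tau> l x)"
proof -
  define C where "C = mat d d (\<lambda>(k, l). coef k l)"
  define D where "D = mat d d (\<lambda>(i, j). if i = j then \<tau> i x else 0)"
  define B where "B = mat d d (\<lambda>(l, k). \<tau> l (bs ! k))"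
  define M where "M = mult_mat bs x"
  have car: "C \<in> carrier_mat d d" "D \<in> carrier_mat d d" "B \<in> carrier_mat d d" "M \<in> carrier_mat d d"
    by (auto simp: C_def D_def B_def M_def mult_mat_def)
  have "map_mat of_rat M = C * (D * B)"
  proof (rule eq_matI)
    fix i j assume "i < dim_row (C * (D * B))" "j < dim_col (C * (D * B))"
    then have ij: "i < d" "j < d" by (auto simp: C_def B_def)
    have DB: "(D * B) $$ (l, j) = \<tau> l x * \<tau> l (bs ! j)" if "l < d" for l
    proof -
      have "(D * B) $$ (l, j) = (\<Sum>k<d. (if l = k then \<tau> l x else 0) * \<tau> k (bs ! j))"
        using that ij by (simp add: D_def B_def scalar_prod_def lessThan_atLeast0)
      then show ?thesis using that by (simp add: if_distrib[of "\<lambda>c. c * _"] cong: if_cong)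
    qed
    have "(C * (D * B)) $$ (i, j) = (\<Sum>l<d. coef i l * ((D * B) $$ (l, j)))"
      using ij car by (simp add: C_def scalar_prod_def lessThan_atLeast0 B_def D_def)
    also have "\<dots> = (\<Sum>l<d. coef i l * (\<tau> l x * \<tau> l (bs ! j)))" by (rule sum.cong) (auto simp: DB)
    also have "\<dots> = (\<Sum>l<2 * n. coef i l * \<tau> l (x * bs ! j))"
      unfolding degree_eq by (rule sum.cong) (use ij in \<open>auto simp: emb_mult[OF emb_\<tau>] assms bs_K\<close>)
    also have "\<dots> = of_rat (crd i (x * bs ! j))"
      using coef[of "x * bs ! j" i] K_mult[OF assms bs_K[OF ij(2)]] by simp
    finally show "map_mat of_rat M $$ (i, j) = (C * (D * B)) $$ (i, j)"
      using ij by (simp add: M_def mult_mat_def crd_def)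
  qed (auto simp: M_def mult_mat_def C_def B_def)
  then have "det (map_mat of_rat M) = det C * (det D * det B)"
    using car by (simp add: det_mult[of _ d])
  moreover have "C * B = 1\<^sub>m d"
  proof (rule eq_matI)
    fix i j assume "i < dim_row (1\<^sub>m d)" "j < dim_col (1\<^sub>m d)"
    then have ij: "i < d" "j < d" by auto
    have "(C * B) $$ (i, j) = (\<Sum>l<d. coef i l * \<tau> l (bs ! j))"
      using ij by (simp add: C_def B_def scalar_prod_def lessThan_atLeast0)
    then show "(C * B) $$ (i, j) = 1\<^sub>m d $$ (i, j)" using ij coef_left[OF ij] by (simp add: degree_eq)
  qed (auto simp: C_def B_def)
  then have "det C * det B = 1" using det_mult[OF car(1,3)] by simp
  moreover have "det D = (\<Prod>l<d. \<tau> l x)"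
  proof -
    have "det D = prod_list (diag_mat D)" by (rule det_upper_triangular[OF _ car(2)]) (auto simp: D_def)
    also have "diag_mat D = map (\<lambda>l. \<tau> l x) [0..<d]" by (auto simp: diag_mat_def D_def)
    also have "prod_list \<dots> = (\<Prod>l<d. \<tau> l x)"
      by (simp add: prod.distinct_set_conv_list lessThan_atLeast0 flip: set_upt)
    finally show ?thesis .
  qed
  ultimately have "det (map_mat of_rat M) = (\<Prod>l<d. \<tau> l x)" by (simp add: mult_ac)
  then have "of_rat (det M) = (\<Prod>l<d. \<tau> l x)" by (simp add: of_rat_hom.hom_det)
  then show ?thesis by (simp add: field_norm_def M_def degree_eq flip: bs_some)
qed

lemma field_norm_real: assumes "x \<in> K" shows "of_rat (field_norm K x) = (\<Prod>i<n. (cmod (\<sigma> i x))\<^sup>2)"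
proof -
  have "(of_rat q :: complex) = of_real (of_rat q)" for q
    by (cases q rule: Rat_cases) (simp add: of_rat_rat)
  then have "of_real (of_rat (field_norm K x)) = (of_real (\<Prod>i<n. (cmod (\<sigma> i x))\<^sup>2) :: complex)"
    using field_norm_prod[OF assms] prod_\<tau>[of x] by (simp only:)
  then show ?thesis by (simp only: of_real_eq_iff)
qed

section \<open>The ring of integers as a lattice\<close>

abbreviation "OK \<equiv> ring_of_integers K"

lemma OK_K: "a \<in> OK \<Longrightarrow> a \<in> K" and OK_int: "a \<in> OK \<Longrightarrow> algebraic_int a"
  by (auto simp: ring_of_integers_def)

lemma OK_ring: "1 \<in> OK" "a \<in> OK \<Longrightarrow> b \<in> OK \<Longrightarrow> a + b \<in> OK"
  "a \<in> OK \<Longrightarrow> b \<in> OK \<Longrightarrow> a - b \<in> OK" "a \<in> OK \<Longrightarrow> b \<in> OK \<Longrightarrow> a * b \<in> OK"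
  by (auto simp: ring_of_integers_def K_add K_diff K_mult algebraic_int_add_mult algebraic_int_diff)

lemma OK_of_int: "of_int k \<in> OK" by (simp add: ring_of_integers_def K_of_int)
lemma OK_0: "0 \<in> OK" using OK_of_int[of 0] by simp

lemma OK_sum: "(\<And>i. i \<in> I \<Longrightarrow> f i \<in> OK) \<Longrightarrow> (\<Sum>i\<in>I. f i) \<in> OK"
  by (induction I rule: infinite_finite_induct) (auto intro: OK_ring OK_0)

lemma \<tau>_int: assumes "a \<in> OK" "l < 2 * n" shows "algebraic_int (\<tau> l a)"
  using emb_algebraic_int[OF emb_\<tau>[OF assms(2)] OK_K[OF assms(1)]] OK_int[OF assms(1)] by simp

text \<open>As a product of conjugates the number is an algebraic integer, and as a field norm it is
  rational.\<close>

lemma OK_norm_Ints: assumes "a \<in> OK" shows "(\<Prod>i<n. (cmod (\<sigma> i a))\<^sup>2) \<in> \<int>"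
proof -
  have "algebraic_int (complex_of_real (\<Prod>i<n. (cmod (\<sigma> i a))\<^sup>2))"
    unfolding prod_\<tau>[symmetric] by (rule algebraic_int_prod) (use \<tau>_int[OF assms] in auto)
  then have "algebraic_int (\<Prod>i<n. (cmod (\<sigma> i a))\<^sup>2)" by (simp only: algebraic_int_of_real_iff)
  moreover have "(\<Prod>i<n. (cmod (\<sigma> i a))\<^sup>2) \<in> \<rat>"
    unfolding field_norm_real[OF OK_K[OF assms], symmetric] by (rule Rats_of_rat)
  ultimately show ?thesis by (rule rational_algebraic_int_is_int)
qed

text \<open>A common denominator \<open>m\<close> of the multiplication matrix of \<open>x\<close>
  makes \<open>m\<close> times \<open>x\<close> preserve the module generated by the basis.\<close>

lemma OK_multiple: assumes "x \<in> K" obtains m :: nat where "0 < m" "of_nat m * x \<in> OK"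
proof -
  define F where "F = (\<lambda>(i, j). crd i (x * bs ! j)) ` ({..<d} \<times> {..<d})"
  have "finite F" by (simp add: F_def)
  then obtain m where m: "0 < (m::nat)" "\<And>q. q \<in> F \<Longrightarrow> of_nat m * q \<in> \<int>" using common_denominator by blast
  have d0: "0 < d" using n_pos degree_eq by simp
  have "bs ! 0 \<noteq> 0"
  proof
    assume "bs ! 0 = 0"
    then have "0 \<in> set bs" using d0 nth_mem by metis
    then show False using indep_bs rat_vs.dependent_zero by blast
  qed
  have "algebraic_int (of_nat m * x)"
  proof (rule algebraic_int_zspan[of "{..<d}" 0 "\<lambda>i. bs ! i"])
    fix j assume "j \<in> {..<d}"
    then have j: "j < d" by simp
    have "of_nat m * crd i (x * bs ! j) \<in> \<int>" if "i < d" for i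
      by (rule m(2)) (use that j in \<open>auto simp: F_def intro!: image_eqI[of _ _ "(i, j)"]\<close>)
    then have "\<forall>i. \<exists>z. i < d \<longrightarrow> of_nat m * crd i (x * bs ! j) = of_int z" by (auto elim!: Ints_cases)
    then obtain z where z: "\<And>i. i < d \<Longrightarrow> of_nat m * crd i (x * bs ! j) = of_int (z i)" by metis
    have "of_nat m * x * bs ! j = of_nat m * (\<Sum>i<d. of_rat (crd i (x * bs ! j)) * bs ! i)"
      by (subst crd_expand[symmetric]) (simp_all add: K_mult assms bs_K j mult.assoc)
    also have "\<dots> = (\<Sum>i<d. of_int (z i) * bs ! i)"
      unfolding sum_distrib_left
    proof (rule sum.cong[OF refl])
      fix i assume "i \<in> {..<d}"
      then have "of_rat (of_nat m * crd i (x * bs ! j)) = (of_int (z i) :: 'a)" using z[of i] by simp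
      then have "of_nat m * of_rat (crd i (x * bs ! j)) = (of_int (z i) :: 'a)" by (simp add: of_rat_mult)
      then show "of_nat m * (of_rat (crd i (x * bs ! j)) * bs ! i) = of_int (z i) * bs ! i"
        by (simp add: mult.assoc[symmetric])
    qed
    finally show "of_nat m * x * bs ! j \<in> zspan {..<d} ((!) bs)" by (rule zspanI)
  qed (use d0 \<open>bs ! 0 \<noteq> 0\<close> in auto)
  then have "of_nat m * x \<in> OK" using assms by (simp add: ring_of_integers_def K_mult K_of_nat)
  then show ?thesis using that m(1) by blast
qed

lemma OK_near:
  obtains R where "0 < R" "\<And>x :: nat \<Rightarrow> complex. \<exists>a\<in>OK. \<forall>i<n. cmod (x i - \<sigma> i a) \<le> R"
proof -
  have "\<exists>m::nat. k < d \<longrightarrow> 0 < m \<and> of_nat m * bs ! k \<in> OK" for k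
    using OK_multiple[OF bs_K] by metis
  then obtain m :: "nat \<Rightarrow> nat" where m: "\<And>k. k < d \<Longrightarrow> 0 < m k" "\<And>k. k < d \<Longrightarrow> of_nat (m k) * bs ! k \<in> OK"
    by metis
  define R where "R = 1 + (\<Sum>i<n. \<Sum>k<d. m k * cmod (\<sigma> i (bs ! k)))"
  have "0 < R" unfolding R_def by (intro add_pos_nonneg sum_nonneg) auto
  moreover have "\<exists>a\<in>OK. \<forall>i<n. cmod (x i - \<sigma> i a) \<le> R" for x :: "nat \<Rightarrow> complex"
  proof -
    \<comment> \<open>Completing \<open>x\<close> by its conjugates gives one value per embedding;
      \<open>coef\<close> then reads off the coordinates \<open>c\<close> in the basis.\<close>
    define X where "X l = (if l < n then x l else cnj (x (l - n)))" for l
    define c where "c k = (\<Sum>l<2 * n. coef k l * X l)" for k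
    have cX: "(\<Sum>k<d. \<tau> j (bs ! k) * c k) = X j" if "j < 2 * n" for j
    proof -
      have "(\<Sum>k<d. \<tau> j (bs ! k) * c k) = (\<Sum>l<2 * n. (\<Sum>k<d. \<tau> j (bs ! k) * coef k l) * X l)"
        unfolding c_def sum_distrib_left sum_distrib_right by (subst sum.swap) (simp add: mult.assoc)
      also have "\<dots> = (\<Sum>l<2 * n. (if j = l then 1 else 0) * X l)"
        by (rule sum.cong) (auto simp: coef_right that)
      finally show ?thesis using that by (simp add: if_distrib[of "\<lambda>c. c * _"] cong: if_cong)
    qed
    \<comment> \<open>Averaging with the conjugate equation replaces \<open>c k\<close> by its real
      part, so the coordinates can be rounded without a proof that \<open>c k\<close> is
      real.\<close>
    have rX: "(\<Sum>k<d. \<sigma> i (bs ! k) * of_real (Re (c k))) = x i" if i: "i < n" for i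
    proof -
      have 1: "(\<Sum>k<d. \<sigma> i (bs ! k) * c k) = x i" using cX[of i] i by (simp add: \<tau>_def X_def)
      have "(\<Sum>k<d. cnj (\<sigma> i (bs ! k)) * c k) = cnj (x i)" using cX[of "n + i"] i by (simp add: \<tau>_def X_def)
      then have "cnj (\<Sum>k<d. cnj (\<sigma> i (bs ! k)) * c k) = x i" by simp
      then have 2: "(\<Sum>k<d. \<sigma> i (bs ! k) * cnj (c k)) = x i" by simp
      have "(\<Sum>k<d. \<sigma> i (bs ! k) * (c k + cnj (c k))) = x i + x i"
        unfolding distrib_left sum.distrib 1 2 ..
      then have "2 * (\<Sum>k<d. \<sigma> i (bs ! k) * of_real (Re (c k))) = 2 * x i"
        unfolding complex_add_cnj sum_distrib_left by (simp add: mult_ac)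
      then show ?thesis by simp
    qed
    define z where "z k = \<lfloor>Re (c k) / m k\<rfloor>" for k
    define a where "a = (\<Sum>k<d. of_int (z k) * (of_nat (m k) * bs ! k))"
    have "a \<in> OK" unfolding a_def by (intro OK_sum OK_ring OK_of_int m) simp
    moreover have "cmod (x i - \<sigma> i a) \<le> R" if i: "i < n" for i
    proof -
      note e = emb[OF i]
      have "\<sigma> i a = (\<Sum>k<d. \<sigma> i (of_int (z k) * (of_nat (m k) * bs ! k)))"
        unfolding a_def by (rule emb_sum[OF e]) (simp add: K_mult K_of_int K_of_nat bs_K)
      also have "\<dots> = (\<Sum>k<d. \<sigma> i (bs ! k) * of_real (of_int (z k) * real (m k)))"
        by (rule sum.cong) (simp_all add: emb_mult[OF e] emb_of_int[OF e] emb_of_nat[OF e] K_mult K_of_int K_of_nat bs_K)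
      finally have sa: "\<sigma> i a = (\<Sum>k<d. \<sigma> i (bs ! k) * of_real (of_int (z k) * real (m k)))" .
      have "x i - \<sigma> i a = (\<Sum>k<d. \<sigma> i (bs ! k) * of_real (Re (c k) - of_int (z k) * real (m k)))"
        unfolding sa rX[OF i, symmetric] by (simp add: sum_subtractf right_diff_distrib)
      also have "cmod \<dots> \<le> (\<Sum>k<d. m k * cmod (\<sigma> i (bs ! k)))"
      proof (rule sum_norm_le)
        fix k assume "k \<in> {..<d}"
        then have mk: "0 < real (m k)" using m(1) by simp
        have "of_int (z k) \<le> Re (c k) / m k" "Re (c k) / m k < of_int (z k) + 1" unfolding z_def by linarith+
        then have "of_int (z k) * real (m k) \<le> Re (c k)" "Re (c k) < (of_int (z k) + 1) * real (m k)"
          using mk by (simp_all add: pos_le_divide_eq pos_divide_less_eq)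
        then have "\<bar>Re (c k) - of_int (z k) * real (m k)\<bar> \<le> m k" by (simp add: distrib_right)
        then have "cmod (\<sigma> i (bs ! k)) * \<bar>Re (c k) - of_int (z k) * real (m k)\<bar> \<le> cmod (\<sigma> i (bs ! k)) * m k"
          by (rule mult_left_mono) simp
        then show "cmod (\<sigma> i (bs ! k) * of_real (Re (c k) - of_int (z k) * real (m k))) \<le> m k * cmod (\<sigma> i (bs ! k))"
          unfolding norm_mult norm_of_real by (simp add: mult.commute)
      qed
      also have "\<dots> \<le> (\<Sum>i<n. \<Sum>k<d. m k * cmod (\<sigma> i (bs ! k)))"
        by (rule member_le_sum[of i "{..<n}" "\<lambda>i. \<Sum>k<d. m k * cmod (\<sigma> i (bs ! k))"])
          (use i in \<open>auto intro!: sum_nonneg\<close>)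
      finally show ?thesis by (simp add: R_def)
    qed
    ultimately show ?thesis by blast
  qed
  ultimately show ?thesis using that by blast
qed

text \<open>For nonzero \<open>a\<close> the witness is the norm divided by \<open>a\<close>. It
  equals the product of the other conjugates and is therefore integral, so every integer divides its
  norm inside the ring.\<close>

lemma OK_adj: assumes "a \<in> OK"
  shows "\<exists>b\<in>OK. \<forall>i<n. \<sigma> i a * \<sigma> i b = of_real (\<Prod>i<n. (cmod (\<sigma> i a))\<^sup>2)"
proof (cases "a = 0")
  case True
  have "(\<Prod>i<n. (cmod (\<sigma> i a))\<^sup>2) = 0"
    using n_pos True emb_0[OF emb[OF n_pos]] by (intro prod_zero) auto
  moreover have "\<sigma> i a = 0" if "i < n" for i using True emb_0[OF emb[OF that]] by simp
  ultimately show ?thesis using OK_0 by auto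
next
  case False
  define b where "b = of_rat (field_norm K a) / a"
  have bK: "b \<in> K" unfolding b_def by (intro K_divide K_of_rat OK_K assms)
  have mult: "\<sigma> i a * \<sigma> i b = of_real (\<Prod>i<n. (cmod (\<sigma> i a))\<^sup>2)" if i: "i < n" for i
  proof -
    have "\<sigma> i a * \<sigma> i b = \<sigma> i (a * b)" using emb_mult[OF emb[OF i] OK_K[OF assms] bK] by simp
    also have "a * b = of_rat (field_norm K a)" using False by (simp add: b_def)
    also have "\<sigma> i (of_rat (field_norm K a)) = of_rat (field_norm K a)" by (rule emb_of_rat[OF emb[OF i]])
    finally show ?thesis using field_norm_prod[OF OK_K[OF assms]] prod_\<tau>[of a] by simp
  qed
  have nz: "\<tau> 0 a \<noteq> 0" using emb_nz[OF emb_\<tau> OK_K[OF assms] False] n_pos by simp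
  have "\<tau> 0 a * \<tau> 0 b = (\<Prod>l<2 * n. \<tau> l a)" using mult[OF n_pos] n_pos prod_\<tau>[of a] by (simp add: \<tau>_def)
  also have "\<dots> = \<tau> 0 a * (\<Prod>l\<in>{..<2 * n} - {0}. \<tau> l a)" using n_pos by (subst prod.remove[of _ 0]) auto
  finally have "\<tau> 0 b = (\<Prod>l\<in>{..<2 * n} - {0}. \<tau> l a)" using nz by simp
  then have "algebraic_int (\<tau> 0 b)" using algebraic_int_prod[of "{..<2 * n} - {0}" "\<lambda>l. \<tau> l a"] \<tau>_int[OF assms] by auto
  then have "algebraic_int b" using emb_algebraic_int[OF emb_\<tau> bK] n_pos by simp
  then have "b \<in> OK" using bK by (simp add: ring_of_integers_def)
  then show ?thesis using mult by blast
qed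

lemma OK_cnj: assumes "a \<in> OK" shows "\<exists>b\<in>OK. \<forall>i<n. \<sigma> i b = cnj (\<sigma> i a)"
proof -
  obtain b where b: "b \<in> K" "\<forall>i<n. \<sigma> i b = cnj (\<sigma> i a)" using K_cnj[OF OK_K[OF assms]] by blast
  have "algebraic_int (\<sigma> 0 a)"
    using emb_algebraic_int[OF emb[OF n_pos] OK_K[OF assms]] OK_int[OF assms] by simp
  then have "algebraic_int (\<sigma> 0 b)" using b(2) n_pos by simp
  then have "algebraic_int b" using emb_algebraic_int[OF emb[OF n_pos] b(1)] by simp
  then show ?thesis using b by (auto simp: ring_of_integers_def)
qed

text \<open>The element is an integral multiple of \<open>x\<close> minus its conjugate, for some
  \<open>x\<close> that conjugation moves.\<close>

lemma OK_imaginary: "\<exists>a\<in>OK. a \<noteq> 0 \<and> (\<forall>i<n. cnj (\<sigma> i a) = - \<sigma> i a)"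
proof -
  obtain x where x: "x \<in> K" "\<sigma> 0 x \<noteq> cnj (\<sigma> 0 x)" using dist_cnj[OF n_pos n_pos] by blast
  obtain y where y: "y \<in> K" "\<forall>i<n. \<sigma> i y = cnj (\<sigma> i x)" using K_cnj[OF x(1)] by blast
  have xy: "x - y \<in> K" by (intro K_diff x y)
  obtain m :: nat where m: "0 < m" "of_nat m * (x - y) \<in> OK" using OK_multiple[OF xy] by blast
  have "x \<noteq> y" using x(2) y(2) n_pos by auto
  then have "of_nat m * (x - y) \<noteq> 0" using m(1) by simp
  moreover have "cnj (\<sigma> i (of_nat m * (x - y))) = - \<sigma> i (of_nat m * (x - y))" if i: "i < n" for i
  proof -
    have eq: "\<sigma> i (of_nat m * (x - y)) = of_nat m * (\<sigma> i x - cnj (\<sigma> i x))"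
      using emb_mult[OF emb[OF i] K_of_nat xy] emb_diff[OF emb[OF i] x(1) y(1)] emb_of_nat[OF emb[OF i]] y(2) i by simp
    show ?thesis unfolding eq by (simp add: algebra_simps)
  qed
  ultimately show ?thesis using m(2) by blast
qed

lemma OK_nonzero: "a \<in> OK \<Longrightarrow> i < n \<Longrightarrow> \<sigma> i a = 0 \<Longrightarrow> a = 0"
  using emb_nz[OF emb OK_K] by blast

end

text \<open>If \<open>x\<close> lies outside \<open>F\<close>, then 1 and \<open>x\<close> span
  \<open>K\<close> over \<open>F\<close>, and \<open>x * x = A + B * x\<close> with totally real
  \<open>A\<close> and \<open>B\<close>. The conjugate root is \<open>B - x\<close>, the same
  element for all embeddings.\<close>

lemma (in field_set) quadratic_conjugate:
  assumes F: "is_subfield F" "totally_real F" and q: "quadratic_extension F K" and c: "totally_complex K" and x: "x \<in> K"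
  shows "\<exists>y\<in>K. \<forall>\<theta>. is_embedding K \<theta> \<longrightarrow> \<theta> y = cnj (\<theta> x)"
proof -
  interpret F: field_set F using F(1) by unfold_locales
  have FK: "F \<subseteq> K" using q by (simp add: quadratic_extension_def)
  have real: "\<theta> a \<in> \<real>" if "is_embedding K \<theta>" "a \<in> F" for \<theta> a
  proof -
    have "is_embedding F \<theta>" using that(1) FK unfolding is_embedding_def by blast
    then have "is_real_embedding F \<theta>" using F(2) by (simp add: totally_real_def)
    then show ?thesis using that(2) by (auto simp: is_real_embedding_def)
  qed
  have "\<exists>e\<^sub>1\<in>K. \<exists>e\<^sub>2\<in>K. \<forall>x\<in>K. \<exists>!(a, b). a \<in> F \<and> b \<in> F \<and> x = a * e\<^sub>1 + b * e\<^sub>2"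
    using q unfolding quadratic_extension_def by (rule conjunct2)
  then obtain e1 e2 where e: "e1 \<in> K" "e2 \<in> K" "\<forall>x\<in>K. \<exists>!(a, b). a \<in> F \<and> b \<in> F \<and> x = a * e1 + b * e2"
    by (elim bexE)
  have ex: "\<exists>a\<in>F. \<exists>b\<in>F. y = a * e1 + b * e2" if "y \<in> K" for y
    using ex1_implies_ex[OF e(3)[rule_format, OF that]] by auto
  show ?thesis
  proof (cases "x \<in> F")
    case True
    then have "\<theta> x = cnj (\<theta> x)" if "is_embedding K \<theta>" for \<theta>
      using real[OF that True] by (simp add: Reals_cnj_iff)
    then show ?thesis using x by blast
  next
    case False
    obtain a1 b1 where 1: "a1 \<in> F" "b1 \<in> F" "1 = a1 * e1 + b1 * e2" using ex[OF K_1] by blast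
    obtain a2 b2 where 2: "a2 \<in> F" "b2 \<in> F" "x = a2 * e1 + b2 * e2" using ex[OF x] by blast
    \<comment> \<open>The determinant of 1 and \<open>x\<close> in the given basis.
      \<open>D1\<close> and \<open>D2\<close> are Cramer's rule; if the determinant vanished, they
      would make \<open>x\<close> a quotient of elements of \<open>F\<close>.\<close>
    define \<Delta> where "\<Delta> = a1 * b2 - a2 * b1"
    have D1: "b2 - b1 * x = \<Delta> * e1"
    proof -
      have "b2 - b1 * x = b2 * 1 - b1 * x" by simp
      also have "\<dots> = b2 * (a1 * e1 + b1 * e2) - b1 * (a2 * e1 + b2 * e2)" by (simp only: 1(3)[symmetric] 2(3)[symmetric])
      finally show ?thesis by (simp add: \<Delta>_def algebra_simps)
    qed
    have D2: "a1 * x - a2 = \<Delta> * e2"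
    proof -
      have "a1 * x - a2 = a1 * x - a2 * 1" by simp
      also have "\<dots> = a1 * (a2 * e1 + b2 * e2) - a2 * (a1 * e1 + b1 * e2)" by (simp only: 1(3)[symmetric] 2(3)[symmetric])
      finally show ?thesis by (simp add: \<Delta>_def algebra_simps)
    qed
    have D0: "\<Delta> \<noteq> 0"
    proof
      assume D: "\<Delta> = 0"
      have "a1 \<noteq> 0 \<or> b1 \<noteq> 0" using 1(3) by auto
      then show False
      proof
        assume "a1 \<noteq> 0"
        then have "x = a2 / a1" using D2 D by (simp add: field_simps)
        then show False using False F.K_divide 1 2 by simp
      next
        assume "b1 \<noteq> 0"
        then have "x = b2 / b1" using D1 D by (simp add: field_simps)
        then show False using False F.K_divide 1 2 by simp
      qed
    qed
    have DF: "\<Delta> \<in> F" unfolding \<Delta>_def by (intro F.K_diff F.K_mult 1 2)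
    have lin: "\<exists>a\<in>F. \<exists>b\<in>F. y = a + b * x" if y: "y \<in> K" for y
    proof -
      obtain a b where ab: "a \<in> F" "b \<in> F" "y = a * e1 + b * e2" using ex[OF y] by blast
      have "\<Delta> * y = a * (\<Delta> * e1) + b * (\<Delta> * e2)" by (simp add: ab(3) algebra_simps)
      also have "\<dots> = (a * b2 - b * a2) + (b * a1 - a * b1) * x" unfolding D1[symmetric] D2[symmetric] by (simp add: algebra_simps)
      finally have "\<Delta> * y = (a * b2 - b * a2) + (b * a1 - a * b1) * x" .
      then have "y = ((a * b2 - b * a2) + (b * a1 - a * b1) * x) / \<Delta>"
        by (metis D0 nonzero_mult_div_cancel_left)
      then have "y = (a * b2 - b * a2) / \<Delta> + (b * a1 - a * b1) / \<Delta> * x"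
        by (simp only: add_divide_distrib times_divide_eq_left)
      moreover have "(a * b2 - b * a2) / \<Delta> \<in> F" "(b * a1 - a * b1) / \<Delta> \<in> F"
        by (intro F.K_divide F.K_diff F.K_mult ab 1 2 DF)+
      ultimately show ?thesis by blast
    qed
    obtain A B where AB: "A \<in> F" "B \<in> F" "x * x = A + B * x" using lin[OF K_mult[OF x x]] by blast
    have "\<theta> (B - x) = cnj (\<theta> x)" if \<theta>: "is_embedding K \<theta>" for \<theta>
    proof -
      define w where "w = \<theta> x"
      \<comment> \<open>A real value at \<open>x\<close> would make \<open>\<theta>\<close> real on
        all of \<open>K\<close>, whose elements are \<open>a + b * x\<close>.\<close>
      have wn: "w \<noteq> cnj w"
      proof
        assume "w = cnj w"
        then have wR: "w \<in> \<real>" by (metis Reals_cnj_iff)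
        have "\<theta> y \<in> \<real>" if y: "y \<in> K" for y
        proof -
          obtain a b where ab: "a \<in> F" "b \<in> F" "y = a + b * x" using lin[OF y] by blast
          have K: "a \<in> K" "b \<in> K" "b * x \<in> K" using ab FK x K_mult by auto
          have "\<theta> y = \<theta> a + \<theta> b * w" using emb_add[OF \<theta> K(1,3)] emb_mult[OF \<theta> K(2) x] by (simp add: ab(3) w_def)
          then show ?thesis using real[OF \<theta>] ab wR by simp
        qed
        moreover have "\<not> \<theta> ` K \<subseteq> \<real>" using c \<theta> by (auto simp: totally_complex_def is_nonreal_embedding_def)
        ultimately show False by blast
      qed
      have K: "A \<in> K" "B \<in> K" "B * x \<in> K" using AB FK x K_mult by auto
      have w2: "w * w = \<theta> A + \<theta> B * w"
        using emb_mult[OF \<theta> x x] emb_add[OF \<theta> K(1,3)] emb_mult[OF \<theta> K(2) x] by (simp add: AB(3) w_def)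
      have "cnj (w * w) = cnj (\<theta> A + \<theta> B * w)" by (simp only: w2)
      then have "cnj w * cnj w = \<theta> A + \<theta> B * cnj w"
        using real[OF \<theta> AB(1)] real[OF \<theta> AB(2)] by (simp add: Reals_cnj_iff)
      then have "(w - cnj w) * (w + cnj w - \<theta> B) = 0" using w2 by (simp add: algebra_simps)
      then have "w + cnj w - \<theta> B = 0" using wn by simp
      then have "cnj w = \<theta> B - w" by (simp add: algebra_simps)
      then show ?thesis using emb_diff[OF \<theta> K(2) x] by (simp add: w_def)
    qed
    moreover have "B - x \<in> K" using K_diff FK AB(2) x by blast
    ultimately show ?thesis by blast
  qed
qed

lemma independent_units:
  assumes "unit_rank K \<ge> 3"
  obtains u v where "u \<in> unit_group K" "v \<in> unit_group K"
    "\<And>p q. u powi p * v powi q = 1 \<Longrightarrow> p = 0 \<and> q = 0"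
proof -
  have "\<exists>S. S \<subseteq> unit_group K \<and> finite S \<and> mult_independent S \<and> 2 \<le> card S"
  proof (rule ccontr)
    assume neg: "\<not> ?thesis"
    have "unit_rank K \<le> 1"
      unfolding unit_rank_def
    proof (rule SUP_least)
      fix S assume "S \<in> {S. S \<subseteq> unit_group K \<and> finite S \<and> mult_independent S}"
      then have "card S \<le> 1" using neg by fastforce
      then show "enat (card S) \<le> 1" by (simp add: one_enat_def)
    qed
    then have "(3::enat) \<le> 1" using assms order_trans by blast
    then show False by (simp add: one_enat_def numeral_eq_enat)
  qed
  then obtain S where S: "S \<subseteq> unit_group K" "finite S" "mult_independent S" "2 \<le> card S" by blast
  obtain T where T: "T \<subseteq> S" "card T = 2" using obtain_subset_with_card_n[OF S(4)] by blast
  obtain u v where uv: "T = {u, v}" "u \<noteq> v" using T(2) by (auto simp: card_2_iff)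
  have ind: "p = 0 \<and> q = 0" if "u powi p * v powi q = 1" for p q
  proof -
    define e where "e w = (if w = u then p else if w = v then q else 0)" for w
    have "(\<Prod>w\<in>S. w powi e w) = (\<Prod>w\<in>T. w powi e w)"
      by (rule prod.mono_neutral_right) (use S T uv in \<open>auto simp: e_def\<close>)
    also have "\<dots> = u powi p * v powi q" using uv by (simp add: e_def)
    finally have "(\<Prod>w\<in>S. w powi e w) = 1" using that by simp
    then have "\<forall>w\<in>S. e w = 0" using S(3) unfolding mult_independent_def by blast
    then have "e u = 0" "e v = 0" using T uv by auto
    then show ?thesis using uv by (auto simp: e_def)
  qed
  show ?thesis
  proof (rule that)
    show "u \<in> unit_group K" "v \<in> unit_group K" using S(1) T(1) uv(1) by auto
  qed (rule ind)
qed

section \<open>Lattices in complex space\<close>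

text \<open>Bolzano-Weierstrass, refining the subsequence one coordinate at a time.\<close>

lemma coordinatewise_subsequence:
  fixes f :: "nat \<Rightarrow> nat \<Rightarrow> complex"
  assumes bd: "\<And>k i. i < m \<Longrightarrow> cmod (f k i) \<le> B"
  shows "\<exists>r. strict_mono r \<and> (\<forall>i<m. convergent (\<lambda>k. f (r k) i))"
  using bd
proof (induction m)
  case 0
  show ?case by (auto intro!: exI[of _ id] simp: strict_mono_def)
next
  case (Suc m)
  then obtain r where r: "strict_mono r" "\<forall>i<m. convergent (\<lambda>k. f (r k) i)"
    by (meson less_Suc_eq)
  have "bounded (range (\<lambda>k. f (r k) m))"
    unfolding bounded_iff using Suc.prems[of m] by (auto intro!: exI[of _ B])
  then obtain l q where q: "strict_mono q" "((\<lambda>k. f (r k) m) \<circ> q) \<longlonglongrightarrow> l"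
    using bounded_imp_convergent_subsequence by blast
  have "convergent (\<lambda>k. f ((r \<circ> q) k) i)" if "i < Suc m" for i
  proof (cases "i = m")
    case True
    then show ?thesis using q(2) by (auto simp: convergent_def o_def)
  next
    case False
    then have "convergent (\<lambda>k. f (r k) i)" using r(2) that by auto
    then have "convergent ((\<lambda>k. f (r k) i) \<circ> q)"
      by (rule convergent_subseq_convergent[OF _ q(1)])
    then show ?thesis by (simp add: o_def)
  qed
  moreover have "strict_mono (r \<circ> q)" using r q by (simp add: strict_mono_o)
  ultimately show ?case by blast
qed

text \<open>\<open>L\<close> stands for the image of the ring of integers in \<open>\<complex>\<^sup>n\<close>; vectors are functions on \<open>nat\<close> that
  vanish from \<open>n\<close> on, and are added and multiplied pointwise.\<close>

locale num_lattice =
  fixes n :: nat and L :: "(nat \<Rightarrow> complex) set" and R :: real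
  assumes n_pos: "0 < n"
    and L_sub: "a \<in> L \<Longrightarrow> i \<ge> n \<Longrightarrow> a i = 0"
    and L_add: "a \<in> L \<Longrightarrow> b \<in> L \<Longrightarrow> a + b \<in> L"
    and L_minus: "a \<in> L \<Longrightarrow> b \<in> L \<Longrightarrow> a - b \<in> L"
    and L_mult: "a \<in> L \<Longrightarrow> b \<in> L \<Longrightarrow> a * b \<in> L"
    and L_one: "(\<lambda>i. if i < n then 1 else 0) \<in> L"
    and L_norm_Ints: "a \<in> L \<Longrightarrow> (\<Prod>i<n. (cmod (a i))\<^sup>2) \<in> \<int>"
    and L_nonzero: "a \<in> L \<Longrightarrow> i < n \<Longrightarrow> a i = 0 \<Longrightarrow> a = 0"
    and R_pos: "0 < R"
    and L_near: "(\<And>i. i \<ge> n \<Longrightarrow> x i = 0) \<Longrightarrow> \<exists>a\<in>L. \<forall>i<n. cmod (x i - a i) \<le> R"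
begin

definition E :: "(nat \<Rightarrow> complex) set" where "E = {x. \<forall>i\<ge>n. x i = 0}"

definition e :: "nat \<Rightarrow> complex" where "e = (\<lambda>i. if i < n then 1 else 0)"

definition nm :: "(nat \<Rightarrow> complex) \<Rightarrow> real" where "nm x = (\<Prod>i<n. (cmod (x i))\<^sup>2)"

text \<open>Sequential closedness for coordinatewise convergence in \<open>n\<close> coordinates.
  The limit is required to lie in \<open>E\<close> because convergence says nothing about the
  coordinates from \<open>n\<close> on.\<close>

definition sclosed :: "(nat \<Rightarrow> complex) set \<Rightarrow> bool" where
  "sclosed S \<longleftrightarrow> S \<subseteq> E \<and>
     (\<forall>f l. (\<forall>k. f k \<in> S) \<longrightarrow> l \<in> E \<longrightarrow> (\<forall>i<n. (\<lambda>k. f k i) \<longlonglongrightarrow> l i) \<longrightarrow> l \<in> S)"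

definition U :: "(nat \<Rightarrow> complex) set" where "U = {u\<in>L. \<exists>v\<in>L. u * v = e}"

lemma E_eqI: "x \<in> E \<Longrightarrow> y \<in> E \<Longrightarrow> (\<And>i. i < n \<Longrightarrow> x i = y i) \<Longrightarrow> x = y"
proof (rule ext)
  fix i assume *: "x \<in> E" "y \<in> E" "\<And>i. i < n \<Longrightarrow> x i = y i"
  show "x i = y i" by (cases "i < n") (use * in \<open>auto simp: E_def\<close>)
qed

lemma E_0 [simp]: "0 \<in> E" by (simp add: E_def)
lemma E_add [intro, simp]: "x \<in> E \<Longrightarrow> y \<in> E \<Longrightarrow> x + y \<in> E" by (simp add: E_def)
lemma E_diff [intro, simp]: "x \<in> E \<Longrightarrow> y \<in> E \<Longrightarrow> x - y \<in> E" by (simp add: E_def fun_diff_def)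
lemma E_mult1 [intro, simp]: "x \<in> E \<Longrightarrow> y * x \<in> E" by (simp add: E_def)
lemma E_mult2 [intro, simp]: "x \<in> E \<Longrightarrow> x * y \<in> E" by (simp add: E_def)
lemma L_E [intro, simp]: "x \<in> L \<Longrightarrow> x \<in> E" using L_sub by (auto simp: E_def)
lemma e_L [simp]: "e \<in> L" using L_one by (simp add: e_def)
lemma e_nth [simp]: "i < n \<Longrightarrow> e i = 1" by (simp add: e_def)
lemma e_mult [simp]: "x \<in> E \<Longrightarrow> e * x = x" by (rule ext) (auto simp: e_def E_def)
lemma mult_e [simp]: "x \<in> E \<Longrightarrow> x * e = x" by (rule ext) (auto simp: e_def E_def)
lemma L_0 [simp]: "0 \<in> L" using L_minus[OF e_L e_L] by simp
lemma L_uminus: "a \<in> L \<Longrightarrow> - a \<in> L" using L_minus[OF L_0, of a] by simp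
lemma e_nz: "e \<noteq> 0" using n_pos by (metis e_nth zero_fun_apply zero_neq_one)

lemma L_of_nat_mult: "a \<in> L \<Longrightarrow> of_nat k * a \<in> L"
  by (induction k) (auto simp: algebra_simps intro: L_add)

lemma L_power: "a \<in> L \<Longrightarrow> e * a ^ k \<in> L"
proof (induction k)
  case (Suc k)
  then have "a * (e * a ^ k) \<in> L" using L_mult by blast
  moreover have "e * a ^ Suc k = a * (e * a ^ k)" by (simp only: power_Suc mult.left_commute)
  ultimately show ?case by (simp only:)
qed simp

lemma nm_nonneg [simp]: "0 \<le> nm x" by (simp add: nm_def prod_nonneg)

lemma nm_mult: "nm (x * y) = nm x * nm y"
  by (simp add: nm_def norm_mult power_mult_distrib prod.distrib)

lemma nm_e [simp]: "nm e = 1" by (simp add: nm_def)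

lemma nm_ge_1: assumes "a \<in> L" "a \<noteq> 0" shows "1 \<le> nm a"
proof -
  have "nm a \<noteq> 0" using assms L_nonzero by (auto simp: nm_def)
  moreover have "nm a \<in> \<int>" using assms L_norm_Ints by (simp add: nm_def)
  then obtain z where "nm a = of_int z" by (auto elim!: Ints_cases)
  ultimately show ?thesis using nm_nonneg[of a] by simp
qed

text \<open>A nonzero lattice point has norm at least 1, so its coordinates cannot all lie inside
  the unit disc.\<close>

lemma L_discrete: assumes "a \<in> L" "\<And>i. i < n \<Longrightarrow> cmod (a i) < 1" shows "a = 0"
proof (rule ccontr)
  assume "a \<noteq> 0"
  then have "1 \<le> nm a" by (rule nm_ge_1[OF assms(1)])
  moreover have "nm a \<le> (cmod (a 0))\<^sup>2"
  proof -
    have "nm a = (cmod (a 0))\<^sup>2 * (\<Prod>i\<in>{..<n}-{0}. (cmod (a i))\<^sup>2)"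
      unfolding nm_def using n_pos by (subst prod.remove[of _ 0]) auto
    moreover have "(\<Prod>i\<in>{..<n}-{0}. (cmod (a i))\<^sup>2) \<le> 1"
      using assms(2) by (intro prod_le_1) (auto simp: power_le_one less_imp_le)
    ultimately show ?thesis by (metis mult_left_le zero_le_power2)
  qed
  moreover have "(cmod (a 0))\<^sup>2 < 1" using assms(2)[OF n_pos] by (simp add: power_less_one_iff)
  ultimately show False by simp
qed

lemma bounded_subsequence:
  fixes f :: "nat \<Rightarrow> nat \<Rightarrow> complex"
  assumes "\<And>k i. i < n \<Longrightarrow> cmod (f k i) \<le> B"
  shows "\<exists>r l. strict_mono r \<and> l \<in> E \<and> (\<forall>i<n. (\<lambda>k. f (r k) i) \<longlonglongrightarrow> l i)"
proof -
  obtain r where r: "strict_mono r" "\<forall>i<n. convergent (\<lambda>k. f (r k) i)"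
    using coordinatewise_subsequence[of n f B] assms by blast
  define l where "l = (\<lambda>i. if i < n then lim (\<lambda>k. f (r k) i) else 0)"
  have "l \<in> E" by (simp add: l_def E_def)
  moreover have "\<forall>i<n. (\<lambda>k. f (r k) i) \<longlonglongrightarrow> l i"
    using r(2) by (simp add: l_def convergent_LIMSEQ_iff)
  ultimately show ?thesis using r(1) by blast
qed

lemma eventually_close:
  fixes f :: "nat \<Rightarrow> nat \<Rightarrow> complex"
  assumes "\<And>i. i < n \<Longrightarrow> (\<lambda>k. f k i) \<longlonglongrightarrow> l i" "0 < \<epsilon>"
  shows "\<forall>\<^sub>F k in sequentially. \<forall>i<n. cmod (f k i - l i) < \<epsilon>"
proof -
  have "\<forall>\<^sub>F k in sequentially. \<forall>i\<in>{..<n}. cmod (f k i - l i) < \<epsilon>"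
    using tendstoD[OF assms(1) assms(2)] by (intro eventually_ball_finite) (auto simp: dist_norm)
  then show ?thesis by (rule eventually_mono) auto
qed

text \<open>Compactness in the form used for recurrence. Only the indices are distinct; that the two
  terms differ has to be argued separately.\<close>

lemma two_close:
  fixes f :: "nat \<Rightarrow> nat \<Rightarrow> complex"
  assumes "\<And>k i. i < n \<Longrightarrow> cmod (f k i) \<le> B" "0 < \<epsilon>"
  shows "\<exists>k l. k < l \<and> (\<forall>i<n. cmod (f k i - f l i) < \<epsilon>)"
proof -
  obtain r l where r: "strict_mono r" "\<forall>i<n. (\<lambda>k. f (r k) i) \<longlonglongrightarrow> l i"
    using bounded_subsequence[of f B] assms by blast
  have "\<forall>\<^sub>F k in sequentially. \<forall>i<n. cmod (f (r k) i - l i) < \<epsilon>/2"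
    using eventually_close[of "\<lambda>k. f (r k)" l "\<epsilon>/2"] r assms by simp
  then obtain N where N: "\<And>k i. k \<ge> N \<Longrightarrow> i < n \<Longrightarrow> cmod (f (r k) i - l i) < \<epsilon>/2"
    by (auto simp: eventually_sequentially)
  have "cmod (f (r N) i - f (r (Suc N)) i) < \<epsilon>" if "i < n" for i
    using N[of N i] N[of "Suc N" i] that
      norm_triangle_ineq4[of "f (r N) i - l i" "f (r (Suc N)) i - l i"] by simp
  moreover have "r N < r (Suc N)" using r(1) by (simp add: strict_mono_def)
  ultimately show ?thesis by blast
qed

lemma infinite_two_close:
  assumes "infinite A" "\<And>a i. a \<in> A \<Longrightarrow> i < n \<Longrightarrow> cmod (g a i) \<le> B" "0 < \<epsilon>"
  shows "\<exists>a\<in>A. \<exists>b\<in>A. a \<noteq> b \<and> (\<forall>i<n. cmod (g a i - g b i) < \<epsilon>)"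
proof -
  obtain h :: "nat \<Rightarrow> _" where h: "inj h" "range h \<subseteq> A"
    using infinite_countable_subset[OF assms(1)] by blast
  obtain k l where kl: "k < l" "\<forall>i<n. cmod (g (h k) i - g (h l) i) < \<epsilon>"
    using two_close[of "\<lambda>k. g (h k)" B \<epsilon>] assms h by blast
  have "h k \<noteq> h l" using h kl by (metis injD nat_neq_iff)
  then show ?thesis using kl h by blast
qed

lemma finite_bounded_L: "finite {a\<in>L. \<forall>i<n. cmod (a i) \<le> B}" (is "finite ?A")
proof (rule ccontr)
  assume "infinite ?A"
  then have "\<exists>a\<in>?A. \<exists>b\<in>?A. a \<noteq> b \<and> (\<forall>i<n. cmod (a i - b i) < 1)"
    by (rule infinite_two_close[where B = B]) auto
  then obtain a b where ab: "a\<in>?A" "b\<in>?A" "a \<noteq> b" "\<forall>i<n. cmod (a i - b i) < 1"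
    by blast
  have "a - b = 0"
    by (rule L_discrete) (use ab L_minus in auto)
  then show False using ab by simp
qed

lemma near: assumes "x \<in> E" obtains a where "a \<in> L" "\<And>i. i < n \<Longrightarrow> cmod (x i - a i) \<le> R"
proof -
  have "\<exists>a\<in>L. \<forall>i<n. cmod (x i - a i) \<le> R" using assms by (intro L_near) (simp add: E_def)
  then show ?thesis using that by blast
qed

lemma sclosedD:
  assumes "sclosed S" "\<And>k. f k \<in> S" "l \<in> E" "\<And>i. i < n \<Longrightarrow> (\<lambda>k. f k i) \<longlonglongrightarrow> l i"
  shows "l \<in> S"
proof -
  have "\<forall>f l. (\<forall>k. f k \<in> S) \<longrightarrow> l \<in> E \<longrightarrow> (\<forall>i<n. (\<lambda>k. f k i) \<longlonglongrightarrow> l i) \<longrightarrow> l \<in> S"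
    using assms(1) unfolding sclosed_def by (rule conjunct2)
  from this[THEN spec[of _ f], THEN spec[of _ l]] show ?thesis using assms(2-4) by simp
qed

lemma sclosed_E: "sclosed S \<Longrightarrow> x \<in> S \<Longrightarrow> x \<in> E" by (auto simp: sclosed_def)

lemma sclosed_approx:
  assumes "sclosed S" "l \<in> E" "\<And>\<epsilon>. 0 < \<epsilon> \<Longrightarrow> \<exists>x\<in>S. \<forall>i<n. cmod (x i - l i) < \<epsilon>"
  shows "l \<in> S"
proof -
  have "\<exists>x\<in>S. \<forall>i<n. cmod (x i - l i) < 1 / Suc k" for k
    by (rule assms(3)) simp
  then have "\<exists>f. \<forall>k. f k \<in> S \<and> (\<forall>i<n. cmod (f k i - l i) < 1 / Suc k)"
    by (intro choice) (simp add: Bex_def)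
  then obtain f where "\<forall>k. f k \<in> S \<and> (\<forall>i<n. cmod (f k i - l i) < 1 / Suc k)" ..
  then have f: "\<And>k. f k \<in> S" "\<And>k i. i < n \<Longrightarrow> cmod (f k i - l i) < 1 / Suc k" by blast+
  have "(\<lambda>k. f k i) \<longlonglongrightarrow> l i" if "i < n" for i
  proof (rule LIM_zero_cancel, rule Lim_null_comparison)
    show "\<forall>\<^sub>F k in sequentially. cmod (f k i - l i) \<le> 1 / real (Suc k)"
      using f(2)[OF that] by (intro always_eventually allI less_imp_le)
    show "(\<lambda>k. 1 / real (Suc k)) \<longlonglongrightarrow> 0" by (rule LIMSEQ_Suc[OF lim_1_over_n])
  qed
  from sclosedD[OF assms(1) f(1) assms(2) this] show ?thesis .
qed

lemma sclosed_tail: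
  assumes "sclosed S" "\<And>k. k \<ge> N \<Longrightarrow> f k \<in> S" "l \<in> E" "\<And>i. i < n \<Longrightarrow> (\<lambda>k. f k i) \<longlonglongrightarrow> l i"
  shows "l \<in> S"
proof (rule sclosedD[OF assms(1), of "\<lambda>k. f (k + N)"])
  show "(\<lambda>k. f (k + N) i) \<longlonglongrightarrow> l i" if "i < n" for i
    by (rule LIMSEQ_ignore_initial_segment[OF assms(4)[OF that]])
  show "f (k + N) \<in> S" for k by (rule assms(2)) simp
qed (rule assms(3))

end

section \<open>Units\<close>

lemma power_fun_nth [simp]: "(f ^ k) i = (f i :: 'b::monoid_mult) ^ k"
  by (induction k) simp_all

lemma floor_eq_close:
  fixes x y :: real
  assumes "0 \<le> x" "0 \<le> y" "nat \<lfloor>x\<rfloor> = nat \<lfloor>y\<rfloor>"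
  shows "\<bar>x - y\<bar> < 1"
proof -
  have "\<lfloor>x\<rfloor> = \<lfloor>y\<rfloor>" using assms by (simp add: eq_nat_nat_iff)
  then show ?thesis by linarith
qed

context num_lattice
begin

text \<open>Minkowski's theorem by the pigeonhole principle: of the \<open>Q\<^bsup>2n\<^esup>\<close> lattice points near the points of a
  grid of mesh \<open>4 R\<close>, two fall into the same box of sides proportional to \<open>h\<close>.\<close>

lemma small_element:
  assumes h: "\<And>i. i < n \<Longrightarrow> 0 < h i" and h1: "(\<Prod>i<n. h i) = 1"
  shows "\<exists>a\<in>L. a \<noteq> 0 \<and> (\<forall>i<n. cmod (a i) \<le> 12 * R * h i)"
proof -
  \<comment> \<open>With \<open>Q\<close> at least \<open>6 * h i\<close> the final
    \<open>+ 1\<close> in the box count \<open>q i\<close> is absorbed: the count is at most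
    \<open>5 / 6\<close> of \<open>Q / h i\<close>.\<close>
  define Q where "Q = nat \<lceil>\<Sum>i<n. 6 * h i\<rceil> + 1"
  have Q0: "0 < Q" by (simp add: Q_def)
  have Q: "6 * h i \<le> Q" if "i < n" for i
  proof -
    have "6 * h i \<le> (\<Sum>i<n. 6 * h i)"
      by (rule member_le_sum) (use that h in \<open>auto intro: less_imp_le\<close>)
    also have "\<dots> \<le> Q" unfolding Q_def by linarith
    finally show ?thesis .
  qed
  define w where "w i = 6 * R * h i" for i
  have w0: "0 < w i" if "i < n" for i using h[OF that] R_pos by (simp add: w_def)
  define D where "D = PiE {..<n} (\<lambda>_. {..<Q} \<times> {..<Q})"
  define x where "x c = (\<lambda>i. if i < n then Complex (4 * R * real (fst (c i))) (4 * R * real (snd (c i))) else 0)"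
    for c :: "nat \<Rightarrow> nat \<times> nat"
  have "\<exists>a. a \<in> L \<and> (\<forall>i<n. cmod (x c i - a i) \<le> R)" for c
    using near[of "x c"] by (auto simp: E_def x_def)
  then obtain A where A: "\<And>c. A c \<in> L" "\<And>c i. i < n \<Longrightarrow> cmod (x c i - A c i) \<le> R"
    by metis
  \<comment> \<open>The real and imaginary parts of \<open>A c i\<close>, shifted by
    \<open>R\<close>, lie between 0 and \<open>4 * R * Q\<close>, so \<open>q i\<close> intervals of
    length \<open>w i\<close> cover their range.\<close>
  define q where "q i = nat \<lfloor>4 * R * Q / w i\<rfloor> + 1" for i
  define T where "T = PiE {..<n} (\<lambda>i. {..<q i} \<times> {..<q i})"
  define F where "F c = (\<lambda>i\<in>{..<n}. (nat \<lfloor>(Re (A c i) + R) / w i\<rfloor>, nat \<lfloor>(Im (A c i) + R) / w i\<rfloor>))" for c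
  have bnd: "0 \<le> (Re (A c i) + R) / w i" "(Re (A c i) + R) / w i \<le> 4 * R * Q / w i"
    "0 \<le> (Im (A c i) + R) / w i" "(Im (A c i) + R) / w i \<le> 4 * R * Q / w i"
    if "c \<in> D" "i < n" for c i
  proof -
    have c: "fst (c i) < Q" "snd (c i) < Q" using that unfolding D_def by (auto simp: PiE_iff mem_Times_iff)
    have 1: "\<bar>Re (A c i) - 4 * R * fst (c i)\<bar> \<le> R" "\<bar>Im (A c i) - 4 * R * snd (c i)\<bar> \<le> R"
      using A(2)[OF that(2), of c] abs_Re_le_cmod[of "x c i - A c i"] abs_Im_le_cmod[of "x c i - A c i"] that(2)
      by (auto simp: x_def)
    have 2: "4 * R * real k + 4 * R \<le> 4 * R * Q" "0 \<le> 4 * R * real k" if "k < Q" for k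
    proof -
      have "4 * R * (real k + 1) \<le> 4 * R * Q"
        by (rule mult_left_mono) (use that R_pos in auto)
      then show "4 * R * real k + 4 * R \<le> 4 * R * Q" by (simp add: algebra_simps)
      show "0 \<le> 4 * R * real k" using R_pos by simp
    qed
    have "0 \<le> Re (A c i) + R" "Re (A c i) + R \<le> 4 * R * Q" "0 \<le> Im (A c i) + R" "Im (A c i) + R \<le> 4 * R * Q"
      using 1 2[OF c(1)] 2[OF c(2)] R_pos by linarith+
    then show "0 \<le> (Re (A c i) + R) / w i" "(Re (A c i) + R) / w i \<le> 4 * R * Q / w i"
    "0 \<le> (Im (A c i) + R) / w i" "(Im (A c i) + R) / w i \<le> 4 * R * Q / w i"
      using w0[OF that(2)] by (auto intro: divide_right_mono)
  qed
  have FT: "F c \<in> T" if "c \<in> D" for c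
  proof -
    have "nat \<lfloor>y\<rfloor> < q i" if "y \<le> 4 * R * Q / w i" for y i
      unfolding q_def using floor_mono[OF that] by linarith
    then show ?thesis using bnd[OF that] by (auto simp: F_def T_def)
  qed
  have cardD: "card D = (Q * Q) ^ n" by (simp add: D_def card_PiE card_cartesian_product)
  have cardT: "card T = (\<Prod>i<n. q i * q i)" by (simp add: T_def card_PiE card_cartesian_product)
  have qle: "real (q i) \<le> 5 / 6 * (Q / h i)" if "i < n" for i
  proof -
    have a: "4 * R * Q / w i = 4 / 6 * (Q / h i)" using R_pos by (simp add: w_def)
    have "1 \<le> Q / (6 * h i)" using Q[OF that] h[OF that] by simp
    then have b: "1 \<le> 1 / 6 * (Q / h i)" by simp
    have "0 \<le> 4 * R * Q / w i" using w0[OF that] R_pos by simp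
    then have "real (q i) \<le> 4 * R * Q / w i + 1" by (simp add: q_def)
    then show ?thesis using a b by linarith
  qed
  \<comment> \<open>The sides \<open>h i\<close> cancel because of \<open>h1\<close>, and
    \<open>25 / 36 < 1\<close> leaves fewer boxes than grid points.\<close>
  have "real (card T) \<le> (\<Prod>i<n. (25/36) * (Q * Q) / (h i * h i))"
    unfolding cardT of_nat_prod
  proof (rule prod_mono)
    fix i assume i: "i \<in> {..<n}"
    have "real (q i) * real (q i) \<le> (5 / 6 * (Q / h i)) * (5 / 6 * (Q / h i))"
      by (rule mult_mono) (use qle i h[of i] in \<open>auto intro!: mult_nonneg_nonneg divide_nonneg_pos\<close>)
    then show "0 \<le> real (q i * q i) \<and> real (q i * q i) \<le> (25/36) * (Q * Q) / (h i * h i)"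
      by (simp add: power2_eq_square)
  qed
  also have "\<dots> = (25/36) ^ n * (Q * Q) ^ n"
    by (simp add: prod_dividef prod.distrib h1 power_mult_distrib power_divide)
  also have "\<dots> < (Q * Q) ^ n"
    using Q0 n_pos by (simp add: power_less_one_iff)
  finally have lt: "card T < card D"
    unfolding cardD by (metis of_nat_less_iff of_nat_power)
  have finT: "finite T" by (auto simp: T_def intro: finite_PiE)
  have "\<not> inj_on F D"
  proof
    assume "inj_on F D"
    then have "card D \<le> card T" by (rule card_inj_on_le) (use FT finT in auto)
    then show False using lt by simp
  qed
  then obtain c c' where cc: "c \<in> D" "c' \<in> D" "c \<noteq> c'" "F c = F c'" by (auto simp: inj_on_def)
  define a where "a = A c - A c'"
  have "a \<in> L" unfolding a_def by (intro L_minus A)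
  moreover have "a \<noteq> 0"
  proof
    assume "a = 0"
    then have eq: "A c = A c'" by (simp add: a_def)
    obtain i where i: "i < n" "c i \<noteq> c' i"
      using cc(1-3) unfolding D_def by (metis PiE_ext lessThan_iff)
    \<comment> \<open>Two grid points within \<open>R\<close> of the same lattice point are at most
      \<open>2 * R\<close> apart, whereas the mesh separates them by \<open>4 * R\<close>.\<close>
    have "cmod (x c i - x c' i) \<le> 2 * R"
      using A(2)[OF i(1), of c] A(2)[OF i(1), of c'] eq
        norm_triangle_ineq4[of "x c i - A c i" "x c' i - A c' i"] by simp
    moreover have "4 * R \<le> cmod (x c i - x c' i)"
    proof -
      have *: "4 * R \<le> \<bar>4 * R * real k - 4 * R * real l\<bar>" if "k \<noteq> l" for k l
      proof -
        have "\<bar>real k - real l\<bar> \<ge> 1" using that by linarith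
        then have "4 * R * 1 \<le> 4 * R * \<bar>real k - real l\<bar>" using R_pos by (intro mult_left_mono) auto
        also have "\<dots> = \<bar>4 * R * real k - 4 * R * real l\<bar>"
          using R_pos by (simp add: abs_mult right_diff_distrib[symmetric])
        finally show ?thesis by simp
      qed
      consider "fst (c i) \<noteq> fst (c' i)" | "snd (c i) \<noteq> snd (c' i)" using i(2) prod_eqI by blast
      then show ?thesis
      proof cases
        case 1
        have "\<bar>Re (x c i - x c' i)\<bar> \<le> cmod (x c i - x c' i)" by (rule abs_Re_le_cmod)
        moreover have "\<bar>Re (x c i - x c' i)\<bar> = \<bar>4 * R * real (fst (c i)) - 4 * R * real (fst (c' i))\<bar>"
          using i(1) by (simp add: x_def)
        ultimately show ?thesis using *[OF 1] by linarith
      next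
        case 2
        have "\<bar>Im (x c i - x c' i)\<bar> \<le> cmod (x c i - x c' i)" by (rule abs_Im_le_cmod)
        moreover have "\<bar>Im (x c i - x c' i)\<bar> = \<bar>4 * R * real (snd (c i)) - 4 * R * real (snd (c' i))\<bar>"
          using i(1) by (simp add: x_def)
        ultimately show ?thesis using *[OF 2] by linarith
      qed
    qed
    ultimately show False using R_pos by simp
  qed
  moreover have "cmod (a i) \<le> 12 * R * h i" if i: "i < n" for i
  proof -
    have F: "F c i = F c' i" using cc(4) by simp
    have "\<bar>(Re (A c i) + R) / w i - (Re (A c' i) + R) / w i\<bar> < 1"
      "\<bar>(Im (A c i) + R) / w i - (Im (A c' i) + R) / w i\<bar> < 1"
      using F i bnd[OF cc(1) i] bnd[OF cc(2) i] by (auto intro!: floor_eq_close simp: F_def)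
    then have "\<bar>Re (A c i) - Re (A c' i)\<bar> < w i" "\<bar>Im (A c i) - Im (A c' i)\<bar> < w i"
      using w0[OF i] by (auto simp: diff_divide_distrib[symmetric] abs_divide divide_less_eq)
    then have "\<bar>Re (a i)\<bar> < w i" "\<bar>Im (a i)\<bar> < w i" by (auto simp: a_def fun_diff_def)
    then have "cmod (a i) \<le> 2 * w i" using cmod_le[of "a i"] by linarith
    then show ?thesis by (simp add: w_def)
  qed
  ultimately show ?thesis by blast
qed

section \<open>Units and residues modulo an integer\<close>

lemma U_L: "u \<in> U \<Longrightarrow> u \<in> L" by (simp add: U_def)

lemma U_inverse: assumes "u \<in> U" obtains v where "v \<in> U" "u * v = e"
proof -
  obtain v where v: "v \<in> L" "u * v = e" using assms by (auto simp: U_def)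
  have "v * u = e" using v(2) by (simp only: mult.commute)
  then have "v \<in> U" using v(1) assms unfolding U_def by blast
  then show ?thesis using that v(2) by blast
qed

lemma U_mult: assumes "u \<in> U" "v \<in> U" shows "u * v \<in> U"
proof -
  obtain u' v' where *: "u' \<in> U" "u * u' = e" "v' \<in> U" "v * v' = e" using assms U_inverse by metis
  have "(u * v) * (u' * v') = (u * u') * (v * v')" by (simp only: mult.assoc mult.left_commute)
  also have "\<dots> = e" using * by simp
  finally have "\<exists>w\<in>L. (u * v) * w = e" using * U_L L_mult by blast
  then show ?thesis using assms U_L L_mult unfolding U_def by blast
qed

lemma e_U: "e \<in> U"
proof -
  have "e * e = e" by simp
  then show ?thesis unfolding U_def using e_L by blast
qed

lemma U_nz: assumes "u \<in> U" "i < n" shows "u i \<noteq> 0"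
proof -
  obtain v where "u * v = e" using U_inverse assms by blast
  then have "u i * v i = 1" using e_nth[OF assms(2)] by (metis times_fun_apply)
  then show ?thesis by auto
qed

lemma U_nm: assumes "u \<in> U" shows "nm u = 1"
proof -
  obtain v where v: "v \<in> U" "u * v = e" using U_inverse assms by blast
  have "u \<noteq> 0" "v \<noteq> 0" using v e_nz by auto
  then have "1 \<le> nm u" "1 \<le> nm v" using nm_ge_1 U_L v assms by blast+
  moreover have "nm u * nm v = 1" using v nm_mult[of u v] by simp
  ultimately show ?thesis by (smt (verit) mult_le_cancel_left1 mult_cancel_left1)
qed

text \<open>The quotient is \<open>a / m\<close> rounded to the lattice. The bound on the remainder
  is independent of \<open>a\<close>, so there are finitely many residue classes modulo
  \<open>m\<close>.\<close>

lemma L_mod: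
  assumes "0 < m" "a \<in> L"
  obtains g b where "g \<in> L" "\<And>i. i < n \<Longrightarrow> cmod (g i) \<le> m * R" "b \<in> L" "a = g + of_nat m * b"
proof -
  define x where "x = (\<lambda>i. a i / m)"
  have "x \<in> E" using L_E[OF assms(2)] by (simp add: E_def x_def)
  then obtain b where b: "b \<in> L" "\<And>i. i < n \<Longrightarrow> cmod (x i - b i) \<le> R" using near by blast
  define g where "g = a - of_nat m * b"
  have "g \<in> L" unfolding g_def using assms b by (intro L_minus L_of_nat_mult)
  moreover have "cmod (g i) \<le> m * R" if "i < n" for i
  proof -
    have "g i = m * (x i - b i)" using assms(1) by (simp add: g_def x_def fun_diff_def algebra_simps)
    then have "cmod (g i) = m * cmod (x i - b i)" by (simp add: norm_mult)
    then show ?thesis using b(2)[OF that] by (simp add: mult_left_mono)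
  qed
  moreover have "a = g + of_nat m * b" by (simp add: g_def)
  ultimately show ?thesis using that b by blast
qed

end

text \<open>\<open>L_adj\<close> lets an element divide its norm, \<open>L_cnj\<close> provides real
  lattice points as traces, and \<open>\<delta>\<close> is the second basis vector beside 1 over the
  real vectors.\<close>

locale cm_lattice = num_lattice +
  fixes \<delta> :: "nat \<Rightarrow> complex"
  assumes n3: "3 \<le> n"
    and L_adj: "a \<in> L \<Longrightarrow> \<exists>b\<in>L. \<forall>i<n. a i * b i = of_real (\<Prod>i<n. (cmod (a i))\<^sup>2)"
    and L_cnj: "a \<in> L \<Longrightarrow> (\<lambda>i. cnj (a i)) \<in> L"
    and \<delta>_L: "\<delta> \<in> L" and \<delta>_nz: "\<delta> \<noteq> 0" and \<delta>_cnj: "\<And>i. cnj (\<delta> i) = - \<delta> i"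
begin

text \<open>With \<open>r * r' = m\<close> the quotient \<open>a / r\<close> is
  \<open>1 + m * b / r\<close>, which is the lattice element \<open>e + b * r'\<close>; exchanging
  \<open>a\<close> and \<open>r\<close> gives its inverse.\<close>

lemma associates:
  assumes "a \<in> L" "r \<in> L" "a \<noteq> 0" "r \<noteq> 0" "nm a = real m" "nm r = real m" "b \<in> L" "a - r = of_nat m * b"
  obtains u where "u \<in> U" "u * r = a"
proof -
  obtain a' where a': "a' \<in> L" "\<And>i. i < n \<Longrightarrow> a i * a' i = m"
    using L_adj[OF assms(1)] assms(5) unfolding nm_def by (metis of_real_of_nat_eq)
  obtain r' where r': "r' \<in> L" "\<And>i. i < n \<Longrightarrow> r i * r' i = m"
    using L_adj[OF assms(2)] assms(6) unfolding nm_def by (metis of_real_of_nat_eq)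
  have m: "complex_of_nat m \<noteq> 0" using nm_ge_1[OF assms(1,3)] assms(5) by auto
  define u where "u = e + b * r'"
  define v where "v = e - b * a'"
  have uL: "u \<in> L" "v \<in> L" unfolding u_def v_def using assms a' r' by (auto intro!: L_add L_minus L_mult)
  have ab: "a i - r i = m * b i" for i using fun_cong[OF assms(8), of i] by (simp add: fun_diff_def)
  have ri: "r i \<noteq> 0" "a i \<noteq> 0" if "i < n" for i using L_nonzero assms that by blast+
  have u1: "u i * r i = a i" if "i < n" for i
  proof -
    have "u i * r i = r i + b i * (r i * r' i)" using that by (simp add: u_def algebra_simps)
    also have "\<dots> = r i + m * b i" using r'(2)[OF that] by simp
    also have "\<dots> = a i" using ab[of i] by (simp add: algebra_simps)
    finally show ?thesis .
  qed
  have v1: "v i * a i = r i" if "i < n" for i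
  proof -
    have "v i * a i = a i - b i * (a i * a' i)" using that by (simp add: v_def fun_diff_def algebra_simps)
    also have "\<dots> = a i - m * b i" using a'(2)[OF that] by simp
    also have "\<dots> = r i" using ab[of i] by (simp add: algebra_simps)
    finally show ?thesis .
  qed
  have "u * v = e"
  proof (rule E_eqI)
    fix i assume i: "i < n"
    have "(u i * v i) * a i = a i" using u1[OF i] v1[OF i] by (simp add: mult.assoc)
    then show "(u * v) i = e i" using ri(2)[OF i] i by simp
  qed (use uL in auto)
  then have "u \<in> U" using uL unfolding U_def by blast
  moreover have "u * r = a" by (rule E_eqI) (use uL assms u1 in auto)
  ultimately show ?thesis using that by blast
qed

lemma finite_pos_lower:
  assumes "finite S" "\<And>r. r \<in> S \<Longrightarrow> r \<in> L \<and> r \<noteq> 0"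
  obtains \<mu> where "0 < \<mu>" "\<And>r i. r \<in> S \<Longrightarrow> i < n \<Longrightarrow> \<mu> \<le> cmod (r i)"
proof -
  define A where "A = insert 1 ((\<lambda>(r, i). cmod (r i)) ` (S \<times> {..<n}))"
  have A: "finite A" "A \<noteq> {}" using assms(1) by (auto simp: A_def)
  have "r i \<noteq> 0" if "r \<in> S" "i < n" for r i using that assms(2) L_nonzero by blast
  then have "x > 0" if "x \<in> A" for x using that by (auto simp: A_def)
  then have "0 < Min A" using A by auto
  moreover have "Min A \<le> cmod (r i)" if "r \<in> S" "i < n" for r i
    by (rule Min_le[OF A(1)]) (use that in \<open>auto simp: A_def intro!: image_eqI[of _ _ "(r, i)"]\<close>)
  ultimately show ?thesis using that by blast
qed

text \<open>Dirichlet's unit theorem: up to units there are only finitely many elements of bounded norm, so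
  the element of shape \<open>h\<close> found above is a unit of shape \<open>h\<close> times one of finitely many elements.\<close>

lemma units_rough:
  "\<exists>c>0. \<exists>C>0. \<forall>h. (\<forall>i<n. 0 < h i) \<longrightarrow> (\<Prod>i<n. h i) = 1 \<longrightarrow>
     (\<exists>u\<in>U. \<forall>i<n. c * h i \<le> cmod (u i) \<and> cmod (u i) \<le> C * h i)"
proof -
  define B where "B = 12 * R"
  have B0: "0 < B" using R_pos by (simp add: B_def)
  define M where "M = nat \<lfloor>(B\<^sup>2) ^ n\<rfloor>"
  define G where "G m = {g\<in>L. \<forall>i<n. cmod (g i) \<le> real m * R}" for m
  \<comment> \<open>\<open>P m g\<close> describes the nonzero elements of norm \<open>m\<close> in
    the class of \<open>g\<close> modulo \<open>m\<close>. \<open>S\<close> keeps one representative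
    for each of the finitely many inhabited classes with \<open>m\<close> up to the norm bound
    \<open>M\<close>.\<close>
  define P where "P m g a \<longleftrightarrow> a \<in> L \<and> a \<noteq> 0 \<and> nm a = real m \<and> (\<exists>b\<in>L. a = g + of_nat m * b)" for m g a
  define rp where "rp m g = (SOME a. P m g a)" for m g
  define S where "S = (\<lambda>(m, g). rp m g) ` {(m, g). m \<in> {..M} \<and> g \<in> G m \<and> (\<exists>a. P m g a)}"
  have "finite (SIGMA m:{..M}. G m)" unfolding G_def by (intro finite_SigmaI finite_bounded_L) auto
  then have "finite {(m, g). m \<in> {..M} \<and> g \<in> G m \<and> (\<exists>a. P m g a)}"
    by (rule rev_finite_subset) auto
  then have finS: "finite S" unfolding S_def by (rule finite_imageI)
  have rp: "P m g (rp m g)" if "P m g a" for m g a unfolding rp_def using that by (rule someI[of "P m g"])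
  have S1: "r \<in> L \<and> r \<noteq> 0" if "r \<in> S" for r
  proof -
    have "\<exists>m g a. r = rp m g \<and> P m g a" using that unfolding S_def by auto
    then obtain m g where "P m g r" using rp by metis
    then show ?thesis by (simp add: P_def)
  qed
  obtain \<mu> where \<mu>: "0 < \<mu>" "\<And>r i. r \<in> S \<Longrightarrow> i < n \<Longrightarrow> \<mu> \<le> cmod (r i)"
    using finite_pos_lower[OF finS S1] by blast
  define C where "C = B / \<mu>"
  have C0: "0 < C" using B0 \<mu> by (simp add: C_def)
  \<comment> \<open>A unit has norm 1, so its size at \<open>i\<close> is the reciprocal of the
    product of the \<open>n - 1\<close> other sizes, each at most \<open>C * h j\<close>.\<close>
  define c where "c = 1 / C ^ (n - 1)"
  have c0: "0 < c" using C0 by (simp add: c_def)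
  have "\<exists>u\<in>U. \<forall>i<n. c * h i \<le> cmod (u i) \<and> cmod (u i) \<le> C * h i"
    if h: "\<forall>i<n. 0 < h i" and h1: "(\<Prod>i<n. h i) = 1" for h
  proof -
    obtain a where a: "a \<in> L" "a \<noteq> 0" "\<And>i. i < n \<Longrightarrow> cmod (a i) \<le> B * h i"
      using small_element[of h] h h1 unfolding B_def by blast
    have "nm a \<le> (\<Prod>i<n. (B * h i)\<^sup>2)"
      unfolding nm_def by (rule prod_mono) (use a in \<open>auto intro: power_mono\<close>)
    also have "\<dots> = (B\<^sup>2) ^ n"
      using h1 by (simp add: power_mult_distrib prod.distrib prod_power_distrib[symmetric])
    finally have nmB: "nm a \<le> (B\<^sup>2) ^ n" .
    have "nm a \<in> \<int>" using L_norm_Ints[OF a(1)] by (simp add: nm_def)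
    then obtain z where z: "nm a = of_int z" by (auto elim: Ints_cases)
    define m where "m = nat z"
    have z1: "1 \<le> z" using nm_ge_1[OF a(1,2)] z by simp
    then have m: "nm a = real m" "0 < m" using z by (auto simp: m_def)
    have mM: "m \<le> M"
    proof -
      have "real_of_int z \<le> (B\<^sup>2) ^ n" using nmB z by simp
      then have "z \<le> \<lfloor>(B\<^sup>2) ^ n\<rfloor>" by (simp add: le_floor_iff)
      then show ?thesis unfolding m_def M_def by (rule nat_mono)
    qed
    obtain g b where g: "g \<in> L" "\<And>i. i < n \<Longrightarrow> cmod (g i) \<le> m * R" "b \<in> L" "a = g + of_nat m * b"
      using L_mod[OF m(2) a(1)] by blast
    have Pa: "P m g a" unfolding P_def using a m g by blast
    define r where "r = rp m g"
    have rS: "r \<in> S" unfolding S_def r_def using mM g Pa by (auto simp: G_def intro!: image_eqI[of _ _ "(m, g)"])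
    have "P m g r" unfolding r_def by (rule rp[OF Pa])
    then obtain b' where r: "r \<in> L" "r \<noteq> 0" "nm r = real m" "b' \<in> L" "r = g + of_nat m * b'" unfolding P_def by blast
    have "a - r = of_nat m * (b - b')" by (simp add: g(4) r(5) right_diff_distrib)
    then obtain u where u: "u \<in> U" "u * r = a"
      using associates[OF a(1) r(1) a(2) r(2) m(1) r(3) L_minus[OF g(3) r(4)]] by blast
    have up: "cmod (u i) \<le> C * h i" if "i < n" for i
    proof -
      have "cmod (u i) * cmod (r i) = cmod (a i)" using u(2) by (metis norm_mult times_fun_apply)
      then have "cmod (u i) * \<mu> \<le> B * h i"
        using a(3)[OF that] \<mu>(2)[OF rS that] mult_left_mono[of \<mu> "cmod (r i)" "cmod (u i)"] by simp
      then show ?thesis using \<mu>(1) by (simp add: C_def field_simps)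
    qed
    have lo: "c * h i \<le> cmod (u i)" if i: "i < n" for i
    proof -
      have "(\<Prod>j<n. cmod (u j))\<^sup>2 = 1" using U_nm[OF u(1)] by (simp add: nm_def prod_power_distrib)
      then have "(\<Prod>j<n. cmod (u j)) = 1" by (smt (verit) power2_eq_1_iff prod_nonneg norm_ge_zero)
      then have 1: "cmod (u i) * (\<Prod>j\<in>{..<n}-{i}. cmod (u j)) = 1"
        using i by (subst (asm) prod.remove[of _ i]) auto
      have 2: "h i * (\<Prod>j\<in>{..<n}-{i}. h j) = 1"
        using i h1 by (subst (asm) prod.remove[of _ i]) auto
      have "(\<Prod>j\<in>{..<n}-{i}. cmod (u j)) \<le> (\<Prod>j\<in>{..<n}-{i}. C * h j)"
        by (rule prod_mono) (use up in auto)
      also have "\<dots> = C ^ (n - 1) * (\<Prod>j\<in>{..<n}-{i}. h j)" using i by (simp add: prod.distrib)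
      finally have "cmod (u i) * (\<Prod>j\<in>{..<n}-{i}. cmod (u j)) \<le> cmod (u i) * (C ^ (n - 1) * (\<Prod>j\<in>{..<n}-{i}. h j))"
        by (rule mult_left_mono) simp
      then have "1 \<le> cmod (u i) * (C ^ (n - 1) * (\<Prod>j\<in>{..<n}-{i}. h j))" using 1 by simp
      moreover have "(\<Prod>j\<in>{..<n}-{i}. h j) = 1 / h i" using 2 h[rule_format, OF i] by (simp add: field_simps)
      ultimately have "1 \<le> cmod (u i) * C ^ (n - 1) / h i" by simp
      then have "h i \<le> cmod (u i) * C ^ (n - 1)" using h[rule_format, OF i] by (simp add: field_simps)
      then show ?thesis using C0 by (simp add: c_def field_simps)
    qed
    show ?thesis using u(1) up lo by blast
  qed
  then show ?thesis using c0 C0 by blast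
qed

text \<open>The congruence condition makes \<open>W m\<close> fix every point of \<open>(1/m) L\<close> modulo \<open>L\<close>.\<close>

definition W :: "nat \<Rightarrow> (nat \<Rightarrow> complex) set" where
  "W N = {w\<in>U. (\<forall>i<n. w i \<in> \<real> \<and> 0 < Re (w i)) \<and> (\<exists>b\<in>L. w - e = of_nat N * b)}"

lemma cong_mult:
  assumes "x \<in> L" "y \<in> L" "\<exists>b\<in>L. x - e = of_nat N * b" "\<exists>b\<in>L. y - e = of_nat N * b"
  shows "\<exists>b\<in>L. x * y - e = of_nat N * b"
proof -
  obtain b c where b: "b \<in> L" "x - e = of_nat N * b" "c \<in> L" "y - e = of_nat N * c" using assms by blast
  have "x * y - e = (x - e) * y + (y - e)" using assms(2) by (simp add: left_diff_distrib)
  also have "\<dots> = of_nat N * (b * y + c)" by (simp only: b distrib_left mult.assoc)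
  finally show ?thesis using b assms L_mult L_add by blast
qed

lemma unit_power_cong:
  assumes "0 < N"
  shows "\<exists>k>0. \<forall>u\<in>U. \<exists>b\<in>L. e * u ^ k - e = of_nat N * b"
proof -
  define G where "G = {g\<in>L. \<forall>i<n. cmod (g i) \<le> real N * R}"
  have fG: "finite G" unfolding G_def by (rule finite_bounded_L)
  \<comment> \<open>Every order that occurs is at most \<open>card G\<close>, so its factorial is an
    exponent that works for all units at once.\<close>
  define k where "k = (fact (card G) :: nat)"
  have "\<exists>b\<in>L. e * u ^ k - e = of_nat N * b" if u: "u \<in> U" for u
  proof -
    obtain v where v: "v \<in> U" "u * v = e" using U_inverse u by blast
    have "\<exists>g. g \<in> G \<and> (\<exists>b\<in>L. e * u ^ j = g + of_nat N * b)" for j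
    proof -
      have "e * u ^ j \<in> L" by (rule L_power[OF U_L[OF u]])
      then obtain g b where "g \<in> L" "\<And>i. i < n \<Longrightarrow> cmod (g i) \<le> N * R" "b \<in> L" "e * u ^ j = g + of_nat N * b"
        using L_mod[OF assms] by metis
      then show ?thesis unfolding G_def by blast
    qed
    then obtain g where g: "\<And>j. g j \<in> G" "\<And>j. \<exists>b\<in>L. e * u ^ j = g j + of_nat N * b" by metis
    \<comment> \<open>Two of the first \<open>card G + 1\<close> powers leave the same remainder;
      cancelling the smaller one with the inverse \<open>v\<close> leaves \<open>u ^ d\<close>
      congruent to 1.\<close>
    have "\<not> inj_on g {..card G}"
    proof
      assume "inj_on g {..card G}"
      then have "card {..card G} \<le> card G" by (rule card_inj_on_le) (use g fG in auto)
      then show False by simp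
    qed
    then obtain i j where ij: "i < j" "j \<le> card G" "g i = g j"
      unfolding inj_on_def by (metis atMost_iff linorder_neqE_nat)
    obtain b c where b: "b \<in> L" "e * u ^ i = g i + of_nat N * b" "c \<in> L" "e * u ^ j = g i + of_nat N * c"
      using g(2)[of i] g(2)[of j] ij(3) by metis
    define d where "d = j - i"
    have d: "0 < d" "d \<le> card G" using ij by (auto simp: d_def)
    have "e * u ^ d - e = of_nat N * ((c - b) * (e * v ^ i))"
    proof (rule E_eqI)
      fix l assume l: "l < n"
      have uv: "u l * v l = 1" using v(2) e_nth[OF l] by (metis times_fun_apply)
      have 1: "u l ^ i * v l ^ i = 1" using uv by (simp add: power_mult_distrib[symmetric])
      have 2: "u l ^ j = u l ^ d * u l ^ i" using ij by (simp add: d_def power_add[symmetric])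
      have 3: "u l ^ i = g i l + N * b l" "u l ^ j = g i l + N * c l"
        using fun_cong[OF b(2), of l] fun_cong[OF b(4), of l] l by simp_all
      have "N * ((c l - b l) * v l ^ i) = (u l ^ j - u l ^ i) * v l ^ i" by (simp add: 3 algebra_simps)
      also have "\<dots> = u l ^ d * (u l ^ i * v l ^ i) - u l ^ i * v l ^ i" by (simp add: 2 algebra_simps)
      also have "\<dots> = u l ^ d - 1" by (simp add: 1)
      finally show "(e * u ^ d - e) l = (of_nat N * ((c - b) * (e * v ^ i))) l"
        using l by (simp add: fun_diff_def)
    qed (use b L_power[OF U_L[OF v(1)], of i] L_power[OF U_L[OF u], of d] in \<open>auto intro!: E_mult1 E_diff\<close>)
    then have dd: "\<exists>b\<in>L. e * u ^ d - e = of_nat N * b"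
      using b L_power[OF U_L[OF v(1)], of i] L_mult L_minus by metis
    have *: "\<exists>b\<in>L. e * u ^ (d * q) - e = of_nat N * b" for q
    proof (induction q)
      case 0
      have "e * u ^ (d * 0) - e = of_nat N * 0" by simp
      then show ?case using L_0 by metis
    next
      case (Suc q)
      have "\<exists>b\<in>L. (e * u ^ d) * (e * u ^ (d * q)) - e = of_nat N * b"
        by (rule cong_mult[OF L_power[OF U_L[OF u]] L_power[OF U_L[OF u]] dd Suc.IH])
      moreover have "(e * u ^ d) * (e * u ^ (d * q)) = e * u ^ (d * Suc q)"
        by (rule ext) (simp add: power_add e_def)
      ultimately show ?case by (simp only:)
    qed
    have "d dvd k" unfolding k_def using d by (intro dvd_fact) auto
    then show ?thesis using * by (auto elim: dvdE)
  qed
  moreover have "0 < k" by (simp add: k_def)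
  ultimately show ?thesis by blast
qed

lemma L_cnj_U: assumes "u \<in> U" shows "(\<lambda>i. cnj (u i)) \<in> U"
proof -
  obtain v where v: "v \<in> U" "u * v = e" using U_inverse assms by blast
  have "(\<lambda>i. cnj (u i)) * (\<lambda>i. cnj (v i)) = e"
  proof
    fix i
    have "u i * v i = e i" using v(2) by (metis times_fun_apply)
    then show "((\<lambda>i. cnj (u i)) * (\<lambda>i. cnj (v i))) i = e i"
      by (simp flip: complex_cnj_mult) (simp add: e_def)
  qed
  then show ?thesis using L_cnj U_L v(1) assms unfolding U_def by blast
qed

lemma U_power: "u \<in> U \<Longrightarrow> e * u ^ k \<in> U"
proof (induction k)
  case (Suc k)
  have "e * u ^ Suc k = u * (e * u ^ k)" by (simp only: power_Suc mult.left_commute)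
  then show ?case using U_mult[OF Suc.prems Suc.IH[OF Suc.prems]] by (simp only:)
qed (simp add: e_U)

text \<open>The \<open>k\<close>-th power of \<open>u\<close> times its conjugate is positive and
  congruent to 1, and its coordinates are the absolute values of \<open>u\<close> raised to the
  power \<open>2 * k\<close>. The shape \<open>t\<close> is therefore requested from
  \<open>u\<close> through its root of that order.\<close>

lemma units:
  assumes "0 < N"
  obtains c C where "0 < c" "0 < C"
    "\<And>t. (\<And>i. i < n \<Longrightarrow> 0 < t i) \<Longrightarrow> (\<Prod>i<n. t i) = 1 \<Longrightarrow>
     \<exists>w\<in>W N. \<forall>i<n. c * t i \<le> Re (w i) \<and> Re (w i) \<le> C * t i"
proof -
  obtain c C where c: "0 < c" "0 < C" and cC: "\<And>h. (\<forall>i<n. 0 < h i) \<Longrightarrow> (\<Prod>i<n. h i) = 1 \<Longrightarrow>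
     (\<exists>u\<in>U. \<forall>i<n. c * h i \<le> cmod (u i) \<and> cmod (u i) \<le> C * h i)"
    using units_rough by metis
  obtain k where k: "0 < k" "\<And>u. u \<in> U \<Longrightarrow> \<exists>b\<in>L. e * u ^ k - e = of_nat N * b"
    using unit_power_cong[OF assms] by blast
  have "\<exists>w\<in>W N. \<forall>i<n. c ^ (2 * k) * t i \<le> Re (w i) \<and> Re (w i) \<le> C ^ (2 * k) * t i"
    if t: "\<And>i. i < n \<Longrightarrow> 0 < t i" and t1: "(\<Prod>i<n. t i) = 1" for t
  proof -
    define h where "h i = t i powr (1 / (2 * k))" for i
    have h0: "\<forall>i<n. 0 < h i" using t by (auto simp: h_def dest: less_imp_neq[THEN not_sym])
    have hk: "h i ^ (2 * k) = t i" if "i < n" for i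
      using t[OF that] k(1) by (simp add: h_def powr_realpow[symmetric] powr_powr)
    have "(\<Prod>i<n. h i) = (\<Prod>i<n. t i) powr (1 / (2 * k))"
      unfolding h_def by (rule prod_powr_distrib[symmetric])
    then have "(\<Prod>i<n. h i) = 1" using t1 by simp
    then obtain u where u: "u \<in> U" "\<And>i. i < n \<Longrightarrow> c * h i \<le> cmod (u i) \<and> cmod (u i) \<le> C * h i"
      using cC[OF h0] by blast
    define v where "v = u * (\<lambda>i. cnj (u i))"
    have vU: "v \<in> U" unfolding v_def by (intro U_mult u L_cnj_U)
    define w where "w = e * v ^ k"
    have wi: "w i = of_real (cmod (u i) ^ (2 * k))" if "i < n" for i
    proof -
      have "v i = of_real ((cmod (u i))\<^sup>2)" by (simp add: v_def complex_norm_square del: of_real_power)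
      then show ?thesis using that by (simp add: w_def power_mult)
    qed
    have "w \<in> W N"
      unfolding W_def using U_power[OF vU, of k] k(2)[OF vU] U_nz[OF u(1)] by (auto simp: w_def[symmetric] wi)
    moreover have "c ^ (2 * k) * t i \<le> Re (w i) \<and> Re (w i) \<le> C ^ (2 * k) * t i" if "i < n" for i
    proof -
      have "(c * h i) ^ (2 * k) \<le> cmod (u i) ^ (2 * k)" "cmod (u i) ^ (2 * k) \<le> (C * h i) ^ (2 * k)"
        by (rule power_mono; use u(2)[OF that] c h0[rule_format, OF that] in simp)+
      then show ?thesis using hk[OF that] wi[OF that] by (simp add: power_mult_distrib)
    qed
    ultimately show ?thesis by blast
  qed
  then show ?thesis using that[of "c ^ (2 * k)" "C ^ (2 * k)"] c by simp
qed

lemma W_U: "w \<in> W N \<Longrightarrow> w \<in> U" by (simp add: W_def)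
lemma W_L: "w \<in> W N \<Longrightarrow> w \<in> L" by (simp add: W_def U_def)

lemma W_Re: "w \<in> W N \<Longrightarrow> i < n \<Longrightarrow> w i = of_real (Re (w i))"
  by (simp add: W_def of_real_Re)

lemma W_pos: "w \<in> W N \<Longrightarrow> i < n \<Longrightarrow> 0 < Re (w i)"
  by (simp add: W_def)

lemma W_cmod: "w \<in> W N \<Longrightarrow> i < n \<Longrightarrow> cmod (w i) = Re (w i)"
  using W_Re W_pos by (metis norm_of_real abs_of_pos)

lemma W_mult: assumes "v \<in> W N" "w \<in> W N" shows "v * w \<in> W N"
proof -
  have "\<exists>b\<in>L. v * w - e = of_nat N * b"
    by (rule cong_mult) (use assms in \<open>auto simp: W_def U_def\<close>)
  moreover have "(v * w) i \<in> \<real> \<and> 0 < Re ((v * w) i)" if "i < n" for i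
  proof -
    have "v i * w i = of_real (Re (v i) * Re (w i))"
      using W_Re[OF assms(1) that] W_Re[OF assms(2) that] by (metis of_real_mult)
    then show ?thesis using W_pos[OF assms(1) that] W_pos[OF assms(2) that] by simp
  qed
  ultimately show ?thesis using U_mult W_U assms unfolding W_def by blast
qed

lemma W_inverse: assumes "w \<in> W N" obtains v where "v \<in> W N" "w * v = e"
proof -
  obtain v where v: "v \<in> U" "w * v = e" using U_inverse[OF W_U[OF assms]] by blast
  obtain b where b: "b \<in> L" "w - e = of_nat N * b" using assms by (auto simp: W_def)
  have "v - e = - ((w - e) * v)" using v(2) v(1) U_L by (simp add: left_diff_distrib)
  also have "\<dots> = of_nat N * (- (b * v))" using b by (simp add: mult.assoc)
  finally have "\<exists>b\<in>L. v - e = of_nat N * b" using b v U_L L_mult L_uminus by blast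
  moreover have "v i \<in> \<real> \<and> 0 < Re (v i)" if "i < n" for i
  proof -
    have "w i * v i = 1" using v(2) e_nth[OF that] by (metis times_fun_apply)
    then have "v i = inverse (w i)" by (simp add: inverse_unique)
    then have "v i = of_real (inverse (Re (w i)))" using W_Re[OF assms that] by (metis of_real_inverse)
    then show ?thesis using W_pos[OF assms that] by simp
  qed
  ultimately have "v \<in> W N" using v(1) unfolding W_def by blast
  then show ?thesis using that v by blast
qed

lemma e_W: "e \<in> W N"
proof -
  have "e - e = of_nat N * 0" by simp
  then have "\<exists>b\<in>L. e - e = of_nat N * b" using L_0 by blast
  then show ?thesis unfolding W_def using e_U by simp
qed

lemma W_power: "w \<in> W N \<Longrightarrow> e * w ^ k \<in> W N"
proof (induction k)
  case (Suc k)
  have "e * w ^ Suc k = w * (e * w ^ k)" by (simp only: power_Suc mult.left_commute)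
  then show ?case using W_mult[OF Suc.prems Suc.IH[OF Suc.prems]] by (simp only:)
qed (simp add: e_W)

lemma W_sub: "w \<in> W (N * M) \<Longrightarrow> w \<in> W N"
  unfolding W_def using L_of_nat_mult by (auto simp: mult.assoc)

end

section \<open>Contraction and expansion by units\<close>

context cm_lattice
begin

definition single :: "nat \<Rightarrow> complex \<Rightarrow> nat \<Rightarrow> complex" where
  "single j z = (\<lambda>i. if i = j then z else 0)"

definition winv :: "nat \<Rightarrow> (nat \<Rightarrow> complex) set \<Rightarrow> bool" where
  "winv N S \<longleftrightarrow> sclosed S \<and> (\<forall>w\<in>W N. \<forall>x\<in>S. w * x \<in> S)"

lemma single_E [simp]: "j < n \<Longrightarrow> single j z \<in> E" by (auto simp: single_def E_def)
lemma single_nth [simp]: "single j z j = z" by (simp add: single_def)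
lemma single_neq [simp]: "i \<noteq> j \<Longrightarrow> single j z i = 0" by (simp add: single_def)

section \<open>Units with prescribed behaviour at one place\<close>

lemma two_others: obtains a b where "a < n" "b < n" "a \<noteq> b" "a \<noteq> j" "b \<noteq> j"
proof -
  have "j = 0 \<or> j = 1 \<or> (j \<noteq> 0 \<and> j \<noteq> 1)" by auto
  then show ?thesis using that[of 1 2] that[of 0 2] that[of 0 1] n3 by (elim disjE) auto
qed

text \<open>The \<open>n - 1\<close> places other than \<open>j\<close> share equally the factor
  that brings the product to 1.\<close>

definition prof :: "nat \<Rightarrow> real \<Rightarrow> nat \<Rightarrow> real" where
  "prof j s i = (if i = j then s else s powr (- 1 / (n - 1)))"

lemma prof: assumes "j < n" "0 < s"
  shows "0 < prof j s i" "(\<Prod>i<n. prof j s i) = 1"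
proof -
  show "0 < prof j s i" using assms by (simp add: prof_def)
  have "(\<Prod>i<n. prof j s i) = s * (\<Prod>i\<in>{..<n}-{j}. prof j s i)"
    using assms by (subst prod.remove[of _ j]) (auto simp: prof_def)
  also have "(\<Prod>i\<in>{..<n}-{j}. prof j s i) = (\<Prod>i\<in>{..<n}-{j}. s powr (- 1 / (n - 1)))"
    by (rule prod.cong) (auto simp: prof_def)
  also have "\<dots> = (s powr (- 1 / (n - 1))) ^ (n - 1)" using assms by simp
  also have "\<dots> = (s powr (- 1 / (n - 1))) powr real (n - 1)"
    by (rule powr_realpow[symmetric]) (use assms in simp)
  also have "\<dots> = s powr (-1)" using n3 by (simp add: powr_powr)
  also have "s * s powr (-1) = 1" using assms by (simp add: powr_minus)
  finally show "(\<Prod>i<n. prof j s i) = 1" .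
qed

lemma W_distinct:
  assumes "v \<in> W N" "w \<in> W N" "v \<noteq> w" "j < n"
  shows "Re (v j) \<noteq> Re (w j)"
proof
  assume "Re (v j) = Re (w j)"
  then have "v j = w j" using W_Re assms by metis
  then have "(v - w) j = 0" by (simp add: fun_diff_def)
  then have "v - w = 0" using L_nonzero L_minus W_L assms by blast
  then show False using assms(3) by simp
qed

text \<open>Here \<open>n \<ge> 3\<close> enters: two places other than \<open>j\<close> leave room for infinitely many units that are
  bounded at \<open>j\<close>.\<close>

lemma W_seq:
  assumes "0 < N" "j < n"
  obtains c C w where "0 < c" "\<And>k. w k \<in> W N" "\<And>k. c \<le> Re (w k j)" "\<And>k. Re (w k j) \<le> C"
    "\<And>k l. k < (l::nat) \<Longrightarrow> w k \<noteq> w l"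
proof -
  obtain c C where c: "0 < c" "0 < C" and cC:
    "\<And>t. (\<And>i. i < n \<Longrightarrow> 0 < t i) \<Longrightarrow> (\<Prod>i<n. t i) = 1 \<Longrightarrow>
     \<exists>w\<in>W N. \<forall>i<n. c * t i \<le> Re (w i) \<and> Re (w i) \<le> C * t i"
    using units[OF assms(1)] by metis
  obtain a b where ab: "a < n" "b < n" "a \<noteq> b" "a \<noteq> j" "b \<noteq> j" by (rule two_others)
  \<comment> \<open>The shape grows at \<open>a\<close>, shrinks at \<open>b\<close> and is 1 at
    \<open>j\<close>. A base above \<open>C / c\<close> outweighs the bounded error, so the values
    at \<open>a\<close> increase strictly.\<close>
  define q where "q = C / c + 1"
  have q1: "1 < q" using c by (simp add: q_def)
  define t where "t k i = (if i = a then q ^ k else 1) * (if i = b then 1 / q ^ k else 1)" for k i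
  have "\<exists>w\<in>W N. \<forall>i<n. c * t k i \<le> Re (w i) \<and> Re (w i) \<le> C * t k i" for k :: nat
  proof (rule cC)
    show "0 < t k i" for i using q1 by (simp add: t_def)
    show "(\<Prod>i<n. t k i) = 1" unfolding t_def prod.distrib using ab q1 by simp
  qed
  then obtain w where w: "\<And>k. w k \<in> W N"
    "\<And>k i. i < n \<Longrightarrow> c * t k i \<le> Re (w k i)" "\<And>k i. i < n \<Longrightarrow> Re (w k i) \<le> C * t k i" by metis
  have Cq: "C < c * q" using c by (simp add: q_def field_simps)
  have lt: "w k \<noteq> w l" if "k < l" for k l
  proof -
    have "Re (w k a) \<le> C * q ^ k" using w(3)[OF ab(1), of k] ab by (simp add: t_def)
    also have "C * q ^ k < c * q * q ^ k"
      by (rule mult_strict_right_mono[OF Cq]) (use q1 in simp)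
    also have "\<dots> = c * q ^ Suc k" by simp
    also have "\<dots> \<le> c * q ^ l"
      using power_increasing[of "Suc k" l q] c q1 that by simp
    also have "\<dots> \<le> Re (w l a)" using w(2)[OF ab(1), of l] ab by (simp add: t_def)
    finally show ?thesis by auto
  qed
  have "c \<le> Re (w k j)" "Re (w k j) \<le> C" for k
    using w(2)[OF assms(2), of k] w(3)[OF assms(2), of k] ab by (simp_all add: t_def)
  then show ?thesis using that[of c w C] c w(1) lt by blast
qed

text \<open>Infinitely many units are bounded at \<open>j\<close> from above and below, so two of
  them are close there. They differ at \<open>j\<close>, and their quotient in the right order lies
  slightly above 1.\<close>

lemma W_near_one:
  assumes "0 < N" "j < n" "0 < \<eta>"
  obtains g where "g \<in> W N" "1 < Re (g j)" "Re (g j) < 1 + \<eta>"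
proof -
  obtain c C w where w: "0 < c" "\<And>k. w k \<in> W N" "\<And>k. c \<le> Re (w k j)" "\<And>k. Re (w k j) \<le> C"
    "\<And>k l. k < (l::nat) \<Longrightarrow> w k \<noteq> w l" using W_seq[OF assms(1,2)] by metis
  have "\<exists>k l. k < l \<and> (\<forall>i<n. cmod (w k j - w l j) < \<eta> * c)"
    by (rule two_close[where B = C]) (use w(1,4) W_cmod[OF w(2) assms(2)] assms(3) in simp_all)
  then obtain k l where kl: "k < l" "cmod (w k j - w l j) < \<eta> * c" using n_pos by blast
  note result = that
  have main: ?thesis if u: "u \<in> W N" "v \<in> W N" "Re (u j) < Re (v j)" "cmod (v j - u j) < \<eta> * c" "c \<le> Re (u j)" for u v
  proof -
    obtain u' where u': "u' \<in> W N" "u * u' = e" using W_inverse[OF u(1)] by blast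
    have "v * u' \<in> W N" using u u' W_mult by blast
    have "u j * u' j = 1" using u'(2) e_nth[OF assms(2)] by (metis times_fun_apply)
    then have "of_real (Re (u j)) * of_real (Re (u' j)) = (1::complex)"
      using W_Re[OF u(1) assms(2)] W_Re[OF u'(1) assms(2)] by metis
    then have "Re (u j) * Re (u' j) = 1" by (metis of_real_mult of_real_eq_1_iff)
    then have u'j: "Re (u' j) = 1 / Re (u j)" using w(1) u(5) by (simp add: field_simps)
    have "(v * u') j = of_real (Re (v j)) * of_real (Re (u' j))"
      using W_Re[OF u(2) assms(2)] W_Re[OF u'(1) assms(2)] by (metis times_fun_apply)
    then have g: "Re ((v * u') j) = Re (v j) / Re (u j)" using u'j by simp
    have "Re (v j) - Re (u j) < \<eta> * c"
      using u(4) abs_Re_le_cmod[of "v j - u j"] by simp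
    also have "\<dots> \<le> \<eta> * Re (u j)" using u(5) assms by simp
    finally have "Re (v j) < (1 + \<eta>) * Re (u j)" by (simp add: algebra_simps)
    then have "Re (v j) / Re (u j) < 1 + \<eta>" "1 < Re (v j) / Re (u j)"
      using u w(1) by (simp_all add: divide_less_eq)
    then show ?thesis using result[OF \<open>v * u' \<in> W N\<close>] unfolding g by blast
  qed
  have "Re (w k j) \<noteq> Re (w l j)" using W_distinct w kl assms by blast
  then consider "Re (w k j) < Re (w l j)" | "Re (w l j) < Re (w k j)" by linarith
  then show ?thesis
  proof cases
    case 1
    then show ?thesis using main[of "w k" "w l"] w kl by (simp add: norm_minus_commute)
  next
    case 2
    then show ?thesis using main[of "w l" "w k"] w kl by simp
  qed
qed

lemma W_small:
  assumes "0 < N" "j < n" "0 < r"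
  obtains w where "w \<in> W N" "Re (w j) \<le> r"
proof -
  obtain c C where c: "0 < c" "0 < C" and cC:
    "\<And>t. (\<And>i. i < n \<Longrightarrow> 0 < t i) \<Longrightarrow> (\<Prod>i<n. t i) = 1 \<Longrightarrow>
     \<exists>w\<in>W N. \<forall>i<n. c * t i \<le> Re (w i) \<and> Re (w i) \<le> C * t i"
    using units[OF assms(1)] by metis
  have s: "0 < r / C" using c assms by simp
  obtain w where w: "w \<in> W N" "\<forall>i<n. c * prof j (r / C) i \<le> Re (w i) \<and> Re (w i) \<le> C * prof j (r / C) i"
    using cC[of "prof j (r / C)"] prof[OF assms(2) s] by blast
  have "Re (w j) \<le> r" using w(2) assms(2) c by (auto simp: prof_def)
  then show ?thesis using that w by blast
qed

text \<open>From a unit at most \<open>r\<close> at \<open>j\<close>, multiplication by a unit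
  slightly above 1 produces a geometric progression whose gaps up to \<open>r\<close> are below
  \<open>\<epsilon>\<close>; the last term not exceeding \<open>r\<close> is taken.\<close>

lemma W_dense:
  assumes "0 < N" "j < n" "0 < r" "0 < \<epsilon>"
  obtains w where "w \<in> W N" "\<bar>Re (w j) - r\<bar> < \<epsilon>"
proof -
  obtain g where g: "g \<in> W N" "1 < Re (g j)" "Re (g j) < 1 + \<epsilon> / r"
    using W_near_one[OF assms(1,2), of "\<epsilon> / r"] assms by auto
  obtain w where w: "w \<in> W N" "Re (w j) \<le> r" using W_small[OF assms(1-3)] .
  have w0: "0 < Re (w j)" using W_pos w(1) assms(2) by blast
  define P where "P m \<longleftrightarrow> r < Re (w j) * Re (g j) ^ m" for m
  obtain m where "r / Re (w j) < Re (g j) ^ m" using real_arch_pow[OF g(2)] by blast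
  then have "P m" using w0 by (simp add: P_def field_simps)
  then have L: "P (LEAST m. P m)" by (rule LeastI)
  have "\<not> P 0" using w(2) by (simp add: P_def)
  then obtain k where k: "(LEAST m. P m) = Suc k" using L by (metis not0_implies_Suc)
  then have "\<not> P k" using not_less_Least[of k P] by simp
  then have 1: "Re (w j) * Re (g j) ^ k \<le> r" by (simp add: P_def)
  have 2: "r < Re (w j) * Re (g j) ^ k * Re (g j)" using L k by (simp add: P_def mult_ac)
  define x where "x = Re (w j) * Re (g j) ^ k"
  have x0: "0 < x" using w0 g by (simp add: x_def)
  have "r < x * Re (g j)" using 2 by (simp add: x_def)
  also have "\<dots> < x * (1 + \<epsilon> / r)" by (rule mult_strict_left_mono) (use g x0 in auto)
  also have "\<dots> = x + x * (\<epsilon> / r)" by (simp add: algebra_simps)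
  also have "x * (\<epsilon> / r) \<le> r * (\<epsilon> / r)" by (rule mult_right_mono) (use 1 assms in \<open>auto simp: x_def\<close>)
  finally have "r < x + \<epsilon>" using assms by simp
  then have "\<bar>x - r\<bar> < \<epsilon>" using 1 assms by (simp add: x_def)
  moreover have "w * (e * g ^ k) \<in> W N" using W_mult W_power w g by blast
  moreover have "Re ((w * (e * g ^ k)) j) = x"
  proof -
    have "(w * (e * g ^ k)) j = w j * g j ^ k" using assms by simp
    also have "\<dots> = of_real (Re (w j)) * of_real (Re (g j)) ^ k"
      using W_Re[OF w(1) assms(2)] W_Re[OF g(1) assms(2)] by simp
    also have "\<dots> = of_real x" by (simp add: x_def)
    finally show ?thesis by simp
  qed
  ultimately show ?thesis using that by metis
qed

lemma W_contract:
  assumes "0 < N" "j < n" "0 < \<epsilon>"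
  obtains w where "w \<in> W N" "\<And>i. i < n \<Longrightarrow> i \<noteq> j \<Longrightarrow> Re (w i) \<le> \<epsilon>"
proof -
  obtain c C where c: "0 < c" "0 < C" and cC:
    "\<And>t. (\<And>i. i < n \<Longrightarrow> 0 < t i) \<Longrightarrow> (\<Prod>i<n. t i) = 1 \<Longrightarrow>
     \<exists>w\<in>W N. \<forall>i<n. c * t i \<le> Re (w i) \<and> Re (w i) \<le> C * t i"
    using units[OF assms(1)] by metis
  \<comment> \<open>The solution of \<open>C * s powr (- 1 / (n - 1)) = \<epsilon>\<close>.\<close>
  define s where "s = (C / \<epsilon>) powr (n - 1)"
  have s0: "0 < s" using c assms by (simp add: s_def)
  have "s powr (- 1 / (n - 1)) = \<epsilon> / C"
  proof -
    have "s powr (- 1 / (n - 1)) = (C / \<epsilon>) powr (-1)" using n3 by (simp add: s_def powr_powr)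
    then show ?thesis using c assms by (simp add: powr_minus)
  qed
  then have p: "C * prof j s i = \<epsilon>" if "i \<noteq> j" for i using that c by (simp add: prof_def)
  obtain w where "w \<in> W N" "\<forall>i<n. c * prof j s i \<le> Re (w i) \<and> Re (w i) \<le> C * prof j s i"
    using cC[of "prof j s"] prof[OF assms(2) s0] by blast
  then show ?thesis using that[of w] p by metis
qed

text \<open>The shape with value \<open>1 / cmod (x j)\<close> at \<open>j\<close> brings that
  coordinate to a size between \<open>c\<close> and \<open>C\<close>. As this value is at least 1,
  the other places are scaled by at most \<open>C\<close> and stay small.\<close>

lemma W_expand:
  assumes "0 < N"
  obtains c C where "0 < c" "0 < C"
    "\<And>x j \<eta>. j < n \<Longrightarrow> x j \<noteq> 0 \<Longrightarrow> (\<And>i. i < n \<Longrightarrow> cmod (x i) \<le> \<eta>) \<Longrightarrow> \<eta> \<le> 1 \<Longrightarrow>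
      \<exists>w\<in>W N. c \<le> cmod (w j * x j) \<and> cmod (w j * x j) \<le> C \<and>
        (\<forall>i<n. i \<noteq> j \<longrightarrow> cmod (w i * x i) \<le> C * \<eta>)"
proof -
  obtain c C where c: "0 < c" "0 < C" and cC:
    "\<And>t. (\<And>i. i < n \<Longrightarrow> 0 < t i) \<Longrightarrow> (\<Prod>i<n. t i) = 1 \<Longrightarrow>
     \<exists>w\<in>W N. \<forall>i<n. c * t i \<le> Re (w i) \<and> Re (w i) \<le> C * t i"
    using units[OF assms(1)] by metis
  have "\<exists>w\<in>W N. c \<le> cmod (w j * x j) \<and> cmod (w j * x j) \<le> C \<and>
        (\<forall>i<n. i \<noteq> j \<longrightarrow> cmod (w i * x i) \<le> C * \<eta>)"
    if j: "j < n" and xj: "x j \<noteq> 0" and \<eta>: "\<And>i. i < n \<Longrightarrow> cmod (x i) \<le> \<eta>" "\<eta> \<le> 1" for x j \<eta>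
  proof -
    define s where "s = 1 / cmod (x j)"
    have s0: "0 < s" using xj by (simp add: s_def)
    have s1: "1 \<le> s" using \<eta>(1)[OF j] \<eta>(2) xj by (simp add: s_def)
    have p1: "prof j s i \<le> 1" if "i \<noteq> j" for i
    proof -
      have "s powr (- 1 / (n - 1)) \<le> s powr 0" by (rule powr_mono) (use s1 in auto)
      then show ?thesis using that s0 by (simp add: prof_def)
    qed
    obtain w where w: "w \<in> W N" "\<And>i. i < n \<Longrightarrow> c * prof j s i \<le> Re (w i)" "\<And>i. i < n \<Longrightarrow> Re (w i) \<le> C * prof j s i"
      using cC[of "prof j s"] prof[OF j s0] by blast
    have "c * s \<le> Re (w j)" "Re (w j) \<le> C * s" using w(2,3)[OF j] by (simp_all add: prof_def)
    then have "c \<le> cmod (w j * x j)" "cmod (w j * x j) \<le> C"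
      using xj by (auto simp: norm_mult W_cmod[OF w(1) j] s_def field_simps)
    moreover have "cmod (w i * x i) \<le> C * \<eta>" if i: "i < n" "i \<noteq> j" for i
    proof -
      have "Re (w i) \<le> C" using w(3)[OF i(1)] mult_left_le[OF p1[OF i(2)], of C] c by linarith
      then show ?thesis
        unfolding norm_mult W_cmod[OF w(1) i(1)]
        by (intro mult_mono \<eta> i) (use c in auto)
    qed
    ultimately show ?thesis using w(1) by blast
  qed
  then show ?thesis using that[of c C] c by blast
qed

section \<open>Rays in closed invariant sets\<close>

lemma winv_sclosed: "winv N S \<Longrightarrow> sclosed S" by (simp add: winv_def)
lemma winv_W: "winv N S \<Longrightarrow> w \<in> W N \<Longrightarrow> x \<in> S \<Longrightarrow> w * x \<in> S" by (simp add: winv_def)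

lemma ray_dense:
  assumes "0 < N" "winv N S" "j < n" "single j z \<in> S" "0 < r"
  shows "single j (of_real r * z) \<in> S"
proof (rule sclosed_approx[OF winv_sclosed[OF assms(2)]])
  show "single j (of_real r * z) \<in> E" using assms by simp
  fix \<epsilon> :: real assume \<epsilon>: "0 < \<epsilon>"
  have "0 < \<epsilon> / (cmod z + 1)" using \<epsilon> by (simp add: add_nonneg_pos)
  then obtain w where w: "w \<in> W N" "\<bar>Re (w j) - r\<bar> < \<epsilon> / (cmod z + 1)"
    by (rule W_dense[OF assms(1,3,5)])
  have wj: "w j * z - of_real r * z = of_real (Re (w j) - r) * z"
    using W_Re[OF w(1) assms(3)] by (metis left_diff_distrib of_real_diff)
  have "cmod (of_real (Re (w j) - r) * z) < \<epsilon>"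
  proof -
    have "\<bar>Re (w j) - r\<bar> * (cmod z + 1) < \<epsilon>"
      using w(2) by (simp add: pos_less_divide_eq add_nonneg_pos)
    moreover have "\<bar>Re (w j) - r\<bar> * cmod z \<le> \<bar>Re (w j) - r\<bar> * (cmod z + 1)"
      by (rule mult_left_mono) auto
    moreover have "cmod (of_real (Re (w j) - r) * z) = \<bar>Re (w j) - r\<bar> * cmod z"
      by (simp only: norm_mult norm_of_real)
    ultimately show ?thesis by linarith
  qed
  then have "cmod ((w * single j z) i - single j (of_real r * z) i) < \<epsilon>" for i
    using wj \<epsilon> by (cases "i = j") simp_all
  then show "\<exists>x\<in>S. \<forall>i<n. cmod (x i - single j (of_real r * z) i) < \<epsilon>"
    using winv_W[OF assms(2) w(1) assms(4)] by blast
qed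

text \<open>Points tending to 0 are expanded to bounded size at \<open>j\<close> while their other
  coordinates still tend to 0, so a limit point is concentrated at \<open>j\<close>. A decreasing
  family is allowed because isolation needs one ray inside all superlevel sets.\<close>

lemma ray:
  assumes N: "0 < N" and j: "j < n" and inv: "\<And>k. winv N (S k)" and dec: "\<And>k. S (Suc k) \<subseteq> S k"
    and small: "\<And>k. \<exists>x\<in>S k. x j \<noteq> 0 \<and> (\<forall>i<n. cmod (x i) \<le> 1 / Suc k)"
  obtains z where "z \<noteq> 0" "\<And>r k. 0 < r \<Longrightarrow> single j (of_real r * z) \<in> S k"
proof -
  obtain c C where c: "0 < c" "0 < C" and cC:
    "\<And>x j \<eta>. j < n \<Longrightarrow> x j \<noteq> 0 \<Longrightarrow> (\<And>i. i < n \<Longrightarrow> cmod (x i) \<le> \<eta>) \<Longrightarrow> \<eta> \<le> 1 \<Longrightarrow>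
      \<exists>w\<in>W N. c \<le> cmod (w j * x j) \<and> cmod (w j * x j) \<le> C \<and>
        (\<forall>i<n. i \<noteq> j \<longrightarrow> cmod (w i * x i) \<le> C * \<eta>)" using W_expand[OF N] by metis
  have "\<exists>y. y \<in> S k \<and> c \<le> cmod (y j) \<and> cmod (y j) \<le> C \<and> (\<forall>i<n. i \<noteq> j \<longrightarrow> cmod (y i) \<le> C * (1 / Suc k))" for k
  proof -
    obtain x where x: "x \<in> S k" "x j \<noteq> 0" "\<And>i. i < n \<Longrightarrow> cmod (x i) \<le> 1 / Suc k" using small by blast
    have "1 / real (Suc k) \<le> 1" by simp
    then obtain w where w: "w \<in> W N" "c \<le> cmod (w j * x j)" "cmod (w j * x j) \<le> C"
        "\<forall>i<n. i \<noteq> j \<longrightarrow> cmod (w i * x i) \<le> C * (1 / Suc k)" using cC[of j x "1 / Suc k", OF j x(2) x(3)] by blast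
    then show ?thesis using winv_W[OF inv w(1) x(1)] by (intro exI[of _ "w * x"]) simp
  qed
  then obtain y where y: "\<And>k. y k \<in> S k" "\<And>k. c \<le> cmod (y k j)" "\<And>k. cmod (y k j) \<le> C"
    "\<And>k i. i < n \<Longrightarrow> i \<noteq> j \<Longrightarrow> cmod (y k i) \<le> C * (1 / Suc k)" by metis
  have bd: "cmod (y k i) \<le> C" if "i < n" for k i
  proof (cases "i = j")
    case False
    have "C * (1 / Suc k) \<le> C * 1" by (rule mult_left_mono) (use c in auto)
    then show ?thesis using y(4)[OF that False, of k] by simp
  qed (use y in simp)
  obtain q l where q: "strict_mono q" "l \<in> E" "\<And>i. i < n \<Longrightarrow> (\<lambda>k. y (q k) i) \<longlonglongrightarrow> l i"
    using bounded_subsequence[of y C] bd by blast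
  have l0: "l i = 0" if "i < n" "i \<noteq> j" for i
  proof -
    have "(\<lambda>k. y k i) \<longlonglongrightarrow> 0"
    proof (rule Lim_null_comparison)
      show "\<forall>\<^sub>F k in sequentially. cmod (y k i) \<le> C * (1 / real (Suc k))"
        using y(4)[OF that] by (intro always_eventually allI)
      show "(\<lambda>k. C * (1 / real (Suc k))) \<longlonglongrightarrow> 0"
        using tendsto_mult_right_zero[OF LIMSEQ_Suc[OF lim_1_over_n]] .
    qed
    then have "((\<lambda>k. y k i) \<circ> q) \<longlonglongrightarrow> 0" using q(1) by (rule LIMSEQ_subseq_LIMSEQ)
    then show ?thesis using q(3)[OF that(1)] by (auto simp: o_def intro: LIMSEQ_unique)
  qed
  define z where "z = l j"
  have l: "l = single j z" by (rule E_eqI[OF q(2) single_E[OF j]]) (use l0 in \<open>auto simp: z_def single_def\<close>)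
  have "c \<le> cmod z"
    unfolding z_def by (rule tendsto_lowerbound[OF tendsto_norm[OF q(3)[OF j]]]) (use y(2) in auto)
  then have z0: "z \<noteq> 0" using c by auto
  have mono: "S m \<subseteq> S k" if "k \<le> m" for k m using lift_Suc_antimono_le[of S, OF dec that] .
  have "l \<in> S k" for k
  proof (rule sclosed_tail[OF winv_sclosed[OF inv], of k "\<lambda>m. y (q m)"])
    fix m assume "k \<le> m"
    then have "k \<le> q m" using seq_suble[OF q(1), of m] by linarith
    then show "y (q m) \<in> S k" using mono y(1) by blast
  qed (use q in auto)
  then have "single j (of_real r * z) \<in> S k" if "0 < r" for r k
    using ray_dense[OF N inv j _ that] l by simp
  then show ?thesis using that[OF z0] by blast
qed

end

section \<open>Invariant sets of real vectors\<close>

context cm_lattice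
begin

definition ER :: "(nat \<Rightarrow> complex) set" where "ER = {x\<in>E. \<forall>i. x i \<in> \<real>}"
definition LR :: "(nat \<Rightarrow> complex) set" where "LR = L \<inter> ER"
text \<open>The preimage of the torsion of the quotient by \<open>L\<close>; for the ring of
  integers this is the image of the field.\<close>

definition tors :: "(nat \<Rightarrow> complex) set" where "tors = {x\<in>E. \<exists>m>0. of_nat m * x \<in> L}"
definition lper :: "(nat \<Rightarrow> complex) set \<Rightarrow> bool" where "lper S \<longleftrightarrow> (\<forall>x\<in>S. \<forall>a\<in>L. x + a \<in> S)"
definition rper :: "(nat \<Rightarrow> complex) set \<Rightarrow> bool" where "rper S \<longleftrightarrow> (\<forall>x\<in>S. \<forall>a\<in>LR. x + a \<in> S)"

lemma ER_E: "x \<in> ER \<Longrightarrow> x \<in> E" by (simp add: ER_def)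
lemma ER_add: "x \<in> ER \<Longrightarrow> y \<in> ER \<Longrightarrow> x + y \<in> ER" by (simp add: ER_def)
lemma ER_diff: "x \<in> ER \<Longrightarrow> y \<in> ER \<Longrightarrow> x - y \<in> ER" by (simp add: ER_def)
lemma ER_mult: "x \<in> ER \<Longrightarrow> y \<in> ER \<Longrightarrow> x * y \<in> ER" by (simp add: ER_def)
lemma ER_0: "0 \<in> ER" by (simp add: ER_def)
lemma LR_ER: "x \<in> LR \<Longrightarrow> x \<in> ER" by (simp add: LR_def)
lemma LR_L: "x \<in> LR \<Longrightarrow> x \<in> L" by (simp add: LR_def)
lemma LR_mult: "x \<in> LR \<Longrightarrow> y \<in> LR \<Longrightarrow> x * y \<in> LR" by (simp add: LR_def ER_mult L_mult)
lemma LR_minus: "x \<in> LR \<Longrightarrow> y \<in> LR \<Longrightarrow> x - y \<in> LR" by (simp add: LR_def ER_diff L_minus)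
lemma LR_0: "0 \<in> LR" by (simp add: LR_def ER_0)
lemma LR_uminus: "x \<in> LR \<Longrightarrow> - x \<in> LR" using LR_minus[OF LR_0, of x] by simp

lemma W_LR: assumes "w \<in> W N" shows "w \<in> LR"
proof -
  have "w i \<in> \<real>" for i
    using assms L_sub[OF W_L[OF assms], of i] by (cases "i < n") (auto simp: W_def)
  then show ?thesis using W_L[OF assms] by (simp add: LR_def ER_def)
qed

lemma sclosed_ER: "sclosed ER"
  unfolding sclosed_def
proof (intro conjI allI impI)
  fix f l assume f: "\<forall>k. f k \<in> ER" "l \<in> E" "\<forall>i<n. (\<lambda>k. f k i) \<longlonglongrightarrow> l i"
  have "l i \<in> \<real>" for i
  proof (cases "i < n")
    case True
    have "(\<lambda>k. Im (f k i)) \<longlonglongrightarrow> Im (l i)" using f(3) True by (intro tendsto_Im) simp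
    moreover have "Im (f k i) = 0" for k using f(1) by (simp add: ER_def complex_is_Real_iff)
    ultimately have "(\<lambda>k::nat. 0) \<longlonglongrightarrow> Im (l i)" by simp
    then have "Im (l i) = 0" by (simp add: LIMSEQ_const_iff)
    then show ?thesis by (simp add: complex_is_Real_iff)
  next
    case False
    then show ?thesis using f(2) by (simp add: E_def)
  qed
  then show "l \<in> ER" using f(2) by (simp add: ER_def)
qed (auto simp: ER_def)

text \<open>A lattice point near half of \<open>x\<close>, plus its conjugate, is a real lattice
  point near \<open>x\<close>; this costs the factor 2.\<close>

lemma near_R: assumes "x \<in> ER" obtains a where "a \<in> LR" "\<And>i. i < n \<Longrightarrow> cmod (x i - a i) \<le> 2 * R"
proof -
  define y where "y = (\<lambda>i. x i / 2)"
  have "y \<in> E" using assms by (simp add: y_def ER_def E_def)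
  then obtain b where b: "b \<in> L" "\<And>i. i < n \<Longrightarrow> cmod (y i - b i) \<le> R" using near by blast
  define a where "a = b + (\<lambda>i. cnj (b i))"
  have "a i \<in> \<real>" for i by (simp add: a_def complex_add_cnj)
  moreover have "a \<in> L" unfolding a_def by (intro L_add L_cnj b)
  ultimately have "a \<in> LR" by (simp add: LR_def ER_def)
  moreover have "cmod (x i - a i) \<le> 2 * R" if "i < n" for i
  proof -
    have "x i \<in> \<real>" using assms by (simp add: ER_def)
    then have "cnj (y i) = y i" by (simp add: y_def Reals_cnj_iff)
    then have "x i - a i = (y i - b i) + cnj (y i - b i)" by (simp add: a_def y_def)
    then have "cmod (x i - a i) \<le> cmod (y i - b i) + cmod (cnj (y i - b i))"
      using norm_triangle_ineq by metis
    then show ?thesis using b(2)[OF that] by (simp only: complex_mod_cnj)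
  qed
  ultimately show ?thesis using that by blast
qed

lemma tors_L: "a \<in> L \<Longrightarrow> a \<in> tors" unfolding tors_def by (auto intro!: exI[of _ 1])

lemma tors_E: "a \<in> tors \<Longrightarrow> a \<in> E" by (simp add: tors_def)

lemma tors_mult: assumes "a \<in> L" "x \<in> tors" shows "a * x \<in> tors"
proof -
  obtain m where m: "m > 0" "of_nat m * x \<in> L" using assms(2) by (auto simp: tors_def)
  have "of_nat m * (a * x) = a * (of_nat m * x)" by (simp only: mult.left_commute)
  then have "of_nat m * (a * x) \<in> L" using L_mult assms m by metis
  then show ?thesis using m assms tors_E unfolding tors_def by blast
qed

lemma tors_add: assumes "x \<in> tors" "y \<in> tors" shows "x + y \<in> tors"
proof -
  obtain m where m: "m > 0" "of_nat m * x \<in> L" using assms(1) by (auto simp: tors_def)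
  obtain k where k: "k > 0" "of_nat k * y \<in> L" using assms(2) by (auto simp: tors_def)
  have "of_nat (m * k) * (x + y) = of_nat k * (of_nat m * x) + of_nat m * (of_nat k * y)"
    by (rule ext) (simp add: algebra_simps)
  also have "\<dots> \<in> L" by (intro L_add L_of_nat_mult m k)
  finally have "\<exists>j>0. of_nat j * (x + y) \<in> L" using m k by (intro exI[of _ "m * k"]) simp
  then show ?thesis using assms tors_E unfolding tors_def by blast
qed

text \<open>Multiplying by the cofactor \<open>b\<close> with \<open>a * b = nm a\<close> replaces
  the lattice multiplier by a positive integer.\<close>

lemma tors_if_mult: assumes "x \<in> E" "a \<in> L" "a \<noteq> 0" "a * x \<in> L" shows "x \<in> tors"
proof -
  obtain b where b: "b \<in> L" "\<And>i. i < n \<Longrightarrow> a i * b i = of_real (nm a)"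
    using L_adj[OF assms(2)] unfolding nm_def by blast
  have "nm a \<in> \<int>" using L_norm_Ints[OF assms(2)] by (simp add: nm_def)
  then obtain z where z: "nm a = of_int z" by (auto elim: Ints_cases)
  have m: "nm a = real (nat z)" "0 < nat z" using z nm_ge_1[OF assms(2,3)] by auto
  have "of_nat (nat z) * x = b * (a * x)"
  proof (rule E_eqI)
    fix i assume i: "i < n"
    have "a i * b i = of_nat (nat z)" using b(2)[OF i] m(1) by simp
    then have "of_nat (nat z) * x i = b i * (a i * x i)" by (simp only: mult_ac flip: \<open>a i * b i = of_nat (nat z)\<close>)
    then show "(of_nat (nat z) * x) i = (b * (a * x)) i" by simp
  qed (use assms in auto)
  then have "of_nat (nat z) * x \<in> L" using L_mult b assms by metis
  then show ?thesis using m assms unfolding tors_def by blast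
qed

text \<open>\<open>w - e\<close> is divisible by \<open>m\<close>, and \<open>m\<close> already
  carries \<open>r\<close> into the lattice.\<close>

lemma tors_fix: assumes "w \<in> W (N * m)" "of_nat m * r \<in> L" "r \<in> E" shows "w * r - r \<in> L"
proof -
  obtain b where b: "b \<in> L" "w - e = of_nat (N * m) * b" using assms(1) by (auto simp: W_def)
  have "w * r - r = (w - e) * r" using assms(3) by (simp add: left_diff_distrib)
  also have "\<dots> = of_nat N * (b * (of_nat m * r))" unfolding b(2) by (rule ext) (simp add: mult_ac)
  also have "\<dots> \<in> L" by (intro L_of_nat_mult L_mult b assms)
  finally show ?thesis .
qed

lemma E_bounded: obtains A where "0 < A" "\<And>i. i < n \<Longrightarrow> cmod (x i) \<le> A"
proof
  show "0 < 1 + (\<Sum>i<n. cmod (x i))" by (intro add_pos_nonneg sum_nonneg) auto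
  show "cmod (x i) \<le> 1 + (\<Sum>i<n. cmod (x i))" if "i < n" for i
    using member_le_sum[of i "{..<n}" "\<lambda>i. cmod (x i)"] that by simp
qed

text \<open>A unit \<open>w\<close> that is tiny away from \<open>j\<close> carries lattice points near \<open>y / w\<close> to lattice points that
  are near \<open>y\<close> away from \<open>j\<close>; the ray corrects the coordinate \<open>j\<close>.\<close>

lemma ray_fills:
  assumes S: "sclosed S" and \<alpha>: "\<alpha> \<in> E" and j: "j < n" and \<rho>: "\<rho> \<noteq> 0" "\<alpha> j = of_real \<rho> * z"
    and rays: "\<And>r. 0 < r \<Longrightarrow> single j (of_real r * z) \<in> S"
    and per: "\<And>x a. x \<in> S \<Longrightarrow> a \<in> LR \<Longrightarrow> x + \<alpha> * a \<in> S"
    and y: "y \<in> ER"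
  shows "y * \<alpha> \<in> S"
proof (rule sclosed_approx[OF S])
  show "y * \<alpha> \<in> E" using \<alpha> by simp
  fix \<epsilon> :: real assume \<epsilon>: "0 < \<epsilon>"
  obtain A where A: "0 < A" "\<And>i. i < n \<Longrightarrow> cmod (\<alpha> i) \<le> A" using E_bounded by blast
  \<comment> \<open>Chosen so that the error away from \<open>j\<close>, at most
    \<open>A * (\<theta> * (2 * R))\<close>, is half of \<open>\<epsilon>\<close>.\<close>
  define \<theta> where "\<theta> = \<epsilon> / (A * (2 * R)) / 2"
  have \<theta>: "0 < \<theta>" using \<epsilon> A(1) R_pos by (simp add: \<theta>_def)
  have A\<theta>: "A * (\<theta> * (2 * R)) < \<epsilon>" using \<epsilon> A(1) R_pos by (simp add: \<theta>_def)
  obtain w where w: "w \<in> W 1" "\<And>i. i < n \<Longrightarrow> i \<noteq> j \<Longrightarrow> Re (w i) \<le> \<theta>"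
    using W_contract[of 1 j \<theta>] j \<theta> by auto
  obtain u where u: "u \<in> W 1" "w * u = e" using W_inverse[OF w(1)] by blast
  \<comment> \<open>Only positive multiples of \<open>z\<close> are available. A shift by
    \<open>3 * R\<close>, more than the rounding error \<open>2 * R\<close>, forces the correction
    \<open>g\<close> at \<open>j\<close> to have the sign of \<open>\<rho>\<close>.\<close>
  define s where "s = sgn \<rho>"
  have s: "s = 1 \<and> 0 < \<rho> \<or> s = -1 \<and> \<rho> < 0" using \<rho>(1) by (auto simp: s_def sgn_if)
  have "single j (of_real (s * (3 * R))) \<in> ER" using j by (auto simp: ER_def single_def E_def)
  then have "y * u - single j (of_real (s * (3 * R))) \<in> ER"
    using y W_LR[OF u(1)] by (intro ER_diff ER_mult) (auto dest: LR_ER)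
  then obtain a where a: "a \<in> LR"
    "\<And>i. i < n \<Longrightarrow> cmod ((y * u - single j (of_real (s * (3 * R)))) i - a i) \<le> 2 * R"
    using near_R by blast
  have wu: "w i * u i = 1" if "i < n" for i using u(2) e_nth[OF that] by (metis times_fun_apply)
  define g where "g = Re (y j * u j - a j)"
  have g: "y j * u j - a j = of_real g"
  proof -
    have "y j \<in> \<real>" "u j \<in> \<real>" "a j \<in> \<real>" using y a(1) W_LR[OF u(1)] by (auto simp: ER_def LR_def)
    then have "y j * u j - a j \<in> \<real>" by (intro Reals_diff Reals_mult)
    then show ?thesis unfolding g_def by (simp only: of_real_Re)
  qed
  have "cmod (of_real g - of_real (s * (3 * R))) \<le> 2 * R"
    using a(2)[OF j] by (simp flip: g) (simp add: algebra_simps)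
  then have "\<bar>g - s * (3 * R)\<bar> \<le> 2 * R" by (metis norm_of_real of_real_diff)
  then have "0 < g * \<rho>" using s R_pos by (auto simp: zero_less_mult_iff)
  define r where "r = Re (w j) * (g * \<rho>)"
  have r: "0 < r" using \<open>0 < g * \<rho>\<close> W_pos[OF w(1) j] by (simp add: r_def)
  have waR: "w * a \<in> LR" by (intro LR_mult W_LR[OF w(1)] a)
  have "single j (of_real r * z) + \<alpha> * (w * a) \<in> S" by (rule per[OF rays[OF r] waR])
  moreover have "cmod ((single j (of_real r * z) + \<alpha> * (w * a)) i - (y * \<alpha>) i) < \<epsilon>" if i: "i < n" for i
  proof (cases "i = j")
    case True
    have "of_real r * z = w j * (y j * u j - a j) * \<alpha> j"
      using W_Re[OF w(1) j] by (simp add: r_def g \<rho>(2))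
    also have "\<dots> = (w j * u j) * y j * \<alpha> j - \<alpha> j * (w j * a j)" by (simp add: algebra_simps)
    finally have "of_real r * z + \<alpha> j * (w j * a j) = y j * \<alpha> j" using wu[OF j] by simp
    then show ?thesis using True \<epsilon> by simp
  next
    case False
    have "\<alpha> i * (w i * a i) - y i * \<alpha> i = - (\<alpha> i * (w i * (y i * u i - a i)))"
      using wu[OF i] by (simp add: algebra_simps)
    then have "cmod (\<alpha> i * (w i * a i) - y i * \<alpha> i) = cmod (\<alpha> i) * (Re (w i) * cmod (y i * u i - a i))"
      by (simp add: norm_mult W_cmod[OF w(1) i])
    also have "\<dots> \<le> A * (\<theta> * (2 * R))"
      using A i w(2)[OF i False] a(2)[OF i] False W_pos[OF w(1) i] \<theta>
      by (intro mult_mono) (auto intro!: mult_nonneg_nonneg less_imp_le)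
    also have "\<dots> < \<epsilon>" by (rule A\<theta>)
    finally show ?thesis using False by simp
  qed
  ultimately show "\<exists>x\<in>S. \<forall>i<n. cmod (x i - (y * \<alpha>) i) < \<epsilon>"
    by (intro bexI[of _ "single j (of_real r * z) + \<alpha> * (w * a)"] allI impI)
qed

text \<open>If every coordinate failed at some stage, the largest of these finitely many stages
  would contain a nonzero point with all coordinates zero.\<close>

lemma acc_coord_family:
  assumes SE: "\<And>k. S k \<subseteq> E" and dec: "\<And>k. S (Suc k) \<subseteq> S k"
    and acc: "\<And>k. \<exists>x\<in>S k. x \<noteq> 0 \<and> (\<forall>i<n. cmod (x i) \<le> 1 / Suc k)"
  obtains j where "j < n" "\<And>k. \<exists>x\<in>S k. x j \<noteq> 0 \<and> (\<forall>i<n. cmod (x i) \<le> 1 / Suc k)"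
proof -
  define P where "P j k \<longleftrightarrow> (\<exists>x\<in>S k. x j \<noteq> 0 \<and> (\<forall>i<n. cmod (x i) \<le> 1 / Suc k))" for j k
  have "\<exists>j<n. \<forall>k. P j k"
  proof (rule ccontr)
    assume "\<not> (\<exists>j<n. \<forall>k. P j k)"
    then have "\<exists>k. j < n \<longrightarrow> \<not> P j k" for j by blast
    then obtain k where k: "\<And>j. j < n \<Longrightarrow> \<not> P j (k j)" by metis
    define m where "m = Max (k ` {..<n})"
    have m: "k j \<le> m" if "j < n" for j unfolding m_def using that by (intro Max_ge) auto
    obtain x where x: "x \<in> S m" "x \<noteq> 0" "\<And>i. i < n \<Longrightarrow> cmod (x i) \<le> 1 / Suc m" using acc by blast
    have "\<exists>j<n. x j \<noteq> 0"
    proof (rule ccontr)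
      assume *: "\<not> (\<exists>j<n. x j \<noteq> 0)"
      have "x \<in> E" using SE x(1) by (rule subsetD)
      then have "x = 0" by (rule E_eqI) (use * in auto)
      then show False using x(2) by simp
    qed
    then obtain j where j: "j < n" "x j \<noteq> 0" by blast
    have "1 / real (Suc m) \<le> 1 / Suc (k j)" using m[OF j(1)] by (simp add: frac_le)
    then have "cmod (x i) \<le> 1 / Suc (k j)" if "i < n" for i using x(3)[OF that] by linarith
    moreover have "x \<in> S (k j)"
      using lift_Suc_antimono_le[of S, OF dec m[OF j(1)]] x(1) by (rule subsetD)
    ultimately have "P j (k j)" unfolding P_def by (intro bexI[of _ x] conjI allI impI j(2))
    then show False using k[OF j(1)] by simp
  qed
  then show ?thesis using that unfolding P_def by blast
qed

lemma acc_coord: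
  assumes "S \<subseteq> E" "\<And>\<epsilon>. 0 < \<epsilon> \<Longrightarrow> \<exists>x\<in>S. x \<noteq> 0 \<and> (\<forall>i<n. cmod (x i) < \<epsilon>)"
  obtains j where "j < n" "\<And>k. \<exists>x\<in>S. x j \<noteq> 0 \<and> (\<forall>i<n. cmod (x i) \<le> 1 / Suc k)"
proof (rule acc_coord_family[of "\<lambda>_. S"])
  show "\<exists>x\<in>S. x \<noteq> 0 \<and> (\<forall>i<n. cmod (x i) \<le> 1 / Suc k)" for k
  proof -
    obtain x where x: "x \<in> S" "x \<noteq> 0" "\<And>i. i < n \<Longrightarrow> cmod (x i) < 1 / Suc k"
      using assms(2)[of "1 / Suc k"] by auto
    then show ?thesis by (intro bexI[of _ x] conjI allI impI less_imp_le)
  qed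
  show "\<And>j. j < n \<Longrightarrow> (\<And>k. \<exists>x\<in>S. x j \<noteq> 0 \<and> (\<forall>i<n. cmod (x i) \<le> 1 / Suc k)) \<Longrightarrow> thesis"
    using that by blast
qed (rule assms(1), rule subset_refl)

lemma ray_const:
  assumes N: "0 < N" and j: "j < n" and inv: "winv N S"
    and small: "\<And>k. \<exists>x\<in>S. x j \<noteq> 0 \<and> (\<forall>i<n. cmod (x i) \<le> 1 / Suc k)"
  obtains z where "z \<noteq> 0" "\<And>r. 0 < r \<Longrightarrow> single j (of_real r * z) \<in> S"
proof (rule ray[OF N j, of "\<lambda>_. S"])
  show "\<And>z. z \<noteq> 0 \<Longrightarrow> (\<And>r k. 0 < r \<Longrightarrow> single j (of_real r * z) \<in> S) \<Longrightarrow> thesis"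
    using that by blast
qed (rule inv, rule subset_refl, rule small)

text \<open>Among real vectors the direction of a ray is automatically a real multiple of
  \<open>e j\<close>, so \<open>ray_fills\<close> applies with \<open>e\<close> itself.\<close>

lemma real_acc_full:
  assumes "0 < N" "winv N S" "S \<subseteq> ER" "rper S"
    "\<And>\<epsilon>. 0 < \<epsilon> \<Longrightarrow> \<exists>x\<in>S. x \<noteq> 0 \<and> (\<forall>i<n. cmod (x i) < \<epsilon>)" "y \<in> ER"
  shows "y \<in> S"
proof -
  have "S \<subseteq> E" using assms(3) ER_E by blast
  then obtain j where j: "j < n" "\<And>k. \<exists>x\<in>S. x j \<noteq> 0 \<and> (\<forall>i<n. cmod (x i) \<le> 1 / Suc k)"
    using acc_coord[OF _ assms(5)] by metis
  obtain z where z: "z \<noteq> 0" "\<And>r. 0 < r \<Longrightarrow> single j (of_real r * z) \<in> S"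
    using ray_const[OF assms(1) j(1) assms(2) j(2)] by blast
  have "single j (of_real 1 * z) \<in> ER" using z(2)[of 1] assms(3) by auto
  then have "single j (of_real 1 * z) j \<in> \<real>" unfolding ER_def by blast
  then have zR: "z = of_real (Re z)" by (simp add: of_real_Re)
  then have Rz: "Re z \<noteq> 0" using z(1) by auto
  have "y * e \<in> S"
  proof (rule ray_fills[OF winv_sclosed[OF assms(2)] _ j(1), of e "1 / Re z" z])
    show "e j = of_real (1 / Re z) * z" using j(1) zR Rz
      by (metis e_nth nonzero_eq_divide_eq of_real_1 of_real_mult)
    show "x + e * a \<in> S" if "x \<in> S" "a \<in> LR" for x a
      using that assms(4) LR_L[OF that(2)] by (simp add: rper_def)
  qed (use z Rz assms in auto)
  then show ?thesis using ER_E[OF assms(6)] by simp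
qed

text \<open>Infinitely many multiples \<open>w * x\<close>, reduced to bounded size, must come close
  to each other. If two reductions coincided, a nonzero lattice element would carry \<open>x\<close>
  into \<open>L\<close> and \<open>x\<close> would be torsion.\<close>

lemma nontorsion_differences:
  assumes "0 < N" "x \<in> E" "x \<notin> tors" "0 < \<epsilon>" "L' \<subseteq> L"
    "\<And>w. w \<in> W N \<Longrightarrow> \<exists>a\<in>L'. \<forall>i<n. cmod ((w * x) i - a i) \<le> B"
  obtains v w a b where "v \<in> W N" "w \<in> W N" "a \<in> L'" "b \<in> L'" "v * x - a \<noteq> w * x - b"
    "\<And>i. i < n \<Longrightarrow> cmod ((v * x - a) i - (w * x - b) i) < \<epsilon>"
proof -
  obtain w where w: "\<And>k. w k \<in> W N" "\<And>k l. k < (l::nat) \<Longrightarrow> w k \<noteq> w l"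
    using W_seq[OF assms(1) n_pos] by metis
  have "\<exists>a. a \<in> L' \<and> (\<forall>i<n. cmod ((w k * x) i - a i) \<le> B)" for k using assms(6)[OF w(1)[of k]] by blast
  then obtain a where a: "\<And>k. a k \<in> L'" "\<And>k i. i < n \<Longrightarrow> cmod ((w k * x) i - a k i) \<le> B" by metis
  have "\<exists>k l. k < l \<and> (\<forall>i<n. cmod ((w k * x - a k) i - (w l * x - a l) i) < \<epsilon>)"
    by (rule two_close[where B = B]) (use a(2) assms in auto)
  then obtain k l where kl: "k < l" "\<And>i. i < n \<Longrightarrow> cmod ((w k * x - a k) i - (w l * x - a l) i) < \<epsilon>" by blast
  have "w k * x - a k \<noteq> w l * x - a l"
  proof
    assume *: "w k * x - a k = w l * x - a l"
    have "(w k - w l) * x = (w k * x - a k) - (w l * x - a l) + (a k - a l)" by (simp add: left_diff_distrib)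
    also have "\<dots> = a k - a l" using * by simp
    also have "\<dots> \<in> L" by (intro L_minus) (use a(1) assms(5) in auto)
    finally have "x \<in> tors"
      using w(2)[OF kl(1)] w(1) W_L by (intro tors_if_mult[OF assms(2), of "w k - w l"] L_minus) auto
    then show False using assms by simp
  qed
  then show ?thesis using that[OF w(1) w(1) a(1) a(1)] kl(2) by blast
qed

lemma rper_minus: "rper S \<Longrightarrow> x \<in> S \<Longrightarrow> a \<in> LR \<Longrightarrow> x - a \<in> S"
  using LR_uminus[of a] unfolding rper_def by (metis diff_conv_add_uminus)

text \<open>The set of differences inherits invariance and periodicity, and a nontorsion point makes
  it accumulate at 0, so \<open>real_acc_full\<close> applies to it.\<close>

lemma diff_set_full:
  assumes N: "0 < N" and inv: "winv N S" and sub: "S \<subseteq> ER" and per: "rper S" and x: "x \<in> S" "x \<notin> tors"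
    and r: "r \<in> ER"
  obtains u v where "u \<in> S" "v \<in> S" "r = u - v"
proof -
  define D where "D = {u - v |u v. u \<in> S \<and> v \<in> S}"
  have "r \<in> D"
  proof (rule real_acc_full[OF N _ _ _ _ r])
    show "D \<subseteq> ER" using sub by (auto simp: D_def intro: ER_diff)
    show "rper D"
      unfolding rper_def
    proof (intro ballI)
      fix d a assume "d \<in> D" "a \<in> LR"
      then obtain u v where uv: "u \<in> S" "v \<in> S" "d = u - v" by (auto simp: D_def)
      have "u + a \<in> S" using uv per \<open>a \<in> LR\<close> by (simp add: rper_def)
      moreover have "d + a = (u + a) - v" using uv by simp
      ultimately show "d + a \<in> D" using uv unfolding D_def by blast
    qed
    show "winv N D"
      unfolding winv_def sclosed_def
    proof (intro conjI ballI allI impI)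
      show "D \<subseteq> E" using sub ER_E by (auto simp: D_def)
    next
      fix w d assume "w \<in> W N" "d \<in> D"
      then obtain u v where uv: "u \<in> S" "v \<in> S" "d = u - v" by (auto simp: D_def)
      have "w * d = w * u - w * v" using uv by (simp add: right_diff_distrib)
      then show "w * d \<in> D" using winv_W[OF inv \<open>w \<in> W N\<close>] uv unfolding D_def by blast
    next
      fix f l assume f: "\<forall>k. f k \<in> D" and l: "l \<in> E" and lim: "\<forall>i<n. (\<lambda>k. f k i) \<longlonglongrightarrow> l i"
      \<comment> \<open>Closedness of the difference set needs bounded representations: subtracting
        one real lattice point from both members keeps the difference and bounds the second
        member.\<close>
      have "\<exists>u v. u \<in> S \<and> v \<in> S \<and> f k = u - v \<and> (\<forall>i<n. cmod (v i) \<le> 2 * R)" for k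
      proof -
        obtain u v where uv: "u \<in> S" "v \<in> S" "f k = u - v" using f[rule_format, of k] by (auto simp: D_def)
        obtain a where a: "a \<in> LR" "\<And>i. i < n \<Longrightarrow> cmod (v i - a i) \<le> 2 * R" using near_R uv sub by blast
        have "u - a \<in> S" "v - a \<in> S" using rper_minus per uv a by blast+
        moreover have "f k = (u - a) - (v - a)" using uv by simp
        ultimately show ?thesis using a(2) by (intro exI[of _ "u - a"] exI[of _ "v - a"]) simp
      qed
      then obtain u v where uv: "\<And>k. u k \<in> S" "\<And>k. v k \<in> S" "\<And>k. f k = u k - v k"
        "\<And>k i. i < n \<Longrightarrow> cmod (v k i) \<le> 2 * R" by metis
      obtain q y where q: "strict_mono q" "y \<in> E" "\<And>i. i < n \<Longrightarrow> (\<lambda>k. v (q k) i) \<longlonglongrightarrow> y i"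
        using bounded_subsequence[of v "2 * R"] uv(4) by blast
      have "y \<in> S" by (rule sclosedD[OF winv_sclosed[OF inv], of "\<lambda>k. v (q k)"]) (use uv q in auto)
      moreover have "l + y \<in> S"
      proof (rule sclosedD[OF winv_sclosed[OF inv], of "\<lambda>k. u (q k)"])
        fix i assume i: "i < n"
        have "((\<lambda>k. f k i) \<circ> q) \<longlonglongrightarrow> l i" using lim i q(1) by (intro LIMSEQ_subseq_LIMSEQ) auto
        then have "(\<lambda>k. f (q k) i + v (q k) i) \<longlonglongrightarrow> l i + y i"
          using q(3)[OF i] by (intro tendsto_add) (simp_all add: o_def)
        then show "(\<lambda>k. u (q k) i) \<longlonglongrightarrow> (l + y) i" by (simp add: uv(3))
      qed (use uv l q in auto)
      moreover have "l = (l + y) - y" by simp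
      ultimately show "l \<in> D" unfolding D_def by blast
    qed
    show "\<exists>d\<in>D. d \<noteq> 0 \<and> (\<forall>i<n. cmod (d i) < \<epsilon>)" if \<epsilon>: "0 < \<epsilon>" for \<epsilon>
    proof -
      have xR: "x \<in> ER" using x sub by blast
      have LRL: "LR \<subseteq> L" by (auto simp: LR_def)
      have nb: "\<exists>a\<in>LR. \<forall>i<n. cmod ((w * x) i - a i) \<le> 2 * R" if "w \<in> W N" for w
      proof -
        have "w * x \<in> ER" by (intro ER_mult xR LR_ER W_LR[OF that])
        then show ?thesis using near_R by blast
      qed
      obtain v w a b where vw: "v \<in> W N" "w \<in> W N" "a \<in> LR" "b \<in> LR" "v * x - a \<noteq> w * x - b"
        "\<And>i. i < n \<Longrightarrow> cmod ((v * x - a) i - (w * x - b) i) < \<epsilon>"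
        using nontorsion_differences[OF N ER_E[OF xR] x(2) \<epsilon> LRL nb] by metis
      have "v * x - a \<in> S" "w * x - b \<in> S" using vw winv_W[OF inv] x per rper_minus by blast+
      then have "(v * x - a) - (w * x - b) \<in> D" unfolding D_def by blast
      moreover have "(v * x - a) - (w * x - b) \<noteq> 0" using vw(5) by (metis eq_iff_diff_eq_0)
      moreover have "cmod (((v * x - a) - (w * x - b)) i) < \<epsilon>" if "i < n" for i
        using vw(6)[OF that] by simp
      ultimately show ?thesis by blast
    qed
  qed
  then show ?thesis using that by (auto simp: D_def)
qed

text \<open>Furstenberg's trick: if \<open>S\<close> has no torsion point, then \<open>S - S\<close> is everything, so the points of \<open>S\<close>
  that stay in \<open>S\<close> after translation by a torsion point form again a nonempty set of the same kind.\<close>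

lemma real_translates:
  assumes "set rs \<subseteq> tors \<inter> ER" "0 < N" "winv N S" "S \<subseteq> ER" "rper S" "S \<noteq> {}" "S \<inter> tors = {}"
  shows "\<exists>x\<in>S. \<forall>r\<in>set rs. x + r \<in> S"
  using assms
proof (induction rs arbitrary: N S)
  case Nil
  then show ?case by auto
next
  case (Cons r rs)
  note N = Cons.prems(2) and inv = Cons.prems(3) and sub = Cons.prems(4) and per = Cons.prems(5)
  have r: "r \<in> tors" "r \<in> ER" using Cons.prems(1) by auto
  obtain m where m: "0 < m" "of_nat m * r \<in> L" using r by (auto simp: tors_def)
  \<comment> \<open>Units of level \<open>N * m\<close> fix \<open>r\<close> modulo the lattice,
    which is why this set is invariant again, at the larger level.\<close>
  define S' where "S' = {y\<in>S. y + r \<in> S}"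
  obtain x where "x \<in> S" "x \<notin> tors" using Cons.prems(6,7) by auto
  then obtain u v where uv: "u \<in> S" "v \<in> S" "r = u - v"
    using diff_set_full[OF N inv sub per _ _ r(2)] by metis
  then have "v \<in> S'" by (simp add: S'_def)
  moreover have "winv (N * m) S'"
    unfolding winv_def sclosed_def
  proof (intro conjI ballI allI impI)
    show "S' \<subseteq> E" using sub ER_E by (auto simp: S'_def)
  next
    fix w y assume w: "w \<in> W (N * m)" and y: "y \<in> S'"
    have wN: "w \<in> W N" using W_sub[OF w] .
    have "w * r - r \<in> LR" using tors_fix[OF w m(2) ER_E[OF r(2)]] r(2) W_LR[OF w]
      by (auto simp: LR_def intro: ER_diff ER_mult)
    moreover have "w * (y + r) \<in> S" using y winv_W[OF inv wN] by (simp add: S'_def)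
    ultimately have "w * (y + r) - (w * r - r) \<in> S" using rper_minus[OF per] by blast
    moreover have "w * (y + r) - (w * r - r) = w * y + r" by (simp add: distrib_left)
    moreover have "w * y \<in> S" using y winv_W[OF inv wN] by (simp add: S'_def)
    ultimately show "w * y \<in> S'" by (simp add: S'_def)
  next
    fix f l assume f: "\<forall>k. f k \<in> S'" and l: "l \<in> E" and lim: "\<forall>i<n. (\<lambda>k. f k i) \<longlonglongrightarrow> l i"
    have "l \<in> S" by (rule sclosedD[OF winv_sclosed[OF inv], of f]) (use f l lim in \<open>auto simp: S'_def\<close>)
    moreover have "l + r \<in> S"
      by (rule sclosedD[OF winv_sclosed[OF inv], of "\<lambda>k. f k + r"])
        (use f l lim ER_E[OF r(2)] in \<open>auto simp: S'_def intro!: tendsto_add\<close>)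
    ultimately show "l \<in> S'" by (simp add: S'_def)
  qed
  moreover have "rper S'"
    unfolding rper_def
  proof (intro ballI)
    fix y a assume "y \<in> S'" "a \<in> LR"
    then have "y + a \<in> S" "(y + r) + a \<in> S" using per by (auto simp: S'_def rper_def)
    moreover have "(y + r) + a = y + a + r" by (simp add: add_ac)
    ultimately show "y + a \<in> S'" by (simp add: S'_def)
  qed
  moreover have "S' \<subseteq> ER" "S' \<inter> tors = {}" using sub Cons.prems(7) by (auto simp: S'_def)
  moreover have "set rs \<subseteq> tors \<inter> ER" "0 < N * m" using Cons.prems(1) N m by auto
  ultimately obtain x where x: "x \<in> S'" "\<forall>r\<in>set rs. x + r \<in> S'" using Cons.IH[of "N * m" S'] by blast
  then have "x \<in> S" "x + r \<in> S" "\<forall>r\<in>set rs. x + r \<in> S" by (simp_all add: S'_def)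
  then have "\<forall>r'\<in>set (r # rs). x + r' \<in> S" by (metis set_ConsD)
  then show ?case using \<open>x \<in> S\<close> by (rule bexI)
qed

text \<open>Without torsion points \<open>S\<close> would contain the translates of one
  \<open>x\<close> by a torsion net of mesh about \<open>1 / m\<close>. One of them is near a
  lattice point, so by periodicity and closedness 0 would lie in \<open>S\<close>.\<close>

lemma real_has_tors:
  assumes "0 < N" "winv N S" "S \<subseteq> ER" "rper S" "S \<noteq> {}"
  shows "\<exists>x\<in>S. x \<in> tors"
proof (rule ccontr)
  assume "\<not> ?thesis"
  then have irr: "S \<inter> tors = {}" by blast
  have "0 \<in> S"
  proof (rule sclosed_approx[OF winv_sclosed[OF assms(2)] E_0])
    fix \<epsilon> :: real assume \<epsilon>: "0 < \<epsilon>"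
    obtain m :: nat where "2 * R / \<epsilon> < m" using reals_Archimedean2 by blast
    then have m: "0 < m" "2 * R < \<epsilon> * m"
      using R_pos \<epsilon> by (auto simp: field_simps intro: Nat.gr0I)
    \<comment> \<open>The bound covers every lattice point \<open>b\<close> that can arise from
      rounding \<open>c\<close>, whose coordinates are at most \<open>m * (2 * R)\<close>.\<close>
    define F where "F = (\<lambda>b i. b i / of_nat m) ` {b\<in>L. \<forall>i<n. cmod (b i) \<le> m * (2 * R) + 2 * R} \<inter> ER"
    have "finite F" unfolding F_def by (intro finite_Int disjI1 finite_imageI finite_bounded_L)
    then obtain rs where rs: "set rs = F" using finite_list by blast
    have "F \<subseteq> tors"
    proof
      fix r assume "r \<in> F"
      then obtain b where b: "b \<in> L" "r = (\<lambda>i. b i / of_nat m)" "r \<in> ER" by (auto simp: F_def)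
      have "of_nat m * r = b" using m(1) b(2) by (intro ext) simp
      then show "r \<in> tors" using b m(1) ER_E unfolding tors_def by blast
    qed
    then have "set rs \<subseteq> tors \<inter> ER" using rs by (auto simp: F_def)
    from real_translates[OF this assms irr] obtain x where x: "x \<in> S" "\<And>r. r \<in> F \<Longrightarrow> x + r \<in> S"
      using rs by blast
    have xR: "x \<in> ER" using x assms by blast
    then obtain a where a: "a \<in> LR" "\<And>i. i < n \<Longrightarrow> cmod (x i - a i) \<le> 2 * R" using near_R by blast
    define c where "c = (\<lambda>i. of_nat m * (a i - x i))"
    have "c \<in> ER" using xR LR_ER[OF a(1)] by (simp add: c_def ER_def E_def)
    then obtain b where b: "b \<in> LR" "\<And>i. i < n \<Longrightarrow> cmod (c i - b i) \<le> 2 * R" using near_R by blast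
    define r where "r = (\<lambda>i. b i / of_nat m)"
    have "cmod (b i) \<le> m * (2 * R) + 2 * R" if "i < n" for i
    proof -
      have "cmod (c i) = m * cmod (x i - a i)" by (simp add: c_def norm_mult norm_minus_commute)
      also have "\<dots> \<le> m * (2 * R)" by (rule mult_left_mono[OF a(2)[OF that]]) simp
      finally show ?thesis using b(2)[OF that] norm_triangle_ineq2[of "b i" "c i"]
        by (simp add: norm_minus_commute)
    qed
    moreover have "r \<in> ER" using LR_ER[OF b(1)] by (simp add: r_def ER_def E_def)
    ultimately have "r \<in> F" unfolding F_def r_def using LR_L[OF b(1)] by blast
    then have "x + r - a \<in> S" using x(2) rper_minus[OF assms(4) _ a(1)] by blast
    moreover have "cmod ((x + r - a) i - 0 i) < \<epsilon>" if i: "i < n" for i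
    proof -
      have "(x + r - a) i = (b i - c i) / of_nat m" using m(1) by (simp add: r_def c_def field_simps)
      then have "cmod ((x + r - a) i) = cmod (c i - b i) / m" by (simp add: norm_divide norm_minus_commute)
      also have "\<dots> \<le> 2 * R / m" by (rule divide_right_mono[OF b(2)[OF i]]) simp
      also have "\<dots> < \<epsilon>" using m by (simp add: field_simps)
      finally show ?thesis by simp
    qed
    ultimately show "\<exists>x\<in>S. \<forall>i<n. cmod (x i - 0 i) < \<epsilon>"
      by (intro bexI[of _ "x + r - a"] allI impI)
  qed
  then show False using irr tors_L[OF L_0] by blast
qed

end

section \<open>Invariant sets of complex vectors\<close>

context cm_lattice
begin

lemma \<delta>_nth: "i < n \<Longrightarrow> \<delta> i \<noteq> 0" using L_nonzero[OF \<delta>_L] \<delta>_nz by blast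

lemma \<delta>_Im: "i < n \<Longrightarrow> Re (\<delta> i) = 0 \<and> Im (\<delta> i) \<noteq> 0"
  using \<delta>_nth[of i] \<delta>_cnj[of i] by (auto simp: complex_eq_iff)

lemma decompose: assumes "x \<in> E" obtains s t where "s \<in> ER" "t \<in> ER" "x = s + t * \<delta>"
proof -
  define s where "s = (\<lambda>i. complex_of_real (Re (x i)))"
  define t where "t = (\<lambda>i. complex_of_real (Im (x i) / Im (\<delta> i)))"
  have "s \<in> ER" "t \<in> ER" using assms by (auto simp: s_def t_def ER_def E_def)
  moreover have "x = s + t * \<delta>"
  proof (rule E_eqI)
    fix i assume "i < n"
    then show "x i = (s + t * \<delta>) i" using \<delta>_Im[of i] by (simp add: s_def t_def complex_eq_iff)
  qed (use assms \<delta>_L calculation ER_E in auto)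
  ultimately show ?thesis using that by blast
qed

text \<open>Units of level \<open>N * m\<close> move \<open>p\<close> only by lattice vectors, which
  periodicity removes; taking \<open>p\<close> as origin thus costs the factor
  \<open>m\<close>.\<close>

lemma winv_translate:
  assumes "winv N S" "lper S" "p \<in> E" "of_nat m * p \<in> L"
  shows "winv (N * m) {x\<in>E. p + x \<in> S}"
  unfolding winv_def sclosed_def
proof (intro conjI ballI allI impI)
  show "{x\<in>E. p + x \<in> S} \<subseteq> E" by blast
next
  fix w y assume w: "w \<in> W (N * m)" and y: "y \<in> {x\<in>E. p + x \<in> S}"
  have "w * (p + y) \<in> S" using winv_W[OF assms(1) W_sub[OF w]] y by simp
  moreover have "- (w * p - p) \<in> L" by (rule L_uminus[OF tors_fix[OF w assms(4,3)]])
  ultimately have "w * (p + y) + - (w * p - p) \<in> S" using assms(2) unfolding lper_def by blast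
  moreover have "w * (p + y) + - (w * p - p) = p + w * y" by (simp add: distrib_left)
  moreover have "w * y \<in> E" using y by blast
  ultimately show "w * y \<in> {x\<in>E. p + x \<in> S}" by (metis (mono_tags, lifting) mem_Collect_eq)
next
  fix f l assume f: "\<forall>k. f k \<in> {x\<in>E. p + x \<in> S}" and l: "l \<in> E" and lim: "\<forall>i<n. (\<lambda>k. f k i) \<longlonglongrightarrow> l i"
  have "p + l \<in> S"
    by (rule sclosedD[OF winv_sclosed[OF assms(1)], of "\<lambda>k. p + f k"])
      (use f l lim assms(3) in \<open>auto intro!: tendsto_add\<close>)
  then show "l \<in> {x\<in>E. p + x \<in> S}" using l by simp
qed

lemma has_tors:
  assumes N: "0 < N" and inv: "winv N S" and per: "lper S" and ne: "S \<noteq> {}"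
  obtains p where "p \<in> S" "p \<in> tors"
proof -
  have SE: "x \<in> S \<Longrightarrow> x \<in> E" for x using sclosed_E winv_sclosed[OF inv] by blast
  \<comment> \<open>The projection of \<open>S\<close> to the coefficient of
    \<open>\<delta>\<close>. It is closed because the other coefficient can be reduced modulo real
    lattice points, and periodic because \<open>L\<close> contains the products
    \<open>a * \<delta>\<close>.\<close>
  define P where "P = {t\<in>ER. \<exists>s\<in>ER. s + t * \<delta> \<in> S}"
  have "winv N P"
    unfolding winv_def sclosed_def
  proof (intro conjI ballI allI impI)
    show "P \<subseteq> E" using ER_E by (auto simp: P_def)
  next
    fix w t assume w: "w \<in> W N" and "t \<in> P"
    then obtain s where s: "t \<in> ER" "s \<in> ER" "s + t * \<delta> \<in> S" by (auto simp: P_def)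
    have "w * (s + t * \<delta>) \<in> S" by (rule winv_W[OF inv w s(3)])
    moreover have "w * (s + t * \<delta>) = w * s + (w * t) * \<delta>" by (simp only: distrib_left mult.assoc)
    moreover have "w * s \<in> ER" "w * t \<in> ER" using s LR_ER[OF W_LR[OF w]] by (auto intro: ER_mult)
    ultimately show "w * t \<in> P" unfolding P_def by (metis (mono_tags, lifting) mem_Collect_eq)
  next
    fix f l assume f: "\<forall>k. f k \<in> P" and l: "l \<in> E" and lim: "\<forall>i<n. (\<lambda>k. f k i) \<longlonglongrightarrow> l i"
    have "\<exists>s. s \<in> ER \<and> s + f k * \<delta> \<in> S \<and> (\<forall>i<n. cmod (s i) \<le> 2 * R)" for k
    proof -
      obtain s where s: "s \<in> ER" "s + f k * \<delta> \<in> S" using f[rule_format, of k] by (auto simp: P_def)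
      obtain a where a: "a \<in> LR" "\<And>i. i < n \<Longrightarrow> cmod (s i - a i) \<le> 2 * R" using near_R[OF s(1)] by blast
      have 1: "(s + f k * \<delta>) + - a \<in> S" using per s(2) L_uminus[OF LR_L[OF a(1)]] unfolding lper_def by blast
      have 2: "(s + f k * \<delta>) + - a = (s - a) + f k * \<delta>" by simp
      have "(s - a) + f k * \<delta> \<in> S" using 1 unfolding 2 .
      moreover have "s - a \<in> ER" by (intro ER_diff s LR_ER a)
      ultimately show ?thesis using a(2) by (intro exI[of _ "s - a"]) auto
    qed
    then obtain s where s: "\<And>k. s k \<in> ER" "\<And>k. s k + f k * \<delta> \<in> S" "\<And>k i. i < n \<Longrightarrow> cmod (s k i) \<le> 2 * R"
      by metis
    obtain q y where q: "strict_mono q" "y \<in> E" "\<And>i. i < n \<Longrightarrow> (\<lambda>k. s (q k) i) \<longlonglongrightarrow> y i"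
      using bounded_subsequence[of s "2 * R"] s(3) by blast
    have "y \<in> ER" by (rule sclosedD[OF sclosed_ER, of "\<lambda>k. s (q k)"]) (use s q in auto)
    moreover have "y + l * \<delta> \<in> S"
    proof (rule sclosedD[OF winv_sclosed[OF inv], of "\<lambda>k. s (q k) + f (q k) * \<delta>"])
      fix i assume i: "i < n"
      have "((\<lambda>k. f k i) \<circ> q) \<longlonglongrightarrow> l i" using lim i q(1) by (intro LIMSEQ_subseq_LIMSEQ) auto
      then show "(\<lambda>k. (s (q k) + f (q k) * \<delta>) i) \<longlonglongrightarrow> (y + l * \<delta>) i"
        using q(3)[OF i] by (auto simp: o_def intro!: tendsto_add tendsto_mult)
    qed (use s q l in auto)
    moreover have "l \<in> ER" by (rule sclosedD[OF sclosed_ER, of f]) (use f l lim in \<open>auto simp: P_def\<close>)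
    ultimately show "l \<in> P" unfolding P_def by blast
  qed
  moreover have "P \<subseteq> ER" by (auto simp: P_def)
  moreover have "rper P"
    unfolding rper_def
  proof (intro ballI)
    fix t a assume "t \<in> P" and a: "a \<in> LR"
    then obtain s where s: "t \<in> ER" "s \<in> ER" "s + t * \<delta> \<in> S" by (auto simp: P_def)
    have "(s + t * \<delta>) + a * \<delta> \<in> S"
      using per s(3) L_mult[OF LR_L[OF a] \<delta>_L] unfolding lper_def by blast
    moreover have "(s + t * \<delta>) + a * \<delta> = s + (t + a) * \<delta>" by (simp only: distrib_right add.assoc)
    moreover have "t + a \<in> ER" by (intro ER_add s LR_ER a)
    ultimately show "t + a \<in> P" using s(2) unfolding P_def by (metis (mono_tags, lifting) mem_Collect_eq)
  qed
  moreover have "P \<noteq> {}"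
  proof -
    obtain x where x: "x \<in> S" using ne by blast
    then obtain s t where "s \<in> ER" "t \<in> ER" "x = s + t * \<delta>" using decompose[OF SE[OF x]] by blast
    then have "t \<in> P" using x by (auto simp: P_def)
    then show ?thesis by blast
  qed
  ultimately obtain t where t: "t \<in> P" "t \<in> tors" using real_has_tors[OF N] by blast
  obtain m where m: "0 < m" "of_nat m * t \<in> L" using t by (auto simp: tors_def)
  have tE: "t * \<delta> \<in> E" using \<delta>_L by simp
  have "of_nat m * (t * \<delta>) \<in> L" using L_mult[OF m(2) \<delta>_L] by (simp only: mult.assoc)
  then have inv2: "winv (N * m) {x\<in>E. t * \<delta> + x \<in> S}" by (rule winv_translate[OF inv per tE])
  \<comment> \<open>The fibre of the projection over the torsion coefficient \<open>t\<close>; a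
    torsion point of the fibre completes one of \<open>S\<close>.\<close>
  define P2 where "P2 = {x\<in>E. t * \<delta> + x \<in> S} \<inter> ER"
  have "winv (N * m) P2"
    unfolding winv_def sclosed_def
  proof (intro conjI ballI allI impI)
    show "P2 \<subseteq> E" by (auto simp: P2_def)
    show "w * x \<in> P2" if "w \<in> W (N * m)" "x \<in> P2" for w x
      using winv_W[OF inv2 that(1)] that(2) ER_mult[OF LR_ER[OF W_LR[OF that(1)]]] unfolding P2_def by blast
    fix f l assume *: "\<forall>k. f k \<in> P2" "l \<in> E" "\<forall>i<n. (\<lambda>k. f k i) \<longlonglongrightarrow> l i"
    have 1: "f k \<in> {x\<in>E. t * \<delta> + x \<in> S}" "f k \<in> ER" for k using *(1) by (auto simp: P2_def)
    have "l \<in> {x\<in>E. t * \<delta> + x \<in> S}" by (rule sclosedD[OF winv_sclosed[OF inv2] 1(1) *(2)]) (use * in auto)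
    moreover have "l \<in> ER" by (rule sclosedD[OF sclosed_ER 1(2) *(2)]) (use * in auto)
    ultimately show "l \<in> P2" unfolding P2_def by blast
  qed
  moreover have "rper P2"
    unfolding rper_def
  proof (intro ballI)
    fix x a assume "x \<in> P2" and a: "a \<in> LR"
    then have x: "x \<in> E" "t * \<delta> + x \<in> S" "x \<in> ER" by (auto simp: P2_def)
    have "(t * \<delta> + x) + a \<in> S" using per x(2) LR_L[OF a] unfolding lper_def by blast
    then have "t * \<delta> + (x + a) \<in> S" by (simp only: add.assoc)
    moreover have "x + a \<in> ER" by (intro ER_add x LR_ER a)
    ultimately show "x + a \<in> P2" unfolding P2_def using ER_E by blast
  qed
  moreover have "P2 \<noteq> {}"
  proof -
    obtain s where s: "s \<in> ER" "s + t * \<delta> \<in> S" using t by (auto simp: P_def)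
    then have "s \<in> P2" using ER_E by (auto simp: P2_def add.commute)
    then show ?thesis by blast
  qed
  moreover have "P2 \<subseteq> ER" "0 < N * m" using N m by (auto simp: P2_def)
  ultimately obtain s where s: "s \<in> P2" "s \<in> tors" using real_has_tors[of "N * m" P2] by blast
  have "t * \<delta> \<in> tors" using tors_mult[OF \<delta>_L t(2)] by (simp only: mult.commute)
  then have "t * \<delta> + s \<in> tors" using tors_add s by blast
  moreover have "t * \<delta> + s \<in> S" using s by (simp add: P2_def)
  ultimately show ?thesis using that by blast
qed

lemma lper_minus: "lper S \<Longrightarrow> x \<in> S \<Longrightarrow> a \<in> L \<Longrightarrow> x - a \<in> S"
  using L_uminus[of a] unfolding lper_def by (metis diff_conv_add_uminus)

text \<open>The multiples of the vector, each reduced by a nearby lattice point, stay bounded; two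
  close ones differ by a multiple that is almost in \<open>L\<close>.\<close>

lemma line_recurrence:
  assumes j: "j < n" and z: "0 < \<epsilon>"
  obtains m a where "0 < m" "a \<in> L" "\<And>i. i < n \<Longrightarrow> cmod (single j (of_nat m * of_real \<tau> * z) i - a i) < \<epsilon>"
proof -
  define x where "x k = single j (of_nat k * of_real \<tau> * z)" for k :: nat
  have "\<exists>a. a \<in> L \<and> (\<forall>i<n. cmod (x k i - a i) \<le> R)" for k
    using near[of "x k"] j unfolding x_def by (metis single_E)
  then obtain a where a: "\<And>k. a k \<in> L" "\<And>k i. i < n \<Longrightarrow> cmod (x k i - a k i) \<le> R" by metis
  have "\<exists>k l. k < l \<and> (\<forall>i<n. cmod ((x k - a k) i - (x l - a l) i) < \<epsilon>)"
    by (rule two_close[where B = R]) (use a(2) z in auto)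
  then obtain k l where kl: "k < l" "\<And>i. i < n \<Longrightarrow> cmod ((x k - a k) i - (x l - a l) i) < \<epsilon>" by blast
  have "x l i - x k i = single j (of_nat (l - k) * of_real \<tau> * z) i" for i
    using kl(1) by (simp add: x_def single_def of_nat_diff algebra_simps)
  then have "single j (of_nat (l - k) * of_real \<tau> * z) i - (a l - a k) i = - ((x k - a k) i - (x l - a l) i)" for i
    by (simp add: algebra_simps)
  then have "cmod (single j (of_nat (l - k) * of_real \<tau> * z) i - (a l - a k) i) < \<epsilon>" if "i < n" for i
    using kl(2)[OF that] by (metis norm_minus_cancel)
  moreover have "a l - a k \<in> L" by (intro L_minus a)
  moreover have "0 < l - k" using kl by simp
  ultimately show ?thesis using that by blast
qed

text \<open>A suitable positive multiple is almost a lattice vector, so the half line returns close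
  to its own backward continuation. The step \<open>\<bar>r\<bar> + 1\<close> keeps the shifted
  parameter positive.\<close>

lemma line_of_ray:
  assumes S: "sclosed S" and per: "lper S" and j: "j < n" and rays: "\<And>r. 0 < r \<Longrightarrow> single j (of_real r * z) \<in> S"
  shows "single j (of_real r * z) \<in> S"
proof (rule sclosed_approx[OF S single_E[OF j]])
  fix \<epsilon> :: real assume \<epsilon>: "0 < \<epsilon>"
  define \<tau> where "\<tau> = \<bar>r\<bar> + 1"
  obtain m a where m: "0 < m" "a \<in> L" "\<And>i. i < n \<Longrightarrow> cmod (single j (of_nat m * of_real \<tau> * z) i - a i) < \<epsilon>"
    using line_recurrence[OF j \<epsilon>] by blast
  have "1 * \<tau> \<le> real m * \<tau>" by (rule mult_right_mono) (use m in \<open>auto simp: \<tau>_def\<close>)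
  then have "0 < real m * \<tau> + r" by (auto simp: \<tau>_def)
  then have mem: "single j (of_real (real m * \<tau> + r) * z) - a \<in> S" by (intro lper_minus[OF per] rays m)
  have eq: "(single j (of_real (real m * \<tau> + r) * z) - a) i - single j (of_real r * z) i
      = single j (of_nat m * of_real \<tau> * z) i - a i" for i
    by (simp add: single_def algebra_simps)
  show "\<exists>x\<in>S. \<forall>i<n. cmod (x i - single j (of_real r * z) i) < \<epsilon>"
    by (rule bexI[OF _ mem]) (use m(3) in \<open>simp only: eq, simp\<close>)
qed

text \<open>The closure of the real line through \<open>z\<close> at place \<open>j\<close> plus
  \<open>L\<close>: a closed subgroup.\<close>

definition lineclosure :: "nat \<Rightarrow> complex \<Rightarrow> (nat \<Rightarrow> complex) set" where
  "lineclosure j z = {x\<in>E. \<forall>\<epsilon>>0. \<exists>t::real. \<exists>a\<in>L. \<forall>i<n. cmod (x i - single j (of_real t * z) i - a i) < \<epsilon>}"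

lemma lineclosure_gen: assumes "j < n" "a \<in> L" shows "single j (of_real t * z) + a \<in> lineclosure j z"
proof -
  have "\<forall>i<n. cmod ((single j (of_real t * z) + a) i - single j (of_real t * z) i - a i) < \<epsilon>" if "0 < \<epsilon>" for \<epsilon> :: real
    using that by simp
  moreover have "single j (of_real t * z) + a \<in> E" using assms by auto
  ultimately show ?thesis unfolding lineclosure_def using assms(2) by blast
qed

lemma lineclosure_diff:
  assumes "x \<in> lineclosure j z" "y \<in> lineclosure j z"
  shows "x - y \<in> lineclosure j z"
proof -
  have "\<exists>t::real. \<exists>a\<in>L. \<forall>i<n. cmod ((x - y) i - single j (of_real t * z) i - a i) < \<epsilon>" if "0 < \<epsilon>" for \<epsilon>
  proof -
    have e2: "0 < \<epsilon> / 2" using that by simp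
    obtain s a where a: "a \<in> L" "\<And>i. i < n \<Longrightarrow> cmod (x i - single j (of_real s * z) i - a i) < \<epsilon> / 2"
      using assms(1) e2 unfolding lineclosure_def by blast
    obtain t b where b: "b \<in> L" "\<And>i. i < n \<Longrightarrow> cmod (y i - single j (of_real t * z) i - b i) < \<epsilon> / 2"
      using assms(2) e2 unfolding lineclosure_def by blast
    have "cmod ((x - y) i - single j (of_real (s - t) * z) i - (a - b) i) < \<epsilon>" if "i < n" for i
    proof -
      have eq: "(x - y) i - single j (of_real (s - t) * z) i - (a - b) i
        = (x i - single j (of_real s * z) i - a i) - (y i - single j (of_real t * z) i - b i)"
        by (simp add: single_def algebra_simps)
      show ?thesis
        unfolding eq using a(2)[OF that] b(2)[OF that]
          norm_triangle_ineq4[of "x i - single j (of_real s * z) i - a i" "y i - single j (of_real t * z) i - b i"]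
        by linarith
    qed
    then show ?thesis using L_minus[OF a(1) b(1)] by blast
  qed
  moreover have "x - y \<in> E" using assms by (auto simp: lineclosure_def)
  ultimately show ?thesis by (simp add: lineclosure_def)
qed

lemma lineclosure_sclosed: "sclosed (lineclosure j z)"
  unfolding sclosed_def
proof (intro conjI allI impI)
  show "lineclosure j z \<subseteq> E" by (auto simp: lineclosure_def)
  fix f l assume f: "\<forall>k. f k \<in> lineclosure j z" and l: "l \<in> E" and lim: "\<forall>i<n. (\<lambda>k. f k i) \<longlonglongrightarrow> l i"
  have "\<exists>t::real. \<exists>a\<in>L. \<forall>i<n. cmod (l i - single j (of_real t * z) i - a i) < \<epsilon>" if "0 < \<epsilon>" for \<epsilon>
  proof -
    have e2: "0 < \<epsilon> / 2" using that by simp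
    have "\<forall>\<^sub>F k in sequentially. \<forall>i<n. cmod (f k i - l i) < \<epsilon> / 2" by (rule eventually_close) (use lim e2 in auto)
    then obtain k where k: "\<And>i. i < n \<Longrightarrow> cmod (f k i - l i) < \<epsilon> / 2" by (auto simp: eventually_sequentially)
    have "f k \<in> lineclosure j z" using f by blast
    then obtain t a where a: "a \<in> L" "\<And>i. i < n \<Longrightarrow> cmod (f k i - single j (of_real t * z) i - a i) < \<epsilon> / 2"
      using e2 unfolding lineclosure_def by blast
    have "cmod (l i - single j (of_real t * z) i - a i) < \<epsilon>" if "i < n" for i
      using k[OF that] a(2)[OF that] norm_triangle_ineq4[of "f k i - single j (of_real t * z) i - a i" "f k i - l i"]
      by (simp add: algebra_simps)
    then show ?thesis using a(1) by blast
  qed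
  then show "l \<in> lineclosure j z" using l by (simp add: lineclosure_def)
qed

text \<open>The units are real at \<open>j\<close>, so they only change the parameter of the
  line.\<close>

lemma lineclosure_winv: assumes "j < n" shows "winv N (lineclosure j z)"
  unfolding winv_def
proof (intro conjI ballI lineclosure_sclosed)
  fix w x assume w: "w \<in> W N" and x: "x \<in> lineclosure j z"
  have "\<exists>t::real. \<exists>a\<in>L. \<forall>i<n. cmod ((w * x) i - single j (of_real t * z) i - a i) < \<epsilon>" if "0 < \<epsilon>" for \<epsilon>
  proof -
    obtain A where A: "0 < A" "\<And>i. i < n \<Longrightarrow> cmod (w i) \<le> A" using E_bounded by blast
    have "0 < \<epsilon> / A" using that A by simp
    then obtain t a where a: "a \<in> L" "\<And>i. i < n \<Longrightarrow> cmod (x i - single j (of_real t * z) i - a i) < \<epsilon> / A"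
      using x unfolding lineclosure_def by blast
    have "cmod ((w * x) i - single j (of_real (Re (w j) * t) * z) i - (w * a) i) < \<epsilon>" if i: "i < n" for i
    proof -
      have "(w * x) i - single j (of_real (Re (w j) * t) * z) i - (w * a) i
        = w i * (x i - single j (of_real t * z) i - a i)"
        using W_Re[OF w assms] by (auto simp: single_def algebra_simps)
      then have "cmod ((w * x) i - single j (of_real (Re (w j) * t) * z) i - (w * a) i)
         = cmod (w i) * cmod (x i - single j (of_real t * z) i - a i)" by (simp only: norm_mult)
      also have "\<dots> \<le> A * cmod (x i - single j (of_real t * z) i - a i)"
        by (rule mult_right_mono[OF A(2)[OF i]]) simp
      also have "\<dots> < A * (\<epsilon> / A)" by (rule mult_strict_left_mono[OF a(2)[OF i] A(1)])
      also have "\<dots> = \<epsilon>" using A(1) by simp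
      finally show ?thesis .
    qed
    then show ?thesis using L_mult[OF W_L[OF w] a(1)] by blast
  qed
  moreover have "w * x \<in> E" using x by (auto simp: lineclosure_def)
  ultimately show "w * x \<in> lineclosure j z" by (simp add: lineclosure_def)
qed

lemma lineclosure_sub:
  assumes S: "sclosed S" and per: "lper S" and line: "\<And>r. single j (of_real r * z) \<in> S"
  shows "lineclosure j z \<subseteq> S"
proof
  fix x assume x: "x \<in> lineclosure j z"
  show "x \<in> S"
  proof (rule sclosed_approx[OF S])
    show "x \<in> E" using x by (simp add: lineclosure_def)
    fix \<epsilon> :: real assume "0 < \<epsilon>"
    then obtain t a where a: "a \<in> L" "\<And>i. i < n \<Longrightarrow> cmod (x i - single j (of_real t * z) i - a i) < \<epsilon>"
      using x unfolding lineclosure_def by blast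
    have "single j (of_real t * z) + a \<in> S" using per line a(1) unfolding lper_def by blast
    moreover have "cmod ((single j (of_real t * z) + a) i - x i) < \<epsilon>" if "i < n" for i
      using a(2)[OF that] by (metis diff_diff_eq norm_minus_commute plus_fun_apply)
    ultimately show "\<exists>y\<in>S. \<forall>i<n. cmod (y i - x i) < \<epsilon>"
      by (intro bexI[of _ "single j (of_real t * z) + a"] allI impI)
  qed
qed

text \<open>A short vector \<open>t z e\<^sub>j - a\<close> of the line modulo \<open>L\<close> has, by irrationality, a nonzero component
  orthogonal to \<open>z\<close> at place \<open>j\<close>; expanding it by units gives a second real line at that place, hence
  the whole complex place, which is dense modulo \<open>L\<close>.\<close>

lemma lineclosure_full:
  assumes j: "j < n" and z: "z \<noteq> 0" and irr: "\<And>a. a \<in> L \<Longrightarrow> a \<noteq> 0 \<Longrightarrow> a j / z \<notin> \<real>" and y: "y \<in> E"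
  shows "y \<in> lineclosure j z"
proof -
  \<comment> \<open>The points orthogonal to \<open>z\<close> at \<open>j\<close>. Real factors
    preserve orthogonality, so this set is invariant and the ray argument applies inside it.\<close>
  define H where "H = lineclosure j z \<inter> {x. Re (x j / z) = 0}"
  have "winv 1 H"
    unfolding winv_def sclosed_def
  proof (intro conjI ballI allI impI)
    show "H \<subseteq> E" by (auto simp: H_def lineclosure_def)
  next
    fix w x assume w: "w \<in> W 1" and x: "x \<in> H"
    have "w * x \<in> lineclosure j z" using winv_W[OF lineclosure_winv[OF j] w] x by (simp add: H_def)
    moreover have "Re ((w * x) j / z) = 0"
    proof -
      have "(w * x) j / z = of_real (Re (w j)) * (x j / z)" using W_Re[OF w j] by simp
      then have "Re ((w * x) j / z) = Re (w j) * Re (x j / z)" by (metis Re_complex_of_real Im_complex_of_real diff_zero mult_zero_left times_complex.sel(1))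
      then show ?thesis using x by (simp add: H_def)
    qed
    ultimately show "w * x \<in> H" by (simp add: H_def)
  next
    fix f l assume f: "\<forall>k. f k \<in> H" and l: "l \<in> E" and lim: "\<forall>i<n. (\<lambda>k. f k i) \<longlonglongrightarrow> l i"
    have "l \<in> lineclosure j z"
      by (rule sclosedD[OF lineclosure_sclosed, of f]) (use f l lim in \<open>auto simp: H_def\<close>)
    moreover have "(\<lambda>k. Re (f k j / z)) \<longlonglongrightarrow> Re (l j / z)"
      using lim j z by (intro tendsto_Re tendsto_divide tendsto_const) auto
    then have "Re (l j / z) = 0" using f by (simp add: H_def LIMSEQ_const_iff)
    ultimately show "l \<in> H" by (simp add: H_def)
  qed
  moreover have "\<exists>x\<in>H. x j \<noteq> 0 \<and> (\<forall>i<n. cmod (x i) \<le> 1 / Suc k)" for k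
  proof -
    \<comment> \<open>The bound by \<open>cmod z\<close> excludes \<open>a = 0\<close>, since a
      positive integer multiple of \<open>z\<close> is at least that large.\<close>
    define \<epsilon> where "\<epsilon> = min (1 / real (Suc k)) (cmod z)"
    have \<epsilon>: "0 < \<epsilon>" "\<epsilon> \<le> 1 / real (Suc k)" "\<epsilon> \<le> cmod z" using z by (auto simp: \<epsilon>_def)
    obtain m a where m: "0 < m" "a \<in> L" "\<And>i. i < n \<Longrightarrow> cmod (single j (of_nat m * of_real 1 * z) i - a i) < \<epsilon>"
      using line_recurrence[OF j \<epsilon>(1)] by blast
    have a0: "a \<noteq> 0"
    proof
      assume "a = 0"
      then have "cmod (of_nat m * z) < cmod z" using m(3)[OF j] \<epsilon>(3) by simp
      then have "real m * cmod z < 1 * cmod z" by (simp add: norm_mult)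
      then show False using m(1) z by (simp add: mult_less_cancel_right)
    qed
    define \<mu> where "\<mu> = Re (a j / z)"
    define x where "x = single j (of_real \<mu> * z) - a"
    have "single j (of_real \<mu> * z) + - a \<in> lineclosure j z" by (rule lineclosure_gen[OF j L_uminus[OF m(2)]])
    then have "x \<in> lineclosure j z" by (simp add: x_def)
    moreover have xj: "x j / z = of_real \<mu> - a j / z" using z by (simp add: x_def diff_divide_distrib)
    then have "Re (x j / z) = 0" by (simp add: \<mu>_def)
    ultimately have "x \<in> H" by (simp add: H_def)
    moreover have "x j \<noteq> 0"
    proof
      assume "x j = 0"
      then have "a j / z = of_real \<mu>" using xj by simp
      then show False using irr[OF m(2) a0] by simp
    qed
    moreover have "cmod (x i) \<le> 1 / Suc k" if i: "i < n" for i
    proof (cases "i = j")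
      case True
      have "cmod (x j) = cmod (x j / z) * cmod z" using z by (simp add: norm_divide)
      also have "cmod (x j / z) = \<bar>Im (x j / z)\<bar>" using \<open>Re (x j / z) = 0\<close> by (simp add: cmod_def)
      also have "Im (x j / z) = Im ((of_nat m * z - a j) / z)" unfolding xj using z by (simp add: diff_divide_distrib)
      also have "\<bar>Im ((of_nat m * z - a j) / z)\<bar> \<le> cmod ((of_nat m * z - a j) / z)" by (rule abs_Im_le_cmod)
      finally have "cmod (x j) \<le> cmod (of_nat m * z - a j)" using z by (simp add: norm_divide mult_right_mono)
      then show ?thesis using m(3)[OF j] \<epsilon>(2) True by simp
    next
      case False
      then show ?thesis using m(3)[OF i] \<epsilon>(2) by (simp add: x_def)
    qed
    ultimately show ?thesis by blast
  qed
  ultimately obtain z' where z': "z' \<noteq> 0" "\<And>r. 0 < r \<Longrightarrow> single j (of_real r * z') \<in> H"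
    using ray_const[OF zero_less_one_class.zero_less_one j, of H] by blast
  have Rz': "Re (z' / z) = 0"
    using z'(2)[of 1] by (simp add: H_def)
  have Iz': "Im (z' / z) \<noteq> 0" using Rz' z'(1) z by (metis complex_eq_iff divide_eq_0_iff zero_complex.sel)
  have line': "single j (of_real r * z') \<in> lineclosure j z" for r
  proof -
    consider "0 < r" | "r = 0" | "r < 0" by linarith
    then show ?thesis
    proof cases
      case 1
      then show ?thesis using z'(2) by (simp add: H_def)
    next
      case 2
      have "single j (of_real 0 * z) + 0 \<in> lineclosure j z" by (rule lineclosure_gen[OF j L_0])
      then show ?thesis using 2 by simp
    next
      case 3
      have "single j (of_real 0 * z) + 0 \<in> lineclosure j z" by (rule lineclosure_gen[OF j L_0])
      moreover have "single j (of_real (- r) * z') \<in> lineclosure j z" using z'(2)[of "- r"] 3 by (simp add: H_def)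
      ultimately have "(single j (of_real 0 * z) + 0) - single j (of_real (- r) * z') \<in> lineclosure j z"
        by (rule lineclosure_diff)
      moreover have "(single j (of_real 0 * z) + 0) - single j (of_real (- r) * z') = single j (of_real r * z')"
        by (rule ext) (simp add: single_def)
      ultimately show ?thesis by (simp only:)
    qed
  qed
  have plane: "single j q + a \<in> lineclosure j z" if "a \<in> L" for q a
  proof -
    define s where "s = Im (q / z) / Im (z' / z)"
    define t where "t = Re (q / z)"
    have "c = of_real (Re c) + of_real (Im c / Im v) * v" if "Re v = 0" "Im v \<noteq> 0" for c v :: complex
      using that by (simp add: complex_eq_iff)
    from this[OF Rz' Iz', of "q / z"] have "q / z = of_real t + of_real s * (z' / z)"
      unfolding s_def t_def .
    then have q: "q = of_real t * z - of_real (- s) * z'" using z by (simp add: field_simps)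
    have "(single j (of_real t * z) + a) - single j (of_real (- s) * z') \<in> lineclosure j z"
      by (intro lineclosure_diff lineclosure_gen j that line')
    moreover have "(single j (of_real t * z) + a) - single j (of_real (- s) * z') = single j q + a"
      by (rule ext) (simp add: single_def q)
    ultimately show ?thesis by (simp only:)
  qed
  show ?thesis
  proof (rule sclosed_approx[OF lineclosure_sclosed y])
    fix \<epsilon> :: real assume \<epsilon>: "0 < \<epsilon>"
    obtain w where w: "w \<in> W 1" "\<And>i. i < n \<Longrightarrow> i \<noteq> j \<Longrightarrow> Re (w i) \<le> \<epsilon> / (2 * R)"
      using W_contract[of 1 j "\<epsilon> / (2 * R)"] j \<epsilon> R_pos by auto
    obtain u where u: "u \<in> W 1" "w * u = e" using W_inverse[OF w(1)] by blast
    have wu: "w i * u i = 1" if "i < n" for i using u(2) e_nth[OF that] by (metis times_fun_apply)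
    have "y * u \<in> E" using y by simp
    then obtain a where a: "a \<in> L" "\<And>i. i < n \<Longrightarrow> cmod ((y * u) i - a i) \<le> R" using near by blast
    \<comment> \<open>Away from \<open>j\<close> the lattice vector \<open>w * a\<close>
      approximates \<open>y\<close>; at \<open>j\<close> the whole complex plane is available and
      the coordinate is corrected exactly.\<close>
    define g where "g = single j (y j - w j * a j) + w * a"
    have "g \<in> lineclosure j z" unfolding g_def by (intro plane L_mult W_L[OF w(1)] a)
    moreover have "cmod (g i - y i) < \<epsilon>" if i: "i < n" for i
    proof (cases "i = j")
      case True
      then show ?thesis using \<epsilon> by (simp add: g_def)
    next
      case False
      have "w i * (y i * u i - a i) = (w i * u i) * y i - w i * a i" by (simp add: algebra_simps)
      then have "g i - y i = - (w i * (y i * u i - a i))" using wu[OF i] False by (simp add: g_def)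
      then have "cmod (g i - y i) = Re (w i) * cmod (y i * u i - a i)"
        by (simp add: norm_mult W_cmod[OF w(1) i])
      also have "\<dots> \<le> \<epsilon> / (2 * R) * R"
        using w(2)[OF i False] a(2)[OF i] \<epsilon> R_pos by (intro mult_mono) auto
      also have "\<dots> < \<epsilon>" using \<epsilon> R_pos by simp
      finally show ?thesis .
    qed
    ultimately show "\<exists>x\<in>lineclosure j z. \<forall>i<n. cmod (x i - y i) < \<epsilon>" by blast
  qed
qed

lemma acc_contains_torus:
  assumes N: "0 < N" and inv: "winv N S" and per: "lper S"
    and acc: "\<And>\<epsilon>. 0 < \<epsilon> \<Longrightarrow> \<exists>x\<in>S. x \<noteq> 0 \<and> (\<forall>i<n. cmod (x i) < \<epsilon>)"
  obtains \<alpha> where "\<alpha> \<in> L" "\<alpha> \<noteq> 0" "\<And>y. y \<in> ER \<Longrightarrow> y * \<alpha> \<in> S"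
proof -
  have SE: "S \<subseteq> E" using sclosed_E winv_sclosed[OF inv] by blast
  obtain j where j: "j < n" "\<And>k. \<exists>x\<in>S. x j \<noteq> 0 \<and> (\<forall>i<n. cmod (x i) \<le> 1 / Suc k)"
    using acc_coord[OF SE acc] by metis
  obtain z where z: "z \<noteq> 0" "\<And>r. 0 < r \<Longrightarrow> single j (of_real r * z) \<in> S"
    using ray_const[OF N j(1) inv j(2)] by blast
  show ?thesis
  proof (cases "\<exists>\<alpha>\<in>L. \<alpha> \<noteq> 0 \<and> \<alpha> j / z \<in> \<real>")
    case True
    then obtain \<alpha> where \<alpha>: "\<alpha> \<in> L" "\<alpha> \<noteq> 0" "\<alpha> j / z \<in> \<real>" by blast
    define \<rho> where "\<rho> = Re (\<alpha> j / z)"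
    have "\<alpha> j / z = of_real \<rho>" using \<alpha>(3) unfolding \<rho>_def by (simp only: of_real_Re)
    then have \<rho>: "\<alpha> j = of_real \<rho> * z" using z(1) by (simp add: field_simps)
    have \<rho>0: "\<rho> \<noteq> 0" using \<rho> L_nonzero[OF \<alpha>(1) j(1)] \<alpha>(2) by auto
    have "y * \<alpha> \<in> S" if "y \<in> ER" for y
    proof (rule ray_fills[OF winv_sclosed[OF inv] L_E[OF \<alpha>(1)] j(1) \<rho>0 \<rho> z(2) _ that])
      show "x + \<alpha> * a \<in> S" if "x \<in> S" "a \<in> LR" for x a
        using per that L_mult[OF \<alpha>(1) LR_L[OF that(2)]] unfolding lper_def by blast
    qed
    then show ?thesis using that \<alpha> by blast
  next
    case False
    \<comment> \<open>In the irrational case \<open>S\<close> is everything, so \<open>e\<close>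
      serves as \<open>\<alpha>\<close>.\<close>
    have "lineclosure j z \<subseteq> S"
      using lineclosure_sub[OF winv_sclosed[OF inv] per] line_of_ray[OF winv_sclosed[OF inv] per j(1) z(2)] by blast
    then have "y \<in> S" if "y \<in> E" for y using lineclosure_full[OF j(1) z(1) _ that] False by blast
    then have "y * e \<in> S" if "y \<in> ER" for y using ER_E[OF that] by simp
    then show ?thesis using that[of e] e_nz by simp
  qed
qed

lemma infinite_contains_torus:
  assumes N: "0 < N" and inv: "winv N S" and per: "lper S" and inf: "infinite {x\<in>S. \<forall>i<n. cmod (x i) \<le> R}"
  obtains p \<alpha> where "p \<in> tors" "\<alpha> \<in> L" "\<alpha> \<noteq> 0" "\<And>y. y \<in> ER \<Longrightarrow> p + y * \<alpha> \<in> S"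
proof -
  have SE: "x \<in> S \<Longrightarrow> x \<in> E" for x using sclosed_E winv_sclosed[OF inv] by blast
  \<comment> \<open>The accumulation points of \<open>S\<close>, nonempty by compactness. They form
    a closed invariant periodic set, so one of them is torsion, and seen from it \<open>S\<close>
    accumulates at 0.\<close>
  define S' where "S' = {x\<in>E. \<forall>\<epsilon>>0. \<exists>y\<in>S. y \<noteq> x \<and> (\<forall>i<n. cmod (y i - x i) < \<epsilon>)}"
  have "S' \<noteq> {}"
  proof -
    obtain f :: "nat \<Rightarrow> _" where f: "inj f" "range f \<subseteq> {x\<in>S. \<forall>i<n. cmod (x i) \<le> R}"
      using infinite_countable_subset[OF inf] by blast
    have fS: "f k \<in> S" and fR: "i < n \<Longrightarrow> cmod (f k i) \<le> R" for k i using f(2) by auto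
    obtain q l where q: "strict_mono q" "l \<in> E" "\<And>i. i < n \<Longrightarrow> (\<lambda>k. f (q k) i) \<longlonglongrightarrow> l i"
      using bounded_subsequence[of f R] fR by blast
    have "\<exists>y\<in>S. y \<noteq> l \<and> (\<forall>i<n. cmod (y i - l i) < \<epsilon>)" if "0 < \<epsilon>" for \<epsilon>
    proof -
      have "\<forall>\<^sub>F k in sequentially. \<forall>i<n. cmod (f (q k) i - l i) < \<epsilon>" by (rule eventually_close) (use q that in auto)
      then obtain k where k: "\<And>m i. k \<le> m \<Longrightarrow> i < n \<Longrightarrow> cmod (f (q m) i - l i) < \<epsilon>"
        by (auto simp: eventually_sequentially)
      have "q k \<noteq> q (Suc k)" using q(1) by (simp add: strict_mono_eq)
      then have "f (q k) \<noteq> f (q (Suc k))" using f(1) by (simp add: inj_eq)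
      then have "f (q k) \<noteq> l \<or> f (q (Suc k)) \<noteq> l" by auto
      then obtain m where m: "k \<le> m" "f (q m) \<noteq> l" using le_SucI by blast
      show ?thesis by (rule bexI[OF _ fS[of "q m"]]) (use k[OF m(1)] m(2) in auto)
    qed
    then have "l \<in> S'" using q(2) by (simp add: S'_def)
    then show ?thesis by blast
  qed
  moreover have "winv N S'"
    unfolding winv_def sclosed_def
  proof (intro conjI ballI allI impI)
    show "S' \<subseteq> E" by (auto simp: S'_def)
  next
    fix w x assume w: "w \<in> W N" and x: "x \<in> S'"
    obtain A where A: "0 < A" "\<And>i. i < n \<Longrightarrow> cmod (w i) \<le> A" using E_bounded by blast
    have "\<exists>y\<in>S. y \<noteq> w * x \<and> (\<forall>i<n. cmod (y i - (w * x) i) < \<epsilon>)" if "0 < \<epsilon>" for \<epsilon>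
    proof -
      have "0 < \<epsilon> / A" using that A by simp
      then obtain y where y: "y \<in> S" "y \<noteq> x" "\<And>i. i < n \<Longrightarrow> cmod (y i - x i) < \<epsilon> / A"
        using x unfolding S'_def by blast
      have "w * y \<noteq> w * x"
      proof
        assume eq: "w * y = w * x"
        have "y = x"
        proof (rule E_eqI)
          fix i assume "i < n"
          then show "y i = x i" using fun_cong[OF eq, of i] U_nz[OF W_U[OF w]] by simp
        qed (use y(1) SE x in \<open>auto simp: S'_def\<close>)
        then show False using y(2) by simp
      qed
      moreover have "cmod ((w * y) i - (w * x) i) < \<epsilon>" if i: "i < n" for i
      proof -
        have "cmod ((w * y) i - (w * x) i) = cmod (w i) * cmod (y i - x i)"
          by (simp add: norm_mult flip: right_diff_distrib)
        also have "\<dots> \<le> A * cmod (y i - x i)" by (rule mult_right_mono[OF A(2)[OF i]]) simp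
        also have "\<dots> < A * (\<epsilon> / A)" by (rule mult_strict_left_mono[OF y(3)[OF i] A(1)])
        finally show ?thesis using A(1) by simp
      qed
      ultimately show ?thesis using winv_W[OF inv w y(1)] by (intro bexI[of _ "w * y"] conjI allI impI)
    qed
    moreover have "w * x \<in> E" using x by (auto simp: S'_def)
    ultimately show "w * x \<in> S'" by (simp add: S'_def)
  next
    fix f l assume f: "\<forall>k. f k \<in> S'" and l: "l \<in> E" and lim: "\<forall>i<n. (\<lambda>k. f k i) \<longlonglongrightarrow> l i"
    have "\<exists>y\<in>S. y \<noteq> l \<and> (\<forall>i<n. cmod (y i - l i) < \<epsilon>)" if \<epsilon>: "0 < \<epsilon>" for \<epsilon>
    proof (cases "\<exists>k. f k = l")
      case True
      then have "l \<in> S'" using f by metis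
      then show ?thesis using \<epsilon> unfolding S'_def by blast
    next
      case False
      have e2: "0 < \<epsilon> / 2" using \<epsilon> by simp
      have "\<forall>\<^sub>F k in sequentially. \<forall>i<n. cmod (f k i - l i) < \<epsilon> / 2" by (rule eventually_close) (use lim e2 in auto)
      then obtain k where k: "\<And>i. i < n \<Longrightarrow> cmod (f k i - l i) < \<epsilon> / 2" by (auto simp: eventually_sequentially)
      have fk: "f k \<in> S'" "f k \<noteq> l" using f False by auto
      have "\<exists>i<n. f k i \<noteq> l i"
      proof (rule ccontr)
        assume *: "\<not> (\<exists>i<n. f k i \<noteq> l i)"
        have "f k \<in> E" using fk(1) by (simp add: S'_def)
        then have "f k = l" by (rule E_eqI[OF _ l]) (use * in auto)
        then show False using fk(2) by simp
      qed
      then obtain i0 where i0: "i0 < n" "f k i0 \<noteq> l i0" by blast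
      \<comment> \<open>The second bound keeps the point found near \<open>f k\<close> away from
        \<open>l\<close> itself.\<close>
      define \<epsilon>' where "\<epsilon>' = min (\<epsilon> / 2) (cmod (f k i0 - l i0))"
      have "0 < \<epsilon>'" using e2 i0 by (simp add: \<epsilon>'_def)
      then obtain y where y: "y \<in> S" "\<And>i. i < n \<Longrightarrow> cmod (y i - f k i) < \<epsilon>'"
        using fk(1) unfolding S'_def by blast
      have "y \<noteq> l"
      proof
        assume "y = l"
        then show False using y(2)[OF i0(1)] by (simp add: \<epsilon>'_def norm_minus_commute)
      qed
      moreover have "cmod (y i - l i) < \<epsilon>" if "i < n" for i
        using y(2)[OF that] k[OF that] norm_triangle_ineq[of "y i - f k i" "f k i - l i"] by (simp add: \<epsilon>'_def)
      ultimately show ?thesis using y(1) by blast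
    qed
    then show "l \<in> S'" using l by (simp add: S'_def)
  qed
  moreover have "lper S'"
    unfolding lper_def
  proof (intro ballI)
    fix x a assume x: "x \<in> S'" and a: "a \<in> L"
    have "\<exists>y\<in>S. y \<noteq> x + a \<and> (\<forall>i<n. cmod (y i - (x + a) i) < \<epsilon>)" if \<epsilon>: "0 < \<epsilon>" for \<epsilon>
    proof -
      obtain y where y: "y \<in> S" "y \<noteq> x" "\<And>i. i < n \<Longrightarrow> cmod (y i - x i) < \<epsilon>"
        using x \<epsilon> unfolding S'_def by blast
      have "y + a \<in> S" using per y(1) a unfolding lper_def by blast
      then show ?thesis by (rule bexI[rotated]) (use y in simp)
    qed
    moreover have "x + a \<in> E" using x a by (auto simp: S'_def)
    ultimately show "x + a \<in> S'" by (simp add: S'_def)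
  qed
  ultimately obtain p where p: "p \<in> S'" "p \<in> tors" using has_tors[OF N] by blast
  obtain m where m: "0 < m" "of_nat m * p \<in> L" using p by (auto simp: tors_def)
  have pE: "p \<in> E" by (rule tors_E[OF p(2)])
  define T where "T = {x\<in>E. p + x \<in> S}"
  have "winv (N * m) T" unfolding T_def by (rule winv_translate[OF inv per pE m(2)])
  moreover have "lper T"
    unfolding lper_def
  proof (intro ballI)
    fix x a assume x: "x \<in> T" and a: "a \<in> L"
    have "(p + x) + a \<in> S" using per x a unfolding lper_def T_def by blast
    then have "p + (x + a) \<in> S" by (simp only: add.assoc)
    moreover have "x + a \<in> E" using x a by (auto simp: T_def)
    ultimately show "x + a \<in> T" by (simp add: T_def)
  qed
  moreover have "\<exists>x\<in>T. x \<noteq> 0 \<and> (\<forall>i<n. cmod (x i) < \<epsilon>)" if \<epsilon>: "0 < \<epsilon>" for \<epsilon>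
  proof -
    obtain y where y: "y \<in> S" "y \<noteq> p" "\<And>i. i < n \<Longrightarrow> cmod (y i - p i) < \<epsilon>"
      using p(1) \<epsilon> unfolding S'_def by blast
    have eq: "p + (y - p) = y" by simp
    have "p + (y - p) \<in> S" unfolding eq by (rule y(1))
    moreover have "y - p \<in> E" using SE[OF y(1)] pE by blast
    ultimately have "y - p \<in> T" unfolding T_def by blast
    then show ?thesis by (rule bexI[rotated]) (use y in simp)
  qed
  moreover have "0 < N * m" using N m by simp
  ultimately obtain \<alpha> where \<alpha>: "\<alpha> \<in> L" "\<alpha> \<noteq> 0" "\<And>y. y \<in> ER \<Longrightarrow> y * \<alpha> \<in> T"
    using acc_contains_torus[of "N * m" T] by metis
  then have "p + y * \<alpha> \<in> S" if "y \<in> ER" for y using that unfolding T_def by blast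
  then show ?thesis using that p(2) \<alpha>(1,2) by blast
qed

end

section \<open>The inhomogeneous minimum\<close>

lemma le_if_le_inverse_Suc:
  fixes x y :: real
  assumes "\<And>k. x \<le> y + 1 / Suc k"
  shows "x \<le> y"
proof (rule field_le_epsilon)
  fix \<epsilon> :: real assume "0 < \<epsilon>"
  then obtain k where "1 / Suc k < \<epsilon>" by (rule nat_approx_posE)
  then show "x \<le> y + \<epsilon>" using assms[of k] by linarith
qed

context cm_lattice
begin

definition infnm :: "(nat \<Rightarrow> complex) \<Rightarrow> real" where "infnm x = (INF a\<in>L. nm (x + a))"
definition M :: real where "M = (SUP x\<in>E. infnm x)"
definition Sc :: "real \<Rightarrow> (nat \<Rightarrow> complex) set" where "Sc c = {x\<in>E. c \<le> infnm x}"

lemma infnm_le: "a \<in> L \<Longrightarrow> infnm x \<le> nm (x + a)"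
  unfolding infnm_def by (rule cINF_lower) (auto intro!: bdd_belowI[of _ 0])

lemma infnm_ge: "(\<And>a. a \<in> L \<Longrightarrow> c \<le> nm (x + a)) \<Longrightarrow> c \<le> infnm x"
  unfolding infnm_def by (rule cINF_greatest) (use e_L in blast)

lemma infnm_less: assumes "infnm x < c" obtains a where "a \<in> L" "nm (x + a) < c"
  using infnm_ge[of c x] assms by (meson not_less)

lemma infnm_shift_le: "a \<in> L \<Longrightarrow> infnm (x + a) \<le> infnm x"
proof (rule infnm_ge)
  fix b assume "a \<in> L" "b \<in> L"
  then have "infnm (x + a) \<le> nm ((x + a) + (b - a))" by (intro infnm_le L_minus)
  then show "infnm (x + a) \<le> nm (x + b)" by simp
qed

lemma infnm_shift: assumes "a \<in> L" shows "infnm (x + a) = infnm x"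
proof (rule antisym[OF infnm_shift_le[OF assms]])
  have "infnm ((x + a) + - a) \<le> infnm (x + a)" by (intro infnm_shift_le L_uminus assms)
  then show "infnm x \<le> infnm (x + a)" by simp
qed

lemma infnm_unit_le: assumes "u \<in> U" shows "infnm (u * x) \<le> infnm x"
proof (rule infnm_ge)
  fix b assume b: "b \<in> L"
  have "infnm (u * x) \<le> nm (u * x + u * b)" by (intro infnm_le L_mult U_L assms b)
  also have "\<dots> = nm (u * (x + b))" by (simp only: distrib_left)
  also have "\<dots> = nm (x + b)" using U_nm[OF assms] by (simp only: nm_mult)
  finally show "infnm (u * x) \<le> nm (x + b)" .
qed

lemma infnm_unit: assumes "u \<in> U" "x \<in> E" shows "infnm (u * x) = infnm x"
proof (rule antisym[OF infnm_unit_le[OF assms(1)]])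
  obtain v where v: "v \<in> U" "u * v = e" using U_inverse assms by blast
  have "v * (u * x) = (u * v) * x" by (simp only: mult.assoc mult.left_commute)
  then have "v * (u * x) = x" using v(2) assms(2) by simp
  then show "infnm x \<le> infnm (u * x)" using infnm_unit_le[OF v(1), of "u * x"] by simp
qed

lemma infnm_bound: assumes "x \<in> E" shows "infnm x \<le> (R\<^sup>2) ^ n"
proof -
  obtain a where a: "a \<in> L" "\<And>i. i < n \<Longrightarrow> cmod (x i - a i) \<le> R" using near assms by blast
  have "infnm x \<le> nm (x + - a)" by (intro infnm_le L_uminus a)
  also have "\<dots> \<le> (\<Prod>i<n. R\<^sup>2)"
    unfolding nm_def by (rule prod_mono) (use a in \<open>auto intro: power_mono\<close>)
  finally show ?thesis by simp
qed

lemma infnm_le_M: "x \<in> E \<Longrightarrow> infnm x \<le> M"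
  unfolding M_def by (rule cSUP_upper) (auto intro!: bdd_aboveI[of _ "(R\<^sup>2) ^ n"] infnm_bound)

text \<open>Each condition \<open>c \<le> nm (x + a)\<close> is closed, and the superlevel set is
  their intersection.\<close>

lemma Sc_sclosed: "sclosed (Sc c)"
  unfolding sclosed_def
proof (intro conjI allI impI)
  show "Sc c \<subseteq> E" by (auto simp: Sc_def)
  fix f l assume f: "\<forall>k. f k \<in> Sc c" and l: "l \<in> E" and lim: "\<forall>i<n. (\<lambda>k. f k i) \<longlonglongrightarrow> l i"
  have "c \<le> nm (l + a)" if a: "a \<in> L" for a
  proof (rule tendsto_lowerbound)
    show "(\<lambda>k. nm (f k + a)) \<longlonglongrightarrow> nm (l + a)"
      unfolding nm_def by (intro tendsto_prod tendsto_power tendsto_norm) (use lim in \<open>auto intro!: tendsto_add\<close>)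
    have "c \<le> nm (f k + a)" for k
    proof -
      have "c \<le> infnm (f k)" using f by (simp add: Sc_def)
      also have "\<dots> \<le> nm (f k + a)" by (rule infnm_le[OF a])
      finally show ?thesis .
    qed
    then show "\<forall>\<^sub>F k in sequentially. c \<le> nm (f k + a)" by simp
  qed simp
  then show "l \<in> Sc c" using l infnm_ge by (simp add: Sc_def)
qed

lemma Sc_winv: "winv N (Sc c)"
  unfolding winv_def using Sc_sclosed infnm_unit W_U by (auto simp: Sc_def)

lemma Sc_lper: "lper (Sc c)"
  unfolding lper_def using infnm_shift by (auto simp: Sc_def)

lemma lper_near:
  assumes "x \<in> E"
  obtains a where "a \<in> L" "\<And>i. i < n \<Longrightarrow> cmod ((x - a) i) \<le> R" "infnm (x - a) = infnm x" "x - a \<in> E"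
proof -
  obtain a where a: "a \<in> L" "\<And>i. i < n \<Longrightarrow> cmod (x i - a i) \<le> R" using near assms by blast
  have "infnm (x + - a) = infnm x" by (rule infnm_shift[OF L_uminus[OF a(1)]])
  then show ?thesis using that[of a] a assms by auto
qed

text \<open>The limit lies in every superlevel set below \<open>M\<close>, because a tail of the
  subsequence does.\<close>

lemma M_limit:
  assumes "\<And>k. f k \<in> E" "\<And>k i. i < n \<Longrightarrow> cmod (f k i) \<le> B" "\<And>k. M - 1 / Suc k < infnm (f k)"
  obtains q l where "strict_mono q" "l \<in> E" "\<And>i. i < n \<Longrightarrow> (\<lambda>k. f (q k) i) \<longlonglongrightarrow> l i" "infnm l = M"
proof -
  obtain q l where q: "strict_mono q" "l \<in> E" "\<And>i. i < n \<Longrightarrow> (\<lambda>k. f (q k) i) \<longlonglongrightarrow> l i"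
    using bounded_subsequence[of f B] assms(2) by blast
  have "M - 1 / Suc k \<le> infnm l" for k
  proof -
    have "l \<in> Sc (M - 1 / Suc k)"
    proof (rule sclosed_tail[OF Sc_sclosed, of k "\<lambda>m. f (q m)"])
      fix m assume "k \<le> m"
      then have "k \<le> q m" using seq_suble[OF q(1), of m] by linarith
      then have "1 / real (Suc (q m)) \<le> 1 / Suc k" by (simp add: frac_le)
      then have "M - 1 / Suc k \<le> infnm (f (q m))" using assms(3)[of "q m"] by linarith
      then show "f (q m) \<in> Sc (M - 1 / Suc k)" using assms(1) by (simp add: Sc_def)
    qed (use q in auto)
    then show ?thesis by (simp add: Sc_def)
  qed
  then have "M \<le> infnm l + 1 / Suc k" for k by (simp add: algebra_simps)
  then have "M \<le> infnm l" by (rule le_if_le_inverse_Suc)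
  then have "infnm l = M" using infnm_le_M[OF q(2)] by simp
  then show ?thesis using that q by blast
qed

lemma M_attained: obtains x where "x \<in> E" "infnm x = M"
proof -
  have "\<exists>x. x \<in> E \<and> (\<forall>i<n. cmod (x i) \<le> R) \<and> M - 1 / Suc k < infnm x" for k
  proof -
    have ne: "infnm ` E \<noteq> {}" using E_0 by blast
    have "M - 1 / Suc k < (SUP x\<in>E. infnm x)" unfolding M_def[symmetric] by simp
    then obtain v where "v \<in> infnm ` E" "M - 1 / Suc k < v" using less_cSupE[OF _ ne] by metis
    then obtain x where x: "x \<in> E" "M - 1 / Suc k < infnm x" by blast
    obtain a where "a \<in> L" "\<And>i. i < n \<Longrightarrow> cmod ((x - a) i) \<le> R" "infnm (x - a) = infnm x" "x - a \<in> E"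
      using lper_near[OF x(1)] by blast
    then show ?thesis using x by (intro exI[of _ "x - a"]) auto
  qed
  then obtain f where f: "\<And>k. f k \<in> E" "\<And>k i. i < n \<Longrightarrow> cmod (f k i) \<le> R" "\<And>k. M - 1 / Suc k < infnm (f k)"
    by metis
  show ?thesis using M_limit[of f R, OF f] that by metis
qed

lemma nm_of_nat: "nm (of_nat m * x) = (real m ^ 2) ^ n * nm x"
  by (simp add: nm_def norm_mult power_mult_distrib prod.distrib)

text \<open>Witnessed by half of \<open>e\<close>: twice any point of its class is a nonzero lattice
  point, of norm at least 1, and doubling multiplies the norm by \<open>4 ^ n\<close>.\<close>

lemma M_pos: "0 < M"
proof -
  define x where "x = (\<lambda>i. e i / 2)"
  have xE: "x \<in> E" by (simp add: x_def e_def E_def)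
  have x2: "of_nat 2 * x = e" by (rule ext) (simp add: x_def)
  have "1 / 4 ^ n \<le> infnm x"
  proof (rule infnm_ge)
    fix a assume a: "a \<in> L"
    have eq: "of_nat 2 * (x + a) = e + of_nat 2 * a" by (simp only: distrib_left x2)
    have "e + of_nat 2 * a \<noteq> 0"
    proof
      assume 0: "e + of_nat 2 * a = 0"
      have "a = 0"
      proof (rule L_discrete[OF a])
        fix i assume i: "i < n"
        have "1 + 2 * a i = 0" using fun_cong[OF 0, of i] i by simp
        then have "2 * a i = - 1" by (simp add: eq_neg_iff_add_eq_0 add.commute)
        then have "cmod (2 * a i) = 1" by simp
        then show "cmod (a i) < 1" by (simp add: norm_mult)
      qed
      then show False using 0 e_nz by simp
    qed
    moreover have "e + of_nat 2 * a \<in> L" by (intro L_add e_L L_of_nat_mult a)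
    ultimately have "1 \<le> nm (of_nat 2 * (x + a))" unfolding eq by (intro nm_ge_1)
    then have "1 \<le> 4 ^ n * nm (x + a)" unfolding nm_of_nat by simp
    then show "1 / 4 ^ n \<le> nm (x + a)" by (simp add: field_simps)
  qed
  moreover have "0 < 1 / (4::real) ^ n" by simp
  ultimately show ?thesis using infnm_le_M[OF xE] by linarith
qed

section \<open>Finiteness and torsion of the maximal points\<close>

lemma nm_Ints: "a \<in> L \<Longrightarrow> nm a \<in> \<int>"
  using L_norm_Ints by (simp add: nm_def)

text \<open>On the class of a torsion point the norms, after multiplication by a fixed power of
  \<open>m\<close>, are nonnegative integers, so the infimum is a minimum.\<close>

lemma tors_attained: assumes "x \<in> tors" obtains a where "a \<in> L" "nm (x + a) = infnm x"
proof -
  obtain m where m: "0 < m" "of_nat m * x \<in> L" using assms by (auto simp: tors_def)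
  have int: "nm (of_nat m * (x + a)) = real (nat \<lfloor>nm (of_nat m * (x + a))\<rfloor>)" if "a \<in> L" for a
  proof -
    have "of_nat m * (x + a) \<in> L" unfolding distrib_left by (intro L_add m L_of_nat_mult that)
    then have "nm (of_nat m * (x + a)) \<in> \<int>" by (rule nm_Ints)
    then obtain z where z: "nm (of_nat m * (x + a)) = of_int z" by (rule Ints_cases)
    then show ?thesis using nm_nonneg[of "of_nat m * (x + a)"] by simp
  qed
  obtain a where a: "a \<in> L" "\<And>b. b \<in> L \<Longrightarrow>
      nat \<lfloor>nm (of_nat m * (x + a))\<rfloor> \<le> nat \<lfloor>nm (of_nat m * (x + b))\<rfloor>"
    using ex_has_least_nat[of "\<lambda>a. a \<in> L" 0 "\<lambda>a. nat \<lfloor>nm (of_nat m * (x + a))\<rfloor>"] by auto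
  have "nm (x + a) \<le> infnm x"
  proof (rule infnm_ge)
    fix b assume b: "b \<in> L"
    have "nm (of_nat m * (x + a)) \<le> nm (of_nat m * (x + b))"
      using a(2)[OF b] int[OF a(1)] int[OF b] by linarith
    then show "nm (x + a) \<le> nm (x + b)" unfolding nm_of_nat using m(1) by simp
  qed
  then show ?thesis using infnm_le[OF a(1), of x] that a(1) by (meson antisym)
qed

text \<open>A translate of a torus on which the minimum is constantly \<open>M\<close> is impossible: the product of
  positive quadratics in the real parameters has a unique minimum, so every rational parameter would
  have to come from the lattice.\<close>

lemma no_torus:
  assumes p: "p \<in> tors" and \<alpha>: "\<alpha> \<in> L" "\<alpha> \<noteq> 0" and const: "\<And>y. y \<in> ER \<Longrightarrow> p + y * \<alpha> \<in> Sc M"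
  shows False
proof -
  have \<alpha>0: "\<alpha> i \<noteq> 0" if "i < n" for i using L_nonzero \<alpha> that by blast
  \<comment> \<open>The hypothesis makes the point at parameter \<open>s\<close> torsion, so
    \<open>M\<close> is attained there by some \<open>a\<close>. Each quadratic factor must then be
    at its minimum, since otherwise changing one real coordinate would push a norm below
    \<open>M\<close>.\<close>
  have key: "\<exists>a\<in>L. \<forall>i<n. Re ((p i + a i) / \<alpha> i) = - s" if ys: "of_nat k * ((\<lambda>i. of_real s * e i) * \<alpha>) \<in> L" "0 < k"
    for k s
  proof -
    define y where "y = (\<lambda>i. complex_of_real s * e i)"
    have yR: "y \<in> ER" by (auto simp: y_def ER_def E_def e_def)
    have "y * \<alpha> \<in> tors" using ys L_E[OF \<alpha>(1)] unfolding tors_def y_def by blast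
    then have "p + y * \<alpha> \<in> tors" by (rule tors_add[OF p])
    then obtain a where a: "a \<in> L" "nm (p + y * \<alpha> + a) = infnm (p + y * \<alpha>)" using tors_attained by blast
    have eqM: "infnm (p + y' * \<alpha>) = M" if "y' \<in> ER" for y'
      using const[OF that] infnm_le_M[of "p + y' * \<alpha>"] by (simp add: Sc_def)
    have nM: "nm (p + y * \<alpha> + a) = M" using a(2) eqM[OF yR] by simp
    have "Re ((p i0 + a i0) / \<alpha> i0) = - s" if i0: "i0 < n" for i0
    proof (rule ccontr)
      define \<beta> where "\<beta> = (p i0 + a i0) / \<alpha> i0"
      assume "Re ((p i0 + a i0) / \<alpha> i0) \<noteq> - s"
      then have ne: "Re \<beta> + s \<noteq> 0" by (simp add: \<beta>_def)
      \<comment> \<open>In coordinate \<open>i0\<close> the factor is proportional to the sum of the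
        squares of \<open>Re \<beta> + s\<close> and \<open>Im \<beta>\<close>; the new parameter
        removes the first square.\<close>
      define y' where "y' = y(i0 := - complex_of_real (Re \<beta>))"
      have y'R: "y' \<in> ER" using yR i0 by (auto simp: y'_def ER_def E_def)
      have pa: "p i0 + a i0 = \<beta> * \<alpha> i0" using \<alpha>0[OF i0] by (simp add: \<beta>_def)
      have f1: "(p + y * \<alpha> + a) i0 = (\<beta> + of_real s) * \<alpha> i0"
        using pa i0 by (simp add: y_def algebra_simps)
      have f2: "(p + y' * \<alpha> + a) i0 = (\<beta> - of_real (Re \<beta>)) * \<alpha> i0"
        using pa by (simp add: y'_def algebra_simps)
      have f3: "(p + y' * \<alpha> + a) i = (p + y * \<alpha> + a) i" if "i \<noteq> i0" for i using that by (simp add: y'_def)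
      define P where "P = (\<Prod>i\<in>{..<n}-{i0}. (cmod ((p + y * \<alpha> + a) i))\<^sup>2)"
      have n1: "nm (p + y * \<alpha> + a) = (cmod ((\<beta> + of_real s) * \<alpha> i0))\<^sup>2 * P"
        unfolding nm_def P_def f1[symmetric] using i0 by (subst prod.remove[of _ i0]) auto
      have n2: "nm (p + y' * \<alpha> + a) = (cmod ((\<beta> - of_real (Re \<beta>)) * \<alpha> i0))\<^sup>2 * P"
      proof -
        have "(\<Prod>i\<in>{..<n}-{i0}. (cmod ((p + y' * \<alpha> + a) i))\<^sup>2) = P"
          unfolding P_def
        proof (rule prod.cong[OF refl])
          fix i assume "i \<in> {..<n}-{i0}"
          then have "i \<noteq> i0" by simp
          from f3[OF this] show "(cmod ((p + y' * \<alpha> + a) i))\<^sup>2 = (cmod ((p + y * \<alpha> + a) i))\<^sup>2" by (simp only:)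
        qed
        then show ?thesis
          unfolding nm_def f2[symmetric] using i0 by (subst prod.remove[of _ i0]) auto
      qed
      have "0 \<le> P" unfolding P_def by (intro prod_nonneg) simp
      \<comment> \<open>As \<open>M\<close> is positive, the other factors do not vanish, and a
        strict decrease of one factor decreases the norm strictly.\<close>
      moreover have "P \<noteq> 0" using n1 nM M_pos by auto
      ultimately have P0: "0 < P" by simp
      have "(cmod (\<beta> - of_real (Re \<beta>)))\<^sup>2 < (cmod (\<beta> + of_real s))\<^sup>2"
        using ne by (simp add: cmod_power2)
      moreover have "0 < (cmod (\<alpha> i0))\<^sup>2 * P" using P0 \<alpha>0[OF i0] by simp
      ultimately have "(cmod (\<beta> - of_real (Re \<beta>)))\<^sup>2 * ((cmod (\<alpha> i0))\<^sup>2 * P) < (cmod (\<beta> + of_real s))\<^sup>2 * ((cmod (\<alpha> i0))\<^sup>2 * P)"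
        by (rule mult_strict_right_mono)
      then have "nm (p + y' * \<alpha> + a) < nm (p + y * \<alpha> + a)"
        unfolding n1 n2 by (simp add: norm_mult power_mult_distrib mult_ac)
      moreover have "M \<le> nm (p + y' * \<alpha> + a)" using infnm_le[OF a(1), of "p + y' * \<alpha>"] eqM[OF y'R] by simp
      ultimately show False using nM by simp
    qed
    then show ?thesis using a(1) by blast
  qed
  have z0: "(\<lambda>i. of_real 0 * e i) * \<alpha> = 0" by (rule ext) simp
  have "of_nat 1 * ((\<lambda>i. of_real 0 * e i) * \<alpha>) \<in> L" unfolding z0 by simp
  from key[OF this zero_less_one_class.zero_less_one] obtain a where a: "a \<in> L" "\<And>i. i < n \<Longrightarrow> Re ((p i + a i) / \<alpha> i) = - 0"
    by blast
  obtain A where A: "0 < A" "\<And>i. i < n \<Longrightarrow> cmod (\<alpha> i) \<le> A" using E_bounded by blast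
  \<comment> \<open>The parameters 0 and \<open>1 / k\<close> are compared, with \<open>k\<close> so
    large that the lattice vector \<open>h\<close> below has all coordinates of absolute value less
    than 1.\<close>
  obtain k :: nat where kA: "2 * A\<^sup>2 < real k" using reals_Archimedean2 by blast
  have k: "0 < k" using kA by (cases k) auto
  have ek: "of_nat k * ((\<lambda>i. of_real (1 / k) * e i) * \<alpha>) = e * \<alpha>" by (rule ext) (use k in simp)
  have "of_nat k * ((\<lambda>i. of_real (1 / k) * e i) * \<alpha>) \<in> L" unfolding ek by (intro L_mult e_L \<alpha>)
  from key[OF this k] obtain b where b: "b \<in> L" "\<And>i. i < n \<Longrightarrow> Re ((p i + b i) / \<alpha> i) = - (1 / k)" by blast
  define c where "c = a - b"
  have cL: "c \<in> L" unfolding c_def by (intro L_minus a b)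
  \<comment> \<open>All quotients \<open>c i / \<alpha> i\<close> have real part
    \<open>1 / k\<close>. Multiplying \<open>c\<close> by the conjugate of \<open>\<alpha>\<close>
    and adding the conjugate product turns this into a statement about a lattice vector.\<close>
  define h where "h = c * (\<lambda>i. cnj (\<alpha> i)) + (\<lambda>i. cnj (c i)) * \<alpha>"
  have hL: "h \<in> L" unfolding h_def by (intro L_add L_mult cL L_cnj \<alpha>)
  have hi: "h i = of_real (2 * (cmod (\<alpha> i))\<^sup>2 / k)" if i: "i < n" for i
  proof -
    define \<gamma> where "\<gamma> = c i / \<alpha> i"
    have "\<gamma> = (p i + a i) / \<alpha> i - (p i + b i) / \<alpha> i" by (simp add: \<gamma>_def c_def flip: diff_divide_distrib)
    then have R\<gamma>: "Re \<gamma> = 1 / k" using a(2)[OF i] b(2)[OF i] by simp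
    have c: "c i = \<gamma> * \<alpha> i" using \<alpha>0[OF i] by (simp add: \<gamma>_def)
    have "h i = (\<gamma> + cnj \<gamma>) * (\<alpha> i * cnj (\<alpha> i))" by (simp add: h_def c algebra_simps)
    also have "\<dots> = of_real (2 * (1 / k)) * of_real ((cmod (\<alpha> i))\<^sup>2)"
      by (simp only: complex_add_cnj R\<gamma> complex_norm_square)
    finally show ?thesis by simp
  qed
  have "h = 0"
  proof (rule L_discrete[OF hL])
    fix i assume i: "i < n"
    have "cmod (h i) = \<bar>2 * (cmod (\<alpha> i))\<^sup>2 / k\<bar>" unfolding hi[OF i] by (rule norm_of_real)
    also have "\<dots> = 2 * (cmod (\<alpha> i))\<^sup>2 / k" by simp
    also have "\<dots> \<le> 2 * A\<^sup>2 / k" by (intro divide_right_mono mult_left_mono power_mono A(2) i) auto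
    also have "\<dots> < 1" using kA k by simp
    finally show "cmod (h i) < 1" .
  qed
  then have "h 0 = 0" by simp
  then show False unfolding hi[OF n_pos] using \<alpha>0[OF n_pos] k by simp
qed

lemma finite_max_set: "finite {x\<in>Sc M. \<forall>i<n. cmod (x i) \<le> R}"
proof (rule ccontr)
  assume inf: "infinite {x\<in>Sc M. \<forall>i<n. cmod (x i) \<le> R}"
  show False
    by (rule infinite_contains_torus[OF zero_less_one_class.zero_less_one Sc_winv Sc_lper inf]) (rule no_torus)
qed

text \<open>Reduction modulo \<open>L\<close> brings each point to coordinates of size at most
  \<open>R\<close>, and the lattice vectors used are themselves bounded.\<close>

lemma finite_max_bounded: "finite {x\<in>Sc M. \<forall>i<n. cmod (x i) \<le> B}"
proof (rule finite_subset)
  let ?A = "{x\<in>Sc M. \<forall>i<n. cmod (x i) \<le> R}" and ?C = "{a\<in>L. \<forall>i<n. cmod (a i) \<le> B + R}"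
  show "finite ((\<lambda>(x, a). x + a) ` (?A \<times> ?C))"
    by (intro finite_imageI finite_cartesian_product finite_max_set finite_bounded_L)
  show "{x\<in>Sc M. \<forall>i<n. cmod (x i) \<le> B} \<subseteq> (\<lambda>(x, a). x + a) ` (?A \<times> ?C)"
  proof
    fix x assume x: "x \<in> {x\<in>Sc M. \<forall>i<n. cmod (x i) \<le> B}"
    then have xE: "x \<in> E" by (simp add: Sc_def)
    obtain a where a: "a \<in> L" "\<And>i. i < n \<Longrightarrow> cmod ((x - a) i) \<le> R" "infnm (x - a) = infnm x" "x - a \<in> E"
      using lper_near[OF xE] by blast
    have "cmod (a i) \<le> B + R" if "i < n" for i
      using a(2)[OF that] x that norm_triangle_ineq4[of "x i" "(x - a) i"] by auto
    moreover have "x - a \<in> ?A" using x a by (auto simp: Sc_def)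
    moreover have "x = (\<lambda>(x, a). x + a) (x - a, a)" by simp
    ultimately show "x \<in> (\<lambda>(x, a). x + a) ` (?A \<times> ?C)" using a(1) by blast
  qed
qed

text \<open>Infinitely many units carry \<open>x\<close> into a set that is finite modulo
  \<open>L\<close>. Two images agree, so a nonzero lattice element carries \<open>x\<close> into
  \<open>L\<close>.\<close>

lemma max_tors: assumes "x \<in> Sc M" shows "x \<in> tors"
proof -
  have xE: "x \<in> E" using assms by (simp add: Sc_def)
  let ?A = "{x\<in>Sc M. \<forall>i<n. cmod (x i) \<le> R}"
  obtain w where w: "\<And>k. w k \<in> W 1" "\<And>k l. k < (l::nat) \<Longrightarrow> w k \<noteq> w l"
    using W_seq[OF zero_less_one_class.zero_less_one n_pos] by metis
  have "\<exists>a. a \<in> L \<and> w k * x - a \<in> ?A" for k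
  proof -
    have wx: "w k * x \<in> Sc M" by (rule winv_W[OF Sc_winv w(1) assms])
    have wE: "w k * x \<in> E" using xE by simp
    obtain a where a: "a \<in> L" "\<And>i. i < n \<Longrightarrow> cmod ((w k * x - a) i) \<le> R" "infnm (w k * x - a) = infnm (w k * x)" "w k * x - a \<in> E"
      using lper_near[OF wE] by blast
    have "M \<le> infnm (w k * x - a)" using wx unfolding a(3) by (simp add: Sc_def)
    then have "w k * x - a \<in> ?A" unfolding Sc_def using a(2,4) by blast
    then show ?thesis using a(1) by blast
  qed
  then have "\<forall>k. \<exists>a. a \<in> L \<and> w k * x - a \<in> ?A" by (rule allI)
  from choice[OF this] obtain a where "\<forall>k. a k \<in> L \<and> w k * x - a k \<in> ?A" by (rule exE)
  then have a: "\<And>k. a k \<in> L" "\<And>k. w k * x - a k \<in> ?A" by simp_all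
  have "\<not> inj (\<lambda>k. w k * x - a k)"
  proof
    assume "inj (\<lambda>k. w k * x - a k)"
    then have "infinite (range (\<lambda>k. w k * x - a k))" by (rule range_inj_infinite)
    moreover have "range (\<lambda>k. w k * x - a k) \<subseteq> ?A" using a(2) by blast
    ultimately show False using finite_max_set finite_subset by blast
  qed
  then obtain k l where kl: "k < l" "w k * x - a k = w l * x - a l"
    unfolding inj_def by (metis linorder_neqE_nat)
  have "(w k - w l) * x = (w k * x - a k) - (w l * x - a l) + (a k - a l)" by (simp add: left_diff_distrib)
  also have "\<dots> = a k - a l" using kl(2) by simp
  also have "\<dots> \<in> L" by (intro L_minus a)
  finally show ?thesis
    using w(2)[OF kl(1)] w(1) W_L by (intro tors_if_mult[OF xE, of "w k - w l"] L_minus) auto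
qed

text \<open>Nearly maximal points accumulate at a maximal point, which is torsion; expanding the differences
  by units that fix it produces a whole ray of maximal points, against finiteness.\<close>

lemma M_isolated: "\<exists>\<epsilon>>0. \<forall>x\<in>E. M - \<epsilon> < infnm x \<longrightarrow> infnm x = M"
proof (rule ccontr)
  assume neg: "\<not> ?thesis"
  have "\<exists>x. x \<in> E \<and> (\<forall>i<n. cmod (x i) \<le> R) \<and> M - 1 / Suc k < infnm x \<and> infnm x \<noteq> M" for k
  proof -
    have "0 < 1 / real (Suc k)" by simp
    then obtain x where x: "x \<in> E" "M - 1 / Suc k < infnm x" "infnm x \<noteq> M" using neg by blast
    obtain a where "a \<in> L" "\<And>i. i < n \<Longrightarrow> cmod ((x - a) i) \<le> R" "infnm (x - a) = infnm x" "x - a \<in> E"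
      using lper_near[OF x(1)] by blast
    then show ?thesis using x by (intro exI[of _ "x - a"]) auto
  qed
  then obtain f where f: "\<And>k. f k \<in> E" "\<And>k i. i < n \<Longrightarrow> cmod (f k i) \<le> R" "\<And>k. M - 1 / Suc k < infnm (f k)"
    "\<And>k. infnm (f k) \<noteq> M" by metis
  obtain q l where q: "strict_mono q" "l \<in> E" "\<And>i. i < n \<Longrightarrow> (\<lambda>k. f (q k) i) \<longlonglongrightarrow> l i" "infnm l = M"
    using M_limit[of f R, OF f(1-3)] by metis
  have "l \<in> tors" by (rule max_tors) (use q in \<open>simp add: Sc_def\<close>)
  then obtain m where m: "0 < m" "of_nat m * l \<in> L" by (auto simp: tors_def)
  \<comment> \<open>The superlevel sets seen from \<open>l\<close>. A ray contained in all of them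
    consists of maximal points.\<close>
  define S where "S k = {y\<in>E. l + y \<in> Sc (M - 1 / Suc k)}" for k
  have inv: "winv (1 * m) (S k)" for k
    unfolding S_def by (rule winv_translate[OF Sc_winv Sc_lper q(2) m(2)])
  have dec: "S (Suc k) \<subseteq> S k" for k
  proof -
    have "1 / real (Suc (Suc k)) \<le> 1 / Suc k" by (simp add: frac_le)
    then show ?thesis by (auto simp: S_def Sc_def)
  qed
  have SE: "S k \<subseteq> E" for k by (auto simp: S_def)
  have small: "\<exists>y\<in>S k. y \<noteq> 0 \<and> (\<forall>i<n. cmod (y i) \<le> 1 / Suc k)" for k
  proof -
    have "\<forall>\<^sub>F r in sequentially. \<forall>i<n. cmod (f (q r) i - l i) < 1 / Suc k" by (rule eventually_close) (use q in auto)
    then obtain r0 where r0: "\<And>r i. r0 \<le> r \<Longrightarrow> i < n \<Longrightarrow> cmod (f (q r) i - l i) < 1 / Suc k"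
      by (auto simp: eventually_sequentially)
    define r where "r = max r0 k"
    have "k \<le> q r" using seq_suble[OF q(1), of r] by (simp add: r_def)
    then have "1 / real (Suc (q r)) \<le> 1 / Suc k" by (simp add: frac_le)
    then have "M - 1 / Suc k \<le> infnm (f (q r))" using f(3)[of "q r"] by linarith
    then have 1: "f (q r) \<in> Sc (M - 1 / Suc k)" using f(1) by (simp add: Sc_def)
    have 2: "l + (f (q r) - l) = f (q r)" by simp
    have "l + (f (q r) - l) \<in> Sc (M - 1 / Suc k)" unfolding 2 by (rule 1)
    moreover have "f (q r) - l \<in> E" using f(1) q(2) by blast
    ultimately have "f (q r) - l \<in> S k" unfolding S_def by blast
    moreover have "f (q r) - l \<noteq> 0"
    proof
      assume "f (q r) - l = 0"
      then have "f (q r) = l" by simp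
      then show False using f(4)[of "q r"] q(4) by simp
    qed
    moreover have "cmod ((f (q r) - l) i) \<le> 1 / Suc k" if "i < n" for i
      using r0[of r, OF _ that] by (simp add: r_def less_imp_le)
    ultimately show ?thesis by (intro bexI[of _ "f (q r) - l"] conjI allI impI)
  qed
  obtain j where j: "j < n" "\<And>k. \<exists>y\<in>S k. y j \<noteq> 0 \<and> (\<forall>i<n. cmod (y i) \<le> 1 / Suc k)"
    using acc_coord_family[of S, OF SE dec small] by metis
  have m1: "0 < 1 * m" using m by simp
  obtain z where z: "z \<noteq> 0" "\<And>r k. 0 < r \<Longrightarrow> single j (of_real r * z) \<in> S k"
    using ray[OF m1 j(1), of S, OF inv dec j(2)] by blast
  obtain A where A: "0 < A" "\<And>i. i < n \<Longrightarrow> cmod (l i) \<le> A" using E_bounded by blast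
  define g where "g r = l + single j (of_real r * z)" for r
  \<comment> \<open>Parameters below 1 keep this part of the ray bounded, so the finiteness of
    bounded maximal points applies to it.\<close>
  have "g r \<in> {x\<in>Sc M. \<forall>i<n. cmod (x i) \<le> A + cmod z}" if r: "r \<in> {0<..<1}" for r
  proof -
    have gE: "g r \<in> E" using q(2) j(1) by (simp add: g_def)
    have "M - 1 / Suc k \<le> infnm (g r)" for k using z(2)[of r k] r by (simp add: S_def Sc_def g_def)
    then have "M \<le> infnm (g r) + 1 / Suc k" for k by (simp add: algebra_simps)
    then have "M \<le> infnm (g r)" by (rule le_if_le_inverse_Suc)
    moreover have "cmod (g r i) \<le> A + cmod z" if "i < n" for i
    proof -
      have "cmod (single j (of_real r * z) i) \<le> cmod z"
        using r by (auto simp: single_def norm_mult intro: mult_left_le_one_le)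
      then show ?thesis using A(2)[OF that] norm_triangle_ineq[of "l i" "single j (of_real r * z) i"]
        by (simp add: g_def)
    qed
    ultimately show ?thesis using gE by (simp add: Sc_def)
  qed
  then have "g ` {0<..<1} \<subseteq> {x\<in>Sc M. \<forall>i<n. cmod (x i) \<le> A + cmod z}" by blast
  then have "finite (g ` {0<..<1})" using finite_max_bounded finite_subset by blast
  moreover have "inj_on g {0<..<1}"
  proof (rule inj_onI)
    fix r s assume "g r = g s"
    then have "g r j = g s j" by simp
    then show "r = s" using z(1) by (simp add: g_def)
  qed
  ultimately have "finite {0<..<1::real}" by (rule finite_imageD)
  then show False using infinite_Ioo[of 0 "1::real"] by simp
qed

text \<open>Either the infimum is below \<open>M\<close> and some norm of the class is too, or the
  point is maximal, hence torsion, and its infimum is attained.\<close>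

lemma class_attains_le_M: assumes "x \<in> E" shows "\<exists>a\<in>L. nm (x + a) \<le> M"
proof (cases "infnm x < M")
  case True
  then obtain a where "a \<in> L" "nm (x + a) < M" by (rule infnm_less)
  then show ?thesis by (intro bexI[of _ a]) simp_all
next
  case False
  then have "x \<in> Sc M" using assms by (simp add: Sc_def)
  then obtain a where "a \<in> L" "nm (x + a) = infnm x" by (rule tors_attained[OF max_tors])
  then show ?thesis using infnm_le_M[OF assms] by (intro bexI[of _ a]) simp_all
qed

lemma max_finitely_many_classes:
  "\<exists>F. finite F \<and> F \<subseteq> E \<and> {x\<in>E. infnm x = M} = (\<Union>x\<in>F. {x + a |a. a \<in> L})"
proof (intro exI conjI)
  let ?F = "{x\<in>Sc M. \<forall>i<n. cmod (x i) \<le> R}"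
  show "finite ?F" by (rule finite_max_set)
  show "?F \<subseteq> E" by (auto simp: Sc_def)
  have eq: "{x\<in>E. infnm x = M} = Sc M" using infnm_le_M by (auto simp: Sc_def intro: antisym)
  show "{x\<in>E. infnm x = M} = (\<Union>x\<in>?F. {x + a |a. a \<in> L})"
    unfolding eq
  proof (intro equalityI subsetI)
    fix x assume x: "x \<in> Sc M"
    then have xE: "x \<in> E" by (simp add: Sc_def)
    obtain a where a: "a \<in> L" "\<And>i. i < n \<Longrightarrow> cmod ((x - a) i) \<le> R" "infnm (x - a) = infnm x" "x - a \<in> E"
      using lper_near[OF xE] by blast
    have "x - a \<in> ?F" using x a by (simp add: Sc_def)
    moreover have "x = (x - a) + a" by simp
    ultimately show "x \<in> (\<Union>x\<in>?F. {x + a |a. a \<in> L})" using a(1) by blast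
  next
    fix x assume "x \<in> (\<Union>x\<in>?F. {x + a |a. a \<in> L})"
    then obtain y a where "y \<in> Sc M" "a \<in> L" "x = y + a" by blast
    then show "x \<in> Sc M" using Sc_lper unfolding lper_def by blast
  qed
qed

end

section \<open>Inhomogeneous minima of CM fields\<close>

context complex_field
begin

definition emb_vec :: "'a \<Rightarrow> nat \<Rightarrow> complex" where "emb_vec x = (\<lambda>i. if i < n then \<sigma> i x else 0)"

lemma emb_vec_add: "x \<in> K \<Longrightarrow> y \<in> K \<Longrightarrow> emb_vec (x + y) = emb_vec x + emb_vec y"
  by (rule ext) (simp add: emb_vec_def emb_add[OF emb])

lemma emb_vec_diff: "x \<in> K \<Longrightarrow> y \<in> K \<Longrightarrow> emb_vec (x - y) = emb_vec x - emb_vec y"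
  by (rule ext) (simp add: emb_vec_def emb_diff[OF emb])

lemma emb_vec_mult: "x \<in> K \<Longrightarrow> y \<in> K \<Longrightarrow> emb_vec (x * y) = emb_vec x * emb_vec y"
  by (rule ext) (simp add: emb_vec_def emb_mult[OF emb])

lemma emb_vec_1: "emb_vec 1 = (\<lambda>i. if i < n then 1 else 0)"
  by (rule ext) (simp add: emb_vec_def emb_1[OF emb])

lemma emb_vec_0: "emb_vec 0 = 0"
  by (rule ext) (simp add: emb_vec_def emb_0[OF emb])

lemma emb_vec_inj: assumes "x \<in> K" "y \<in> K" "emb_vec x = emb_vec y" shows "x = y"
proof (rule emb_inj[OF emb[OF n_pos] assms(1,2)])
  show "\<sigma> 0 x = \<sigma> 0 y" using fun_cong[OF assms(3), of 0] n_pos by (simp add: emb_vec_def)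
qed

lemma emb_vec_num_lattice:
  assumes R: "0 < R" "\<And>x :: nat \<Rightarrow> complex. \<exists>a\<in>OK. \<forall>i<n. cmod (x i - \<sigma> i a) \<le> R"
  shows "num_lattice n (emb_vec ` OK) R"
proof
  show "0 < n" by (rule n_pos)
  show "0 < R" by (rule R)
  show "a i = 0" if "a \<in> emb_vec ` OK" "n \<le> i" for a i
    using that by (auto simp: emb_vec_def)
  show "a + b \<in> emb_vec ` OK" if ab: "a \<in> emb_vec ` OK" "b \<in> emb_vec ` OK" for a b
  proof -
    obtain x y where xy: "x \<in> OK" "y \<in> OK" "a = emb_vec x" "b = emb_vec y" using ab by blast
    have "a + b = emb_vec (x + y)" unfolding xy(3,4) by (rule emb_vec_add[OF OK_K OK_K, OF xy(1,2), symmetric])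
    then show ?thesis using OK_ring(2)[OF xy(1,2)] by (simp only: imageI)
  qed
  show "a - b \<in> emb_vec ` OK" if ab: "a \<in> emb_vec ` OK" "b \<in> emb_vec ` OK" for a b
  proof -
    obtain x y where xy: "x \<in> OK" "y \<in> OK" "a = emb_vec x" "b = emb_vec y" using ab by blast
    have "a - b = emb_vec (x - y)" unfolding xy(3,4) by (rule emb_vec_diff[OF OK_K OK_K, OF xy(1,2), symmetric])
    then show ?thesis using OK_ring(3)[OF xy(1,2)] by (simp only: imageI)
  qed
  show "a * b \<in> emb_vec ` OK" if ab: "a \<in> emb_vec ` OK" "b \<in> emb_vec ` OK" for a b
  proof -
    obtain x y where xy: "x \<in> OK" "y \<in> OK" "a = emb_vec x" "b = emb_vec y" using ab by blast
    have "a * b = emb_vec (x * y)" unfolding xy(3,4) by (rule emb_vec_mult[OF OK_K OK_K, OF xy(1,2), symmetric])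
    then show ?thesis using OK_ring(4)[OF xy(1,2)] by (simp only: imageI)
  qed
  show "(\<lambda>i. if i < n then 1 else 0) \<in> emb_vec ` OK"
    unfolding emb_vec_1[symmetric] by (rule imageI[OF OK_ring(1)])
  show "(\<Prod>i<n. (cmod (a i))\<^sup>2) \<in> \<int>" if "a \<in> emb_vec ` OK" for a
    using that OK_norm_Ints by (auto simp: emb_vec_def)
  show "a = 0" if ai: "a \<in> emb_vec ` OK" "i < n" "a i = 0" for a i
  proof -
    obtain x where x: "x \<in> OK" "a = emb_vec x" using ai(1) by blast
    then have "x = 0" using OK_nonzero[OF x(1) ai(2)] ai(2,3) by (simp add: emb_vec_def)
    then show ?thesis using x(2) emb_vec_0 by simp
  qed
  show "\<exists>a\<in>emb_vec ` OK. \<forall>i<n. cmod (x i - a i) \<le> R" if "\<And>i. n \<le> i \<Longrightarrow> x i = 0" for x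
  proof -
    obtain a where a: "a \<in> OK" "\<And>i. i < n \<Longrightarrow> cmod (x i - \<sigma> i a) \<le> R" using R(2) by blast
    show ?thesis by (rule bexI[OF _ imageI[OF a(1)]]) (use a(2) in \<open>simp add: emb_vec_def\<close>)
  qed
qed

section \<open>The units of K and the number of places\<close>

lemma unit_group_mult: "u \<in> unit_group K \<Longrightarrow> v \<in> unit_group K \<Longrightarrow> u * v \<in> unit_group K"
proof -
  assume "u \<in> unit_group K" "v \<in> unit_group K"
  then obtain u' v' where *: "u \<in> OK" "v \<in> OK" "u' \<in> OK" "v' \<in> OK" "u * u' = 1" "v * v' = 1"
    by (auto simp: unit_group_def)
  have "(u * v) * (u' * v') = (u * u') * (v * v')" by (simp only: mult_ac)
  then have "(u * v) * (u' * v') = 1" using * by simp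
  then show ?thesis using * OK_ring(4) unfolding unit_group_def by blast
qed

lemma unit_group_inverse: "u \<in> unit_group K \<Longrightarrow> inverse u \<in> unit_group K"
proof -
  assume "u \<in> unit_group K"
  then obtain v where *: "u \<in> OK" "v \<in> OK" "u * v = 1" by (auto simp: unit_group_def)
  then have "inverse u = v" by (simp add: inverse_unique)
  then show ?thesis using * by (auto simp: unit_group_def mult.commute)
qed

lemma unit_group_power: "u \<in> unit_group K \<Longrightarrow> u ^ k \<in> unit_group K"
proof (induction k)
  case 0
  have "(1::'a) * 1 = 1" by simp
  then show ?case using OK_ring(1) unfolding unit_group_def power_0 by blast
qed (simp add: unit_group_mult)

lemma unit_group_powi: "u \<in> unit_group K \<Longrightarrow> u powi p \<in> unit_group K"
  unfolding power_int_def using unit_group_power unit_group_inverse by simp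

lemma emb_powi: assumes "x \<in> K" "i < n" shows "\<sigma> i (x powi p) = \<sigma> i x powi p"
proof -
  note e = emb[OF assms(2)]
  have "\<sigma> i (inverse x) = inverse (\<sigma> i x)"
    using emb_divide[OF e K_1 assms(1)] emb_1[OF e] by (simp add: inverse_eq_divide)
  then show ?thesis
    unfolding power_int_def using emb_power[OF e assms(1)] emb_power[OF e K_inverse[OF assms(1)]] by simp
qed

text \<open>For \<open>n \<le> 2\<close> the logarithm of a unit at one place bounds it at all places, so suitable
  integer combinations of two units would give infinitely many bounded integers.\<close>

lemma n_ge_3:
  assumes "unit_rank K \<ge> 3"
  shows "3 \<le> n"
proof (rule ccontr)
  assume "\<not> 3 \<le> n"
  then have n2: "n = 1 \<or> n = 2" using n_pos by linarith
  obtain R where R: "0 < R" "\<And>x :: nat \<Rightarrow> complex. \<exists>a\<in>OK. \<forall>i<n. cmod (x i - \<sigma> i a) \<le> R"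
    using OK_near by blast
  interpret L: num_lattice n "emb_vec ` OK" R by (rule emb_vec_num_lattice[OF R])
  obtain u v where u: "u \<in> unit_group K" and v: "v \<in> unit_group K"
    and ind: "\<And>p q. u powi p * v powi q = 1 \<Longrightarrow> p = 0 \<and> q = 0"
    using independent_units[OF assms] by blast
  have UK: "w \<in> K" "w \<in> OK" "w \<noteq> 0" if "w \<in> unit_group K" for w
    using that by (auto simp: unit_group_def ring_of_integers_def)
  define lu where "lu = ln (cmod (\<sigma> 0 u))"
  define lv where "lv = ln (cmod (\<sigma> 0 v))"
  have exl: "cmod (\<sigma> 0 u) = exp lu" "cmod (\<sigma> 0 v) = exp lv"
    using emb_nz[OF emb[OF n_pos] UK(1,3)[OF u]] emb_nz[OF emb[OF n_pos] UK(1,3)[OF v]]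
    by (simp_all add: lu_def lv_def)
  \<comment> \<open>The exponents keep \<open>P k * lu + Q k * lv\<close> within
    \<open>\<bar>lv\<bar>\<close>: for \<open>P k = k\<close> the solution is rounded to an integer
    \<open>Q k\<close>, and if \<open>lv = 0\<close> the powers of \<open>v\<close> alone
    do.\<close>
  define P where "P k = (if lv = 0 then 0 else int k)" for k
  define Q where "Q k = (if lv = 0 then int k else - \<lfloor>real k * lu / lv\<rfloor>)" for k
  define w where "w k = u powi P k * v powi Q k" for k
  have wU: "w k \<in> unit_group K" for k unfolding w_def by (intro unit_group_mult unit_group_powi u v)
  have c0: "cmod (\<sigma> 0 (w k)) = exp (real_of_int (P k) * lu + real_of_int (Q k) * lv)" for k
  proof -
    have "\<sigma> 0 (w k) = \<sigma> 0 u powi P k * \<sigma> 0 v powi Q k"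
      unfolding w_def using emb_mult[OF emb[OF n_pos] UK(1)[OF unit_group_powi[OF u]] UK(1)[OF unit_group_powi[OF v]]]
        emb_powi[OF UK(1)[OF u] n_pos] emb_powi[OF UK(1)[OF v] n_pos] by simp
    then show ?thesis by (simp add: norm_mult norm_power_int exl exp_power_int exp_add)
  qed
  have bnd: "\<bar>real_of_int (P k) * lu + real_of_int (Q k) * lv\<bar> \<le> \<bar>lv\<bar>" for k
  proof (cases "lv = 0")
    case False
    define t where "t = real k * lu / lv"
    have "real k * lu = t * lv" using False by (simp add: t_def)
    then have "real_of_int (P k) * lu + real_of_int (Q k) * lv = (t - of_int \<lfloor>t\<rfloor>) * lv"
      using False by (simp add: P_def Q_def left_diff_distrib flip: t_def)
    moreover have "\<bar>t - of_int \<lfloor>t\<rfloor>\<bar> * \<bar>lv\<bar> \<le> 1 * \<bar>lv\<bar>"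
      by (rule mult_right_mono) linarith+
    ultimately show ?thesis by (simp add: abs_mult)
  qed (simp add: P_def)
  have up: "cmod (\<sigma> 0 (w k)) \<le> exp \<bar>lv\<bar>" and lo: "exp (- \<bar>lv\<bar>) \<le> cmod (\<sigma> 0 (w k))" for k
    unfolding c0 using bnd[of k] by (auto simp: abs_le_iff)
  have bd: "cmod (emb_vec (w k) i) \<le> exp \<bar>lv\<bar>" if i: "i < n" for i k
  proof (cases "i = 0")
    case True
    then show ?thesis using up n_pos by (simp add: emb_vec_def)
  next
    case False
    then have n: "n = 2" "i = 1" using n2 i by auto
    \<comment> \<open>For \<open>n = 2\<close> norm 1 makes the two absolute values reciprocal, so
      the lower bound at place 0 is an upper bound at place 1.\<close>
    obtain w' where w': "w' \<in> OK" "w k * w' = 1" using wU[of k] by (auto simp: unit_group_def)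
    have "emb_vec (w k) * emb_vec w' = L.e"
      unfolding L.e_def emb_vec_1[symmetric] w'(2)[symmetric]
      by (rule emb_vec_mult[symmetric]) (use UK[OF wU] OK_K w' in auto)
    then have "emb_vec (w k) \<in> L.U" unfolding L.U_def using UK(2)[OF wU] w'(1) by blast
    then have "L.nm (emb_vec (w k)) = 1" by (rule L.U_nm)
    then have "(\<Prod>i<n. (cmod (emb_vec (w k) i))\<^sup>2) = 1" unfolding L.nm_def .
    moreover have "{..<n} = {0, 1}" using n(1) by auto
    moreover have "1 < n" using n(1) by simp
    then have "emb_vec (w k) 0 = \<sigma> 0 (w k)" "emb_vec (w k) 1 = \<sigma> 1 (w k)" by (simp_all add: emb_vec_def)
    ultimately have "(cmod (\<sigma> 0 (w k)) * cmod (\<sigma> 1 (w k)))\<^sup>2 = 1"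
      by (simp add: power_mult_distrib)
    then have one: "cmod (\<sigma> 0 (w k)) * cmod (\<sigma> 1 (w k)) = 1"
      by (smt (verit) mult_nonneg_nonneg norm_ge_zero power2_eq_1_iff)
    have "exp (- \<bar>lv\<bar>) * cmod (\<sigma> 1 (w k)) \<le> 1"
      using mult_right_mono[OF lo[of k], of "cmod (\<sigma> 1 (w k))"] one by simp
    then have "cmod (\<sigma> 1 (w k)) \<le> exp \<bar>lv\<bar>" by (simp add: exp_minus field_simps)
    then show ?thesis using n(2) \<open>1 < n\<close> by (simp add: emb_vec_def)
  qed
  have "range (\<lambda>k. emb_vec (w k)) \<subseteq> {a \<in> emb_vec ` OK. \<forall>i<n. cmod (a i) \<le> exp \<bar>lv\<bar>}"
    using bd UK(2)[OF wU] by blast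
  then have "finite (range (\<lambda>k. emb_vec (w k)))" using L.finite_bounded_L finite_subset by blast
  then have "\<not> inj (\<lambda>k. emb_vec (w k))" using range_inj_infinite by blast
  then obtain k l where kl: "k \<noteq> l" "emb_vec (w k) = emb_vec (w l)" by (auto simp: inj_def)
  then have "w k = w l" using emb_vec_inj UK(1)[OF wU] by blast
  then have "u powi (P k - P l) * v powi (Q k - Q l) = 1"
    using UK(3)[OF u] UK(3)[OF v] by (simp add: power_int_diff w_def field_simps)
  then have "P k = P l" "Q k = Q l" using ind by fastforce+
  then show False using kl(1) by (auto simp: P_def Q_def split: if_splits)
qed

lemma emb_vec_cm_lattice:
  assumes R: "0 < R" "\<And>x :: nat \<Rightarrow> complex. \<exists>a\<in>OK. \<forall>i<n. cmod (x i - \<sigma> i a) \<le> R"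
    and n3: "3 \<le> n" and a: "a \<in> OK" "a \<noteq> 0" "\<And>i. i < n \<Longrightarrow> cnj (\<sigma> i a) = - \<sigma> i a"
  shows "cm_lattice n (emb_vec ` OK) R (emb_vec a)"
proof -
  interpret L: num_lattice n "emb_vec ` OK" R by (rule emb_vec_num_lattice[OF R])
  show ?thesis
  proof
    show "3 \<le> n" by (rule n3)
    show "emb_vec a \<in> emb_vec ` OK" using a(1) by (rule imageI)
    show "emb_vec a \<noteq> 0"
    proof
      assume "emb_vec a = 0"
      then have "emb_vec a = emb_vec 0" by (simp only: emb_vec_0)
      then show False using emb_vec_inj[OF OK_K[OF a(1)] K_0] a(2) by simp
    qed
    show "cnj (emb_vec a i) = - emb_vec a i" for i using a(3) by (simp add: emb_vec_def)
    show "(\<lambda>i. cnj (b i)) \<in> emb_vec ` OK" if b: "b \<in> emb_vec ` OK" for b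
    proof -
      obtain x where x: "x \<in> OK" "b = emb_vec x" using b by blast
      obtain y where y: "y \<in> OK" "\<forall>i<n. \<sigma> i y = cnj (\<sigma> i x)" using OK_cnj[OF x(1)] by blast
      have "(\<lambda>i. cnj (b i)) = emb_vec y" by (rule ext) (use x y in \<open>simp add: emb_vec_def\<close>)
      then show ?thesis using y(1) by blast
    qed
    show "\<exists>c\<in>emb_vec ` OK. \<forall>i<n. b i * c i = of_real (\<Prod>i<n. (cmod (b i))\<^sup>2)" if b: "b \<in> emb_vec ` OK" for b
    proof -
      obtain x where x: "x \<in> OK" "b = emb_vec x" using b by blast
      obtain y where y: "y \<in> OK" "\<forall>i<n. \<sigma> i x * \<sigma> i y = of_real (\<Prod>i<n. (cmod (\<sigma> i x))\<^sup>2)"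
        using OK_adj[OF x(1)] by blast
      show ?thesis by (rule bexI[OF _ imageI[OF y(1)]]) (use x y in \<open>simp add: emb_vec_def\<close>)
    qed
  qed
qed

end

lemma CM_complex_field:
  fixes K :: "'a::field_char_0 set"
  assumes "CM_field K" "embedding_system K r\<^sub>1 r\<^sub>2 \<sigma>"
  shows "r\<^sub>1 = 0" "complex_field K (SOME bs. is_rat_basis K bs) r\<^sub>2 \<sigma>"
proof -
  obtain F where F: "number_field F" "totally_real F" "quadratic_extension F K"
    and tc: "totally_complex K" and nf: "number_field K"
    using assms(1) by (auto simp: CM_field_def)
  interpret field_set K using nf by unfold_locales (simp add: number_field_def)
  have nonreal: "is_nonreal_embedding K \<theta>" if "is_embedding K \<theta>" for \<theta>
    using tc that by (simp add: totally_complex_def)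
  note es = assms(2)[unfolded embedding_system_def]
  show r0: "r\<^sub>1 = 0"
  proof (rule ccontr)
    assume "r\<^sub>1 \<noteq> 0"
    then have "is_real_embedding K (\<sigma> 0)" using es by auto
    then show False using nonreal[of "\<sigma> 0"] by (auto simp: is_real_embedding_def is_nonreal_embedding_def)
  qed
  have emb: "is_embedding K (\<sigma> i)" if "i < r\<^sub>2" for i
    using es that r0 by (auto simp: is_nonreal_embedding_def)
  have uniq: "\<exists>!i. i \<in> {0..<r\<^sub>2} \<and> ((\<forall>x\<in>K. \<theta> x = \<sigma> i x) \<or> (\<forall>x\<in>K. \<theta> x = cnj (\<sigma> i x)))"
    if "is_embedding K \<theta>" for \<theta>
    using es nonreal[OF that] r0 by simp
  \<comment> \<open>Uniqueness of the representing index separates the embeddings from each other;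
    for \<open>i = j\<close> an agreement with the conjugate would make \<open>\<sigma> i\<close>
    real.\<close>
  have same: "i = j" if "i < r\<^sub>2" "j < r\<^sub>2" "(\<forall>x\<in>K. \<sigma> i x = \<sigma> j x) \<or> (\<forall>x\<in>K. \<sigma> i x = cnj (\<sigma> j x))" for i j
    using ex1_implies_ex[OF uniq[OF emb[OF that(1)]]] uniq[OF emb[OF that(1)]] that by (metis atLeastLessThan_iff zero_le)
  show "complex_field K (SOME bs. is_rat_basis K bs) r\<^sub>2 \<sigma>"
  proof
    show "is_rat_basis K (SOME bs. is_rat_basis K bs)"
      using number_field_basis_exists[OF nf] by (metis someI)
    show "is_embedding K (\<sigma> i)" if "i < r\<^sub>2" for i by (rule emb[OF that])
    show "\<exists>i<r\<^sub>2. (\<forall>x\<in>K. \<theta> x = \<sigma> i x) \<or> (\<forall>x\<in>K. \<theta> x = cnj (\<sigma> i x))" if "is_embedding K \<theta>" for \<theta>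
      using ex1_implies_ex[OF uniq[OF that]] by auto
    show "\<exists>x\<in>K. \<sigma> i x \<noteq> \<sigma> j x" if "i < r\<^sub>2" "j < r\<^sub>2" "i \<noteq> j" for i j
      using same[OF that(1,2)] that(3) by blast
    show "\<exists>x\<in>K. \<sigma> i x \<noteq> cnj (\<sigma> j x)" if "i < r\<^sub>2" "j < r\<^sub>2" for i j
    proof (rule ccontr)
      assume neg: "\<not> ?thesis"
      then have "i = j" using same[OF that] by blast
      then have "\<sigma> i x \<in> \<real>" if "x \<in> K" for x using neg that by (auto simp: Reals_cnj_iff)
      then show False using nonreal[OF emb[OF that(1)]] by (auto simp: is_nonreal_embedding_def)
    qed
    show "\<exists>y\<in>K. \<forall>i<r\<^sub>2. \<sigma> i y = cnj (\<sigma> i x)" if "x \<in> K" for x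
    proof -
      have "is_subfield F" using F(1) by (simp add: number_field_def)
      from quadratic_conjugate[OF this F(2,3) tc that] show ?thesis using emb by blast
    qed
  qed simp
qed

theorem corollary1p5:
  fixes K :: "'a::field_char_0 set"
    and r\<^sub>1 r\<^sub>2 :: nat
    and \<sigma> :: "nat \<Rightarrow> 'a \<Rightarrow> complex"
  assumes "CM_field K"
    and "unit_rank K \<ge> 3"
    and "embedding_system K r\<^sub>1 r\<^sub>2 \<sigma>"
  shows "minimum_attained K r\<^sub>1 r\<^sub>2 \<sigma>
    \<and> euclidean_minimum K isolated_in inhom_spectrum K r\<^sub>1 r\<^sub>2 \<sigma>
    \<and> {z \<in> Kbar r\<^sub>1 r\<^sub>2. m_Kbar K r\<^sub>1 r\<^sub>2 \<sigma> z = euclidean_minimum K} \<subseteq> to_Kbar r\<^sub>1 r\<^sub>2 \<sigma> ` K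
    \<and> (\<exists>R. finite R \<and> R \<subseteq> Kbar r\<^sub>1 r\<^sub>2 \<and>
          {z \<in> Kbar r\<^sub>1 r\<^sub>2. m_Kbar K r\<^sub>1 r\<^sub>2 \<sigma> z = euclidean_minimum K}
            = (\<Union>x\<in>R. residue_class K r\<^sub>1 r\<^sub>2 \<sigma> x))"
proof -
  define n where "n = r\<^sub>2"
  have r: "r\<^sub>1 = 0" "r\<^sub>2 = n" using CM_complex_field(1)[OF assms(1,3)] by (simp_all add: n_def)
  interpret F: complex_field K "SOME bs. is_rat_basis K bs" n \<sigma>
    using CM_complex_field(2)[OF assms(1,3)] by (simp add: n_def)
  obtain R where R: "0 < R" "\<And>x :: nat \<Rightarrow> complex. \<exists>a\<in>F.OK. \<forall>i<n. cmod (x i - \<sigma> i a) \<le> R"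
    using F.OK_near by blast
  obtain a0 where a0: "a0 \<in> F.OK" "a0 \<noteq> 0" "\<And>i. i < n \<Longrightarrow> cnj (\<sigma> i a0) = - \<sigma> i a0"
    using F.OK_imaginary by blast
  interpret L: cm_lattice n "F.emb_vec ` F.OK" R "F.emb_vec a0"
    by (rule F.emb_vec_cm_lattice[OF R F.n_ge_3[OF assms(2)] a0])
  have Kb: "Kbar r\<^sub>1 r\<^sub>2 = L.E" by (simp add: Kbar_def L.E_def r)
  have toK: "to_Kbar r\<^sub>1 r\<^sub>2 \<sigma> = F.emb_vec" by (intro ext) (simp add: to_Kbar_def F.emb_vec_def r)
  have rc: "residue_class K r\<^sub>1 r\<^sub>2 \<sigma> x = {x + a |a. a \<in> F.emb_vec ` F.OK}" for x
    unfolding residue_class_def toK plus_fun_def by blast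
  have nmK: "\<bar>norm_Kbar r\<^sub>1 r\<^sub>2 y\<bar> = L.nm y" for y
    by (simp add: norm_Kbar_def L.nm_def r lessThan_atLeast0 prod_nonneg)
  have mK: "m_Kbar K r\<^sub>1 r\<^sub>2 \<sigma> x = L.infnm x" for x
  proof -
    have "residue_class K r\<^sub>1 r\<^sub>2 \<sigma> x = (\<lambda>a. x + a) ` (F.emb_vec ` F.OK)" unfolding rc by blast
    then show ?thesis unfolding m_Kbar_def nmK L.infnm_def by (simp only: image_image)
  qed
  have nfm: "\<bar>of_rat (field_norm K y)\<bar> = L.nm (F.emb_vec y)" if "y \<in> K" for y
    unfolding F.field_norm_real[OF that] by (simp add: L.nm_def F.emb_vec_def prod_nonneg)
  have inner: "(INF y\<in>{x + a |a. a \<in> F.OK}. \<bar>of_rat (field_norm K y)\<bar>) = L.infnm (F.emb_vec x)" if x: "x \<in> K" for x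
  proof -
    have eq: "{x + a |a. a \<in> F.OK} = (\<lambda>a. x + a) ` F.OK" by blast
    have val: "\<bar>of_rat (field_norm K (x + a))\<bar> = L.nm (F.emb_vec x + F.emb_vec a)" if "a \<in> F.OK" for a
      using nfm[OF F.K_add[OF x F.OK_K[OF that]]] F.emb_vec_add[OF x F.OK_K[OF that]] by simp
    show ?thesis
      unfolding eq L.infnm_def image_image by (intro arg_cong[of _ _ Inf] image_cong refl val)
  qed
  \<comment> \<open>The lattice vector can be divided by \<open>m\<close> inside \<open>K\<close>,
    so torsion points come from the field.\<close>
  have tors_K: "\<exists>y\<in>K. x = F.emb_vec y" if x: "x \<in> L.tors" for x
  proof -
    obtain m where m: "0 < m" "of_nat m * x \<in> F.emb_vec ` F.OK" "x \<in> L.E" using x by (auto simp: L.tors_def)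
    then obtain a where a: "a \<in> F.OK" "of_nat m * x = F.emb_vec a" by blast
    have aK: "a / of_nat m \<in> K" by (intro F.K_divide F.K_of_nat F.OK_K a)
    have "x = F.emb_vec (a / of_nat m)"
    proof (rule ext)
      fix i
      have e: "of_nat m * x i = F.emb_vec a i" using fun_cong[OF a(2), of i] by simp
      show "x i = F.emb_vec (a / of_nat m) i"
      proof (cases "i < n")
        case True
        then have "\<sigma> i (a / of_nat m) = \<sigma> i a / of_nat m"
          using F.emb_divide[OF F.emb[OF True] F.OK_K[OF a(1)] F.K_of_nat] F.emb_of_nat[OF F.emb[OF True]] by simp
        then have "of_nat m * \<sigma> i (a / of_nat m) = \<sigma> i a" using m(1) by simp
        then have "of_nat m * x i = of_nat m * \<sigma> i (a / of_nat m)" using e True by (simp add: F.emb_vec_def)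
        then show ?thesis using m(1) True by (simp add: F.emb_vec_def)
      next
        case False
        then show ?thesis using m(3) by (simp add: L.E_def F.emb_vec_def)
      qed
    qed
    then show ?thesis using aK by blast
  qed
  have vE: "F.emb_vec x \<in> L.E" for x by (simp add: L.E_def F.emb_vec_def)
  obtain x0 where x0: "x0 \<in> L.E" "L.infnm x0 = L.M" using L.M_attained by blast
  then have "x0 \<in> L.Sc L.M" by (simp add: L.Sc_def)
  then obtain y0 where y0: "y0 \<in> K" "x0 = F.emb_vec y0" using tors_K L.max_tors by blast
  \<comment> \<open>The supremum over \<open>K\<close> reaches the one over \<open>L.E\<close>
    because the maximal point \<open>x0\<close> is torsion and thus the image of
    \<open>y0\<close>.\<close>
  have EM: "euclidean_minimum K = L.M"
  proof -
    have "euclidean_minimum K = (SUP x\<in>K. L.infnm (F.emb_vec x))"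
      unfolding euclidean_minimum_def using inner by (intro SUP_cong) auto
    also have "\<dots> = L.M"
    proof (rule antisym)
      show "(SUP x\<in>K. L.infnm (F.emb_vec x)) \<le> L.M"
        by (rule cSUP_least) (use y0 L.infnm_le_M[OF vE] in auto)
      show "L.M \<le> (SUP x\<in>K. L.infnm (F.emb_vec x))"
        by (rule cSUP_upper2[OF _ y0(1)]) (use x0 y0 L.infnm_le_M[OF vE] in \<open>auto intro!: bdd_aboveI\<close>)
    qed
    finally show ?thesis .
  qed
  have "minimum_attained K r\<^sub>1 r\<^sub>2 \<sigma>"
    unfolding minimum_attained_def Kb EM rc nmK using L.class_attains_le_M by blast
  moreover have "L.M isolated_in (L.infnm ` L.E)"
  proof -
    obtain \<epsilon> where \<epsilon>: "0 < \<epsilon>" "\<forall>x\<in>L.E. L.M - \<epsilon> < L.infnm x \<longrightarrow> L.infnm x = L.M" using L.M_isolated by blast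
    \<comment> \<open>An open half line suffices as neighbourhood, since the gap condition applies
      to all larger values as well.\<close>
    have "{L.M - \<epsilon><..} \<inter> L.infnm ` L.E = {L.M}" using \<epsilon> x0 by (auto intro!: image_eqI[of _ _ x0])
    then show ?thesis unfolding isolated_in_def using x0 by (metis image_eqI open_greaterThan)
  qed
  then have "euclidean_minimum K isolated_in inhom_spectrum K r\<^sub>1 r\<^sub>2 \<sigma>"
    unfolding EM inhom_spectrum_def Kb mK .
  moreover have "{z \<in> Kbar r\<^sub>1 r\<^sub>2. m_Kbar K r\<^sub>1 r\<^sub>2 \<sigma> z = euclidean_minimum K} \<subseteq> to_Kbar r\<^sub>1 r\<^sub>2 \<sigma> ` K"
    unfolding Kb mK EM toK
  proof
    fix z assume "z \<in> {z \<in> L.E. L.infnm z = L.M}"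
    then have "z \<in> L.Sc L.M" by (simp add: L.Sc_def)
    then show "z \<in> F.emb_vec ` K" using tors_K L.max_tors by blast
  qed
  moreover have "\<exists>R. finite R \<and> R \<subseteq> Kbar r\<^sub>1 r\<^sub>2 \<and>
          {z \<in> Kbar r\<^sub>1 r\<^sub>2. m_Kbar K r\<^sub>1 r\<^sub>2 \<sigma> z = euclidean_minimum K}
            = (\<Union>x\<in>R. residue_class K r\<^sub>1 r\<^sub>2 \<sigma> x)"
    unfolding Kb mK EM rc by (rule L.max_finitely_many_classes)
  ultimately show ?thesis by blast
qed

end
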